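(* A hyperbolic PDE $\Sigma\subset J^2=J^2(\mathbb{R}^2,\mathbb{R})$ is (a) Monge–Ampère if and only if for every $\xi\in J^1$ the surface $\Sigma|_\xi\subset J^2|_\xi$ is (an open subset of) an indefinite sphere; (b) Goursat if and only if for every $\xi\in J^1$ the surface $\Sigma|_\xi\subset J^2|_\xi$ is singly-ruled by null geodesics; (c) 2-elliptic if and only if for every $\xi\in J^1$ the surface $\Sigma|_\xi\subset J^2|_\xi$ is 2-elliptic ($\epsilon=+1$); (d) 2-hyperbolic if and only if for every $\xi\in J^1$ the surface $\Sigma|_\xi\subset J^2|_\xi$ is 2-hyperbolic ($\epsilon=-1$); where (c) and (d) are the definitions of 2-elliptic and 2-hyperbolic PDE. These four classes of PDE are contact-invariant and mutually contact-inequivalent.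
   Context: $J^1=J^1(\mathbb{R}^2,\mathbb{R})$ has local coordinates $(x,y,z,p,q)$ and contact distribution $C=\{dz-p\,dx-q\,dy=0\}$, with symplectic form $\eta=dx\wedge dp+dy\wedge dq$ on $C$ defined up to scale. $J^2$ is the bundle $\pi^2_1:J^2\to J^1$ with fibre $J^2|_\xi=LG(C_\xi,[\eta])$ (2-dimensional isotropic subspaces), with standard coordinates $(x,y,z,p,q,r,s,t)$, where $(r,s,t)$ corresponds to $\mathrm{span}\{\partial_x+p\partial_z+r\partial_p+s\partial_q,\ \partial_y+q\partial_z+s\partial_p+t\partial_q\}$. A contact transformation of $J^2$ is a local diffeomorphism preserving the canonical system $\{dz-p\,dx-q\,dy=dp-r\,dx-s\,dy=dq-s\,dx-t\,dy=0\}$. A PDE is a hypersurface $\Sigma=\{F=0\}\subset J^2$, transverse to $\pi^2_1$ with $\pi^2_1|_\Sigma$ a submersion; $\Sigma|_\xi=\Sigma\cap J^2|_\xi$. It is hyperbolic if $\Delta=F_rF_t-\frac14F_s^2<0$ on $\Sigma$. Assume (replacing $F$ by $-F$ if needed) $F_s\ge0$ at a given point, put $\lambda_+=\frac{F_s}{2}+\sqrt{-\Delta}$ and $$I_1^{(T)}=\det\begin{pmatrix}F_r&F_s&F_t\\ \lambda_+&F_t&0\\ (F_t/\lambda_+)_r&(F_t/\lambda_+)_s&(F_t/\lambda_+)_t\end{pmatrix},\quad I_2^{(T)}=\det\begin{pmatrix}0&F_r&\lambda_+\\ F_r&F_s&F_t\\ (F_r/\lambda_+)_r&(F_r/\lambda_+)_s&(F_r/\lambda_+)_t\end{pmatrix}.$$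 Evaluated on $\Sigma$, a hyperbolic PDE is: Monge–Ampère if $I_1^{(T)}=I_2^{(T)}=0$ (equivalently of the form $a(rt-s^2)+br+cs+dt+e=0$ with coefficients functions of $(x,y,z,p,q)$); Goursat if exactly one of $I_1^{(T)},I_2^{(T)}$ vanishes; generic if both are nonzero. Fibre geometry: each fibre $J^2|_\xi$ is identified, via a conformal symplectic basis of $C_\xi$, with $LG(2,4)$, on which $CSp(4,\mathbb{R})$ acts. $LG(2,4)$ is identified with the quadric $\mathcal{Q}=\{[z]\in\mathbb{P}V:\langle z,z\rangle=0\}$, $V=\mathbb{R}^5$, $\langle z,w\rangle=-z_0w_4-z_4w_0+z_1w_3+z_3w_1-2z_2w_2$, with $(r,s,t)\leftrightarrow[1,r,s,t,rt-s^2]$; it carries the invariant conformal Lorentzian structure represented by $dr\,dt-ds^2$. A surface in it is hyperbolic if each tangent plane contains exactly two null lines (each $\Sigma|_\xi$ is hyperbolic when $\Sigma$ is). For a hyperbolic surface $M$, choose locally a lift $\mathbf x:M\to V\setminus\{0\}$, linearly independent null tangent fields $N_1,N_2$, and $\mathbf n:M\to V$ with $\langle\mathbf n,\mathbf n\rangle=-2$, $\langle\mathbf n,\mathbf x\rangle=0$, $\langle\mathbf n,d\mathbf x\rangle=0$; set $\ell_i=\langle N_i(N_i\mathbf x),\mathbf n\rangle$. $M$ is singly-ruled by null geodesics (2-parabolic) if exactly one of $\ell_1,\ell_2$ is zero; 2-elliptic if $\epsilon:=\mathrm{sgn}(\ell_1\ell_2)=+1$; 2-hyperbolic if $\epsilon=-1$.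 An indefinite sphere is a set $\mathbb{P}(z^\perp)\cap\mathcal{Q}$ with $\langle z,z\rangle<0$.
   Formalization: In (a), each connected component of Σ|_ξ (rather than all of Σ|_ξ) is shown to be an open subset of an indefinite sphere; for disconnected fibres the literal claim fails, e.g. s(s−1)=0 has I_1=I_2=0 but its fibres lie on two spheres. *)

theory Defs
  imports "HOL-Analysis.Analysis"
begin

section \<open>Calculus\<close>

definition along :: "('a::real_normed_vector \<Rightarrow> 'a) \<Rightarrow> ('a \<Rightarrow> 'b::real_normed_vector) \<Rightarrow> 'a \<Rightarrow> 'b" where
  "along N f = (\<lambda>u. frechet_derivative f (at u) (N u))"

primrec Ck :: "nat \<Rightarrow> 'a::euclidean_space set \<Rightarrow> ('a \<Rightarrow> 'b::real_normed_vector) \<Rightarrow> bool" where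
  "Ck 0 S f \<longleftrightarrow> continuous_on S f"
| "Ck (Suc k) S f \<longleftrightarrow> (\<forall>x\<in>S. f differentiable (at x)) \<and> (\<forall>b\<in>Basis. Ck k S (along (\<lambda>_. b) f))"

text \<open>Only used on open sets.\<close>

definition smooth_on :: "'a::euclidean_space set \<Rightarrow> ('a \<Rightarrow> 'b::real_normed_vector) \<Rightarrow> bool" where
  "smooth_on S f \<longleftrightarrow> (\<forall>k. Ck k S f)"


section \<open>The jet spaces\<close>

text \<open>
  A point of \<open>J\<^sup>1\<close> is \<open>(x, y, z, p, q)\<close>; a tangent vector is written in the coordinate frame, so it
  has the same type.  A point of \<open>J\<^sup>2\<close> is given by its standard coordinates
  \<open>((x, y, z, p, q), (r, s, t))\<close>, and \<open>fst\<close> is the projection to \<open>J\<^sup>1\<close>.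
\<close>

type_synonym jet1 = "real \<times> real \<times> real \<times> real \<times> real"
type_synonym jet2 = "jet1 \<times> real \<times> real \<times> real"

fun contact_plane :: "jet1 \<Rightarrow> jet1 set" where
  "contact_plane (x, y, z, p, q) = {(dx, dy, dz, dp, dq). dz - p * dx - q * dy = 0}"

fun symp :: "jet1 \<Rightarrow> jet1 \<Rightarrow> real" where
  "symp (x1, y1, z1, p1, q1) (x2, y2, z2, p2, q2) = (x1 * p2 - p1 * x2) + (y1 * q2 - q1 * y2)"

definition LG :: "jet1 \<Rightarrow> jet1 set set" where
  "LG \<xi> = {L. subspace L \<and> dim L = 2 \<and> L \<subseteq> contact_plane \<xi> \<and> (\<forall>v\<in>L. \<forall>w\<in>L. symp v w = 0)}"

fun lagr :: "jet1 \<Rightarrow> real \<times> real \<times> real \<Rightarrow> jet1 set" where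
  "lagr (x, y, z, p, q) (r, s, t) = span {(1, 0, p, r, s), (0, 1, q, s, t)}"

definition fibre :: "jet2 set \<Rightarrow> jet1 \<Rightarrow> jet1 set set" where
  "fibre \<Sigma> \<xi> = {L \<in> LG \<xi>. \<exists>u. (\<xi>, u) \<in> \<Sigma> \<and> L = lagr \<xi> u}"

text \<open>The connected components of a fibre; the map \<open>lagr \<xi>\<close> is the standard chart of \<open>LG \<xi>\<close>.\<close>

definition fibre_components :: "jet2 set \<Rightarrow> jet1 \<Rightarrow> jet1 set set set" where
  "fibre_components \<Sigma> \<xi> = (\<lambda>C. lagr \<xi> ` C) ` components {u. (\<xi>, u) \<in> \<Sigma>}"

fun canonical_system :: "jet2 \<Rightarrow> jet2 set" where
  "canonical_system ((x, y, z, p, q), (r, s, t)) =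
    {((dx, dy, dz, dp, dq), (dr, ds, dt)).
       dz - p * dx - q * dy = 0 \<and> dp - r * dx - s * dy = 0 \<and> dq - s * dx - t * dy = 0}"

definition contact_transformation :: "jet2 set \<Rightarrow> jet2 set \<Rightarrow> (jet2 \<Rightarrow> jet2) \<Rightarrow> bool" where
  "contact_transformation W W' \<Phi> \<longleftrightarrow>
     open W \<and> open W' \<and> bij_betw \<Phi> W W' \<and> smooth_on W \<Phi> \<and> smooth_on W' (inv_into W \<Phi>) \<and>
     (\<forall>m\<in>W. frechet_derivative \<Phi> (at m) ` canonical_system m = canonical_system (\<Phi> m))"


section \<open>Hyperbolic PDE\<close>

abbreviation d_r :: "(jet2 \<Rightarrow> real) \<Rightarrow> jet2 \<Rightarrow> real" where "d_r \<equiv> along (\<lambda>_. (0, 1, 0, 0))"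
abbreviation d_s :: "(jet2 \<Rightarrow> real) \<Rightarrow> jet2 \<Rightarrow> real" where "d_s \<equiv> along (\<lambda>_. (0, 0, 1, 0))"
abbreviation d_t :: "(jet2 \<Rightarrow> real) \<Rightarrow> jet2 \<Rightarrow> real" where "d_t \<equiv> along (\<lambda>_. (0, 0, 0, 1))"

text \<open>
  \<open>\<Sigma>\<close> is the regular zero set of \<open>F\<close>, and the differential of \<open>\<Sigma> \<rightarrow> J\<^sup>1\<close> maps each tangent space
  \<open>ker dF\<close> onto the tangent space of \<open>J\<^sup>1\<close>; for a hypersurface this is the same as
  transversality to the fibres of \<open>J\<^sup>2 \<rightarrow> J\<^sup>1\<close>.
\<close>

definition pde :: "jet2 set \<Rightarrow> (jet2 \<Rightarrow> real) \<Rightarrow> jet2 set \<Rightarrow> bool" where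
  "pde U F \<Sigma> \<longleftrightarrow>
     open U \<and> smooth_on U F \<and> \<Sigma> = {m \<in> U. F m = 0} \<and>
     (\<forall>m\<in>\<Sigma>. (\<exists>v. frechet_derivative F (at m) v \<noteq> 0) \<and>
             fst ` {v. frechet_derivative F (at m) v = 0} = UNIV)"

definition discr :: "(jet2 \<Rightarrow> real) \<Rightarrow> jet2 \<Rightarrow> real" where
  "discr F m = d_r F m * d_t F m - 1/4 * (d_s F m)\<^sup>2"

definition hyperbolic_pde :: "jet2 set \<Rightarrow> (jet2 \<Rightarrow> real) \<Rightarrow> jet2 set \<Rightarrow> bool" where
  "hyperbolic_pde U F \<Sigma> \<longleftrightarrow> pde U F \<Sigma> \<and> (\<forall>m\<in>\<Sigma>. discr F m < 0)"

definition lambda_plus :: "(jet2 \<Rightarrow> real) \<Rightarrow> jet2 \<Rightarrow> real" where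
  "lambda_plus F m = d_s F m / 2 + sqrt (- discr F m)"

definition I1 :: "(jet2 \<Rightarrow> real) \<Rightarrow> jet2 \<Rightarrow> real" where
  "I1 F m = (let f = (\<lambda>m. d_t F m / lambda_plus F m) in
     det (vector [vector [d_r F m, d_s F m, d_t F m],
                  vector [lambda_plus F m, d_t F m, 0],
                  vector [d_r f m, d_s f m, d_t f m]] :: real^3^3))"

definition I2 :: "(jet2 \<Rightarrow> real) \<Rightarrow> jet2 \<Rightarrow> real" where
  "I2 F m = (let f = (\<lambda>m. d_r F m / lambda_plus F m) in
     det (vector [vector [0, d_r F m, lambda_plus F m],
                  vector [d_r F m, d_s F m, d_t F m],
                  vector [d_r f m, d_s f m, d_t f m]] :: real^3^3))"

text \<open>
  The sign of \<open>F\<close> is normalised separately at each point, so that \<open>F\<^sub>s \<ge> 0\<close> there.  (Where \<open>F\<^sub>s = 0\<close>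
  both signs are admissible; changing the sign then exchanges the vanishing of the two invariants,
  to which the classes below are insensitive.)
\<close>

definition oriented :: "(jet2 \<Rightarrow> real) \<Rightarrow> jet2 \<Rightarrow> jet2 \<Rightarrow> real" where
  "oriented F m = (if d_s F m \<ge> 0 then F else (\<lambda>m'. - F m'))"

definition monge_ampere :: "(jet2 \<Rightarrow> real) \<Rightarrow> jet2 set \<Rightarrow> bool" where
  "monge_ampere F \<Sigma> \<longleftrightarrow> (\<forall>m\<in>\<Sigma>. I1 (oriented F m) m = 0 \<and> I2 (oriented F m) m = 0)"

definition goursat :: "(jet2 \<Rightarrow> real) \<Rightarrow> jet2 set \<Rightarrow> bool" where
  "goursat F \<Sigma> \<longleftrightarrow> (\<forall>m\<in>\<Sigma>. (I1 (oriented F m) m = 0) \<noteq> (I2 (oriented F m) m = 0))"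


section \<open>Surfaces in the Lagrangian Grassmannian\<close>

text \<open>
  A subset of the projective space of \<open>V = \<real>\<^sup>5\<close> is represented by the cone of all nonzero vectors that
  represent its points; it carries the quotient topology, so relative openness of a set and of its
  cone are the same thing.
\<close>

type_synonym vec = "real \<times> real \<times> real \<times> real \<times> real"

fun quad :: "vec \<Rightarrow> vec \<Rightarrow> real" where
  "quad (z0, z1, z2, z3, z4) (w0, w1, w2, w3, w4) =
     - z0 * w4 - z4 * w0 + z1 * w3 + z3 * w1 - 2 * z2 * w2"

text \<open>
  With \<open>m\<^sub>i\<^sub>j\<close> the Pluecker coordinates in the conformal symplectic basis
  \<open>(\<partial>\<^sub>x + p \<partial>\<^sub>z, \<partial>\<^sub>y + q \<partial>\<^sub>z, \<partial>\<^sub>p, \<partial>\<^sub>q)\<close> of the contact plane, the point of the quadric that corresponds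
  to a Lagrangian plane is \<open>[m\<^sub>1\<^sub>2, m\<^sub>3\<^sub>2, m\<^sub>1\<^sub>3, m\<^sub>1\<^sub>4, m\<^sub>3\<^sub>4]\<close>.
\<close>

fun pluecker :: "jet1 \<Rightarrow> jet1 \<Rightarrow> vec" where
  "pluecker (x1, y1, z1, p1, q1) (x2, y2, z2, p2, q2) =
     (x1 * y2 - y1 * x2, p1 * y2 - y1 * p2, x1 * p2 - p1 * x2, x1 * q2 - q1 * x2, p1 * q2 - q1 * p2)"

definition quadric_cone :: "jet1 set set \<Rightarrow> vec set" where
  "quadric_cone M = {pluecker v w | v w. \<exists>L\<in>M. v \<in> L \<and> w \<in> L} - {0}"

lemma lagr_eq:
  "lagr (x, y, z, p, q) (r, s, t) = {(a, b, a * p + b * q, a * r + b * s, a * s + b * t) | a b. True}"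
  by (force simp: span_insert span_singleton algebra_simps span_breakdown_eq)

lemma lagr_in_LG: "lagr \<xi> u \<in> LG \<xi>"
proof -
  obtain x y z p q where \<xi>: "\<xi> = (x, y, z, p, q)" by (cases \<xi>) auto
  obtain r s t where u: "u = (r, s, t)" by (cases u) auto
  let ?v = "(1, 0, p, r, s) :: jet1" and ?w = "(0, 1, q, s, t) :: jet1"
  have "independent {?v, ?w}"
    by (auto simp: independent_insert span_singleton zero_prod_def)
  then have "dim (lagr \<xi> u) = 2"
    using dim_eq_card_independent[of "{?v, ?w}"] by (simp add: \<xi> u)
  moreover have "subspace (lagr \<xi> u)"
    by (simp add: \<xi> u)
  moreover have "lagr \<xi> u \<subseteq> contact_plane \<xi>"
    unfolding \<xi> u lagr_eq by (auto simp: algebra_simps)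
  moreover have "\<forall>v\<in>lagr \<xi> u. \<forall>w\<in>lagr \<xi> u. symp v w = 0"
    unfolding \<xi> u lagr_eq by (auto simp: algebra_simps)
  ultimately show ?thesis
    by (simp add: LG_def)
qed

lemma quadric_cone_lagr:
  "quadric_cone {lagr \<xi> (r, s, t)} = {c *\<^sub>R (1, r, s, t, r * t - s\<^sup>2) | c. c \<noteq> 0}"
  (is "?A = ?B")
proof -
  obtain x y z p q where \<xi>: "\<xi> = (x, y, z, p, q)" by (cases \<xi>) auto
  have pl: "pluecker (a, b, a * p + b * q, a * r + b * s, a * s + b * t)
        (c, d, c * p + d * q, c * r + d * s, c * s + d * t) =
      (a * d - b * c) *\<^sub>R (1, r, s, t, r * t - s\<^sup>2)" for a b c d
    by (simp add: algebra_simps power2_eq_square)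
  have "?A \<subseteq> ?B"
    unfolding quadric_cone_def \<xi> lagr_eq by (fastforce simp: pl simp del: pluecker.simps scaleR_Pair)
  moreover have "?B \<subseteq> ?A"
  proof
    fix X assume "X \<in> ?B"
    then obtain c where c: "c \<noteq> 0" "X = c *\<^sub>R (1, r, s, t, r * t - s\<^sup>2)" by blast
    let ?v = "(c, 0, c * p + 0 * q, c * r + 0 * s, c * s + 0 * t)"
    let ?w = "(0, 1, 0 * p + 1 * q, 0 * r + 1 * s, 0 * s + 1 * t)"
    have "X = pluecker ?v ?w" unfolding pl by (simp add: c)
    moreover have "?v \<in> lagr \<xi> (r, s, t)" "?w \<in> lagr \<xi> (r, s, t)"
      unfolding \<xi> lagr_eq by blast+
    moreover have "X \<noteq> 0" using c by (simp add: zero_prod_def)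
    ultimately show "X \<in> ?A"
      unfolding quadric_cone_def by blast
  qed
  ultimately show ?thesis by blast
qed

definition sphere_cone :: "vec \<Rightarrow> vec set" where
  "sphere_cone z = {w. w \<noteq> 0 \<and> quad w w = 0 \<and> quad w z = 0}"

definition open_in_indefinite_sphere :: "vec set \<Rightarrow> bool" where
  "open_in_indefinite_sphere A \<longleftrightarrow> (\<exists>z. quad z z < 0 \<and> openin (top_of_set (sphere_cone z)) A)"

text \<open>
  A moving frame on an open piece of the surface with cone \<open>M\<close>.  The piece is parametrised by
  \<open>D \<subseteq> \<real>\<^sup>2\<close>: \<open>X\<close> is the lift composed with the parametrisation, which is an injective
  immersion into the projective space with relatively open image, and tangent fields
  are vector fields on \<open>D\<close>.  The null directions of each tangent plane form exactly the two lines
  spanned by \<open>N1\<close> and \<open>N2\<close>, which is hyperbolicity of the surface.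
\<close>

definition moving_frame ::
  "vec set \<Rightarrow> (real \<times> real) set \<Rightarrow> (real \<times> real \<Rightarrow> vec) \<Rightarrow> (real \<times> real \<Rightarrow> real \<times> real) \<Rightarrow>
   (real \<times> real \<Rightarrow> real \<times> real) \<Rightarrow> (real \<times> real \<Rightarrow> vec) \<Rightarrow> bool" where
  "moving_frame M D X N1 N2 n \<longleftrightarrow>
     open D \<and> smooth_on D X \<and> smooth_on D N1 \<and> smooth_on D N2 \<and> smooth_on D n \<and>
     openin (top_of_set M) {c *\<^sub>R X u | c u. c \<noteq> 0 \<and> u \<in> D} \<and>
     (\<forall>u\<in>D. \<forall>u'\<in>D. \<forall>c. X u' = c *\<^sub>R X u \<longrightarrow> u' = u) \<and>
     (\<forall>u\<in>D. let dX = frechet_derivative X (at u) in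
        (\<forall>a v. a *\<^sub>R X u + dX v = 0 \<longrightarrow> a = 0 \<and> v = 0) \<and>
        N1 u \<noteq> N2 u \<and> independent {N1 u, N2 u} \<and>
        {v. quad (dX v) (dX v) = 0} = span {N1 u} \<union> span {N2 u} \<and>
        quad (n u) (n u) = -2 \<and> quad (n u) (X u) = 0 \<and> (\<forall>v. quad (n u) (dX v) = 0))"

definition ell ::
  "(real \<times> real \<Rightarrow> vec) \<Rightarrow> (real \<times> real \<Rightarrow> real \<times> real) \<Rightarrow> (real \<times> real \<Rightarrow> vec) \<Rightarrow> real \<times> real \<Rightarrow> real" where
  "ell X N n u = quad (along N (along N X) u) (n u)"

text \<open>
  \<open>l1\<close>, \<open>l2\<close> are the values of \<open>\<ell>\<^sub>1\<close>, \<open>\<ell>\<^sub>2\<close> at \<open>[w]\<close> for some moving frame around \<open>[w]\<close>.  Another frame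
  gives the same pair up to exchange, positive factors on each and a common nonzero factor.
\<close>

definition ell_values :: "vec set \<Rightarrow> vec \<Rightarrow> real \<Rightarrow> real \<Rightarrow> bool" where
  "ell_values M w l1 l2 \<longleftrightarrow>
     (\<exists>D X N1 N2 n u c. moving_frame M D X N1 N2 n \<and> u \<in> D \<and> w = c *\<^sub>R X u \<and>
        l1 = ell X N1 n u \<and> l2 = ell X N2 n u)"

definition singly_ruled :: "vec set \<Rightarrow> bool" where
  "singly_ruled M \<longleftrightarrow> (\<forall>w\<in>M. \<exists>l1 l2. ell_values M w l1 l2 \<and> (l1 = 0) \<noteq> (l2 = 0))"

definition two_elliptic :: "vec set \<Rightarrow> bool" where
  "two_elliptic M \<longleftrightarrow> (\<forall>w\<in>M. \<exists>l1 l2. ell_values M w l1 l2 \<and> sgn (l1 * l2) = 1)"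

definition two_hyperbolic :: "vec set \<Rightarrow> bool" where
  "two_hyperbolic M \<longleftrightarrow> (\<forall>w\<in>M. \<exists>l1 l2. ell_values M w l1 l2 \<and> sgn (l1 * l2) = -1)"


section \<open>The classes of PDE\<close>

definition two_elliptic_pde :: "jet2 set \<Rightarrow> bool" where
  "two_elliptic_pde \<Sigma> \<longleftrightarrow> (\<forall>\<xi>. two_elliptic (quadric_cone (fibre \<Sigma> \<xi>)))"

definition two_hyperbolic_pde :: "jet2 set \<Rightarrow> bool" where
  "two_hyperbolic_pde \<Sigma> \<longleftrightarrow> (\<forall>\<xi>. two_hyperbolic (quadric_cone (fibre \<Sigma> \<xi>)))"

datatype pde_class = MongeAmpere | Goursat | TwoElliptic | TwoHyperbolic

primrec in_class :: "pde_class \<Rightarrow> (jet2 \<Rightarrow> real) \<Rightarrow> jet2 set \<Rightarrow> bool" where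
  "in_class MongeAmpere F \<Sigma> = monge_ampere F \<Sigma>"
| "in_class Goursat F \<Sigma> = goursat F \<Sigma>"
| "in_class TwoElliptic F \<Sigma> = two_elliptic_pde \<Sigma>"
| "in_class TwoHyperbolic F \<Sigma> = two_hyperbolic_pde \<Sigma>"

end

theory Submission
  imports Defs
begin


text \<open>
  The tangent plane of a hyperbolic fibre surface \<open>F = 0\<close> contains two null directions \<open>v\<^sub>1\<close>, \<open>v\<^sub>2\<close> of the
  Lorentzian form \<open>dr dt - ds\<^sup>2\<close>.  The invariants \<open>I\<^sub>1\<close>, \<open>I\<^sub>2\<close> are nonzero multiples of the second
  derivatives \<open>F\<^sub>v\<^sub>v\<close> in these directions, and so are \<open>\<ell>\<^sub>1\<close>, \<open>\<ell>\<^sub>2\<close> of any moving frame, with a common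
  factor.  Hence each class is a condition on the pair of values \<open>F\<^sub>v\<^sub>v\<close>, which is well defined up to
  exchange, positive factors and a common nonzero factor.  If both values vanish identically, the unit normal
  \<open>\<nu>\<close> has \<open>d\<nu> = \<alpha> id\<close> on the tangent planes with \<open>\<alpha>\<close> locally constant, which puts each component of
  the fibre on a sphere.  A contact transformation preserves the exterior derivatives of the canonical
  system on that system; their kernels are the null cones of the fibres, so it acts conformally along the fibres
  and maps null lines to null lines up to second order.  It therefore multiplies the pair by a common factor.
\<close>

text \<open>A line of the chart \<open>(r, s, t)\<close> in a null direction maps to a projective
  line inside the quadric, so \<open>F_vv\<close> measures the second-order contact of the surface
  with its null tangent lines. Passing to another regular defining function changes
  \<open>F_vv\<close> on tangent vectors only by the factor that relates the differentials.
  Rescaling \<open>v\<close> multiplies it by a square, while a change of the normal or of the sign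
  of \<open>F\<close> multiplies both values at once; so exactly the zero pattern and the sign of
  the product survive. This also absorbs the orientation of \<open>F\<close>, which is fixed point
  by point and may jump. In the contact part the obstacle is that a contact transformation is not
  assumed to respect the fibres of \<open>J^2\<close> over \<open>J^1\<close>. That its differential
  maps vertical vectors to vertical vectors has to be derived, and it follows because the null cone
  spans the vertical space. For spheres the obstacle is that a fibre may be disconnected: the sphere
  determined by the normal is fixed on each component only.\<close>

type_synonym real3 = "real \<times> real \<times> real"

subsection \<open>Smooth functions\<close>

abbreviation fder :: "('a::real_normed_vector \<Rightarrow> 'b::real_normed_vector) \<Rightarrow> 'a \<Rightarrow> 'a \<Rightarrow> 'b" where
  "fder f x \<equiv> frechet_derivative f (at x)"

lemma fder_eq: "(f has_derivative f') (at x) \<Longrightarrow> fder f x v = f' v"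
  using frechet_derivative_at by metis

lemma along_const_eq: "(f has_derivative f') (at x) \<Longrightarrow> along (\<lambda>_. v) f x = f' v"
  unfolding along_def by (rule fder_eq)

lemma derivative_local_unique:
  assumes "(f has_derivative f') (at x)" "(g has_derivative g') (at x)" "open S" "x \<in> S" "\<And>y. y \<in> S \<Longrightarrow> f y = g y"
  shows "f' h = g' h"
  using has_derivative_unique[OF has_derivative_transform_within_open[OF assms(1,3,4,5)] assms(2)] by simp

lemma derivative_locally_const:
  assumes "(f has_derivative f') (at x)" "open S" "x \<in> S" "\<And>y. y \<in> S \<Longrightarrow> f y = c"
  shows "f' h = 0"
  by (rule derivative_local_unique[OF assms(1) has_derivative_const[of c] assms(2-4)])

section \<open>Functions of class C^k\<close>

lemma Ck_cong:
  assumes "open S" "\<And>x. x \<in> S \<Longrightarrow> f x = g x" "Ck k S f"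
  shows "Ck k S g"
  using assms(2,3)
proof (induction k arbitrary: f g)
  case 0
  then show ?case using continuous_on_cong by fastforce
next
  case (Suc k)
  have "g differentiable at x" if x: "x \<in> S" for x
  proof -
    obtain f' where "(f has_derivative f') (at x)"
      using Suc.prems(2) x by (auto simp: differentiable_def)
    then have "(g has_derivative f') (at x)"
      by (rule has_derivative_transform_within_open[OF _ assms(1) that]) (rule Suc.prems(1))
    then show ?thesis
      unfolding differentiable_def by blast
  qed
  moreover have "Ck k S (along (\<lambda>_. b) g)" if "b \<in> Basis" for b
  proof (rule Suc.IH)
    show "Ck k S (along (\<lambda>_. b) f)" using Suc.prems that by simp
    show "along (\<lambda>_. b) f x = along (\<lambda>_. b) g x" if "x \<in> S" for x
      unfolding along_def
      by (rule fun_cong[OF frechet_derivative_transform_within_open[OF _ assms(1) that]])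
        (use Suc.prems that in auto)
  qed
  ultimately show ?case by simp
qed

lemma Ck_Suc_imp: "Ck (Suc k) S f \<Longrightarrow> Ck k S f"
proof (induction k arbitrary: f)
  case 0
  then show ?case
    by (auto intro!: continuous_at_imp_continuous_on differentiable_imp_continuous_within)
next
  case (Suc k)
  have "\<forall>x\<in>S. f differentiable at x" "\<forall>b\<in>Basis. Ck (Suc k) S (along (\<lambda>_. b) f)"
    using Suc.prems by auto
  then show ?case
    unfolding Ck.simps(2)[of k S f] using Suc.IH by blast
qed

lemma Ck_subset: "Ck k S f \<Longrightarrow> T \<subseteq> S \<Longrightarrow> Ck k T f"
  by (induction k arbitrary: f) (auto intro: continuous_on_subset)

lemma Ck_const: "Ck k S (\<lambda>_. c)"
  by (induction k arbitrary: c) (auto simp: along_def)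

text \<open>Any derivative formula valid on \<open>S\<close> may replace \<open>along\<close>, so
  each closure rule below becomes an induction on \<open>k\<close> in which the derivative is
  visibly built from functions of class C^k.\<close>

lemma Ck_Suc_iff:
  assumes "open S" "\<And>x. x \<in> S \<Longrightarrow> (f has_derivative f' x) (at x)"
  shows "Ck (Suc k) S f \<longleftrightarrow> (\<forall>b\<in>Basis. Ck k S (\<lambda>x. f' x b))"
proof -
  have "Ck k S (along (\<lambda>_. b) f) \<longleftrightarrow> Ck k S (\<lambda>x. f' x b)" for b
    using Ck_cong[OF assms(1), of "along (\<lambda>_. b) f" "\<lambda>x. f' x b" k]
      Ck_cong[OF assms(1), of "\<lambda>x. f' x b" "along (\<lambda>_. b) f" k] along_const_eq[OF assms(2)]
    by auto
  moreover have "\<forall>x\<in>S. f differentiable at x"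
    using assms(2) differentiable_def by blast
  ultimately show ?thesis by simp
qed

lemma Ck_has_derivative:
  "Ck (Suc k) S f \<Longrightarrow> x \<in> S \<Longrightarrow> (f has_derivative fder f x) (at x)"
  using frechet_derivative_works by auto

lemma Ck_Suc_along: "Ck (Suc k) S f \<Longrightarrow> b \<in> Basis \<Longrightarrow> Ck k S (\<lambda>x. fder f x b)"
  by (simp add: along_def)

lemma Ck_add:
  assumes "open S" "Ck k S f" "Ck k S g"
  shows "Ck k S (\<lambda>x. f x + g x)"
  using assms(2,3)
proof (induction k arbitrary: f g)
  case 0
  then show ?case by (simp add: continuous_on_add)
next
  case (Suc k)
  show ?case
    by (subst Ck_Suc_iff[OF assms(1), OF has_derivative_add])
       (auto intro!: Suc.IH Ck_has_derivative[OF Suc.prems(1)] Ck_has_derivative[OF Suc.prems(2)]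
          Ck_Suc_along[OF Suc.prems(1)] Ck_Suc_along[OF Suc.prems(2)])
qed

lemma Ck_bounded_linear:
  assumes "open S" "bounded_linear L" "Ck k S f"
  shows "Ck k S (\<lambda>x. L (f x))"
  using assms(3)
proof (induction k arbitrary: f)
  case 0
  then show ?case by (simp add: assms(2) bounded_linear.continuous_on)
next
  case (Suc k)
  show ?case
    by (subst Ck_Suc_iff[OF assms(1), OF bounded_linear.has_derivative[OF assms(2)]])
       (auto intro!: Suc.IH Ck_has_derivative[OF Suc.prems(1)] Ck_Suc_along[OF Suc.prems(1)])
qed

lemma Ck_bounded_bilinear:
  assumes "open S" "bounded_bilinear B" "Ck k S f" "Ck k S g"
  shows "Ck k S (\<lambda>x. B (f x) (g x))"
  using assms(3,4)
proof (induction k arbitrary: f g)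
  case 0
  then show ?case by (simp add: assms(2) bounded_bilinear.continuous_on)
next
  case (Suc k)
  show ?case
    by (subst Ck_Suc_iff[OF assms(1), OF bounded_bilinear.FDERIV[OF assms(2)]])
       (auto intro!: Suc.IH Ck_add assms(1) Ck_has_derivative[OF Suc.prems(1)] Ck_has_derivative[OF Suc.prems(2)]
          Ck_Suc_along[OF Suc.prems(1)] Ck_Suc_along[OF Suc.prems(2)] Ck_Suc_imp[OF Suc.prems(1)] Ck_Suc_imp[OF Suc.prems(2)])
qed

lemma Ck_sum:
  assumes "open S" "finite I" "\<And>i. i \<in> I \<Longrightarrow> Ck k S (f i)"
  shows "Ck k S (\<lambda>x. \<Sum>i\<in>I. f i x)"
  using assms(2,3) by (induction I rule: finite_induct) (auto intro!: Ck_const Ck_add assms(1))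

lemma derivative_basis_sum:
  fixes L :: "'a::euclidean_space \<Rightarrow> 'b::real_normed_vector"
  assumes "linear L"
  shows "L v = (\<Sum>i\<in>Basis. (v \<bullet> i) *\<^sub>R L i)"
proof -
  have "L v = L (\<Sum>i\<in>Basis. (v \<bullet> i) *\<^sub>R i)" by (subst euclidean_representation) (rule refl)
  also have "\<dots> = (\<Sum>i\<in>Basis. (v \<bullet> i) *\<^sub>R L i)"
    by (simp only: linear_sum[OF assms] linear_cmul[OF assms])
  finally show ?thesis .
qed

lemma Ck_compose:
  fixes f :: "'a::euclidean_space \<Rightarrow> 'b::euclidean_space" and g :: "'b \<Rightarrow> 'c::real_normed_vector"
  assumes "open S" "open T" "f ` S \<subseteq> T" "Ck k S f" "Ck k T g"
  shows "Ck k S (\<lambda>x. g (f x))"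
  using assms(3-5)
proof (induction k arbitrary: f g)
  case 0
  then show ?case using continuous_on_compose2[of T g S f] by simp
next
  case (Suc k)
  have *: "((\<lambda>x. g (f x)) has_derivative
      (\<lambda>v. fder g (f x) (fder f x v))) (at x)" if "x \<in> S" for x
  proof (rule has_derivative_compose[OF Ck_has_derivative[OF Suc.prems(2) that] Ck_has_derivative[OF Suc.prems(3)]])
    show "f x \<in> T" using Suc.prems(1) that by blast
  qed
  \<comment> \<open>In the chain rule both the base point and the argument of the derivative of
    \<open>g\<close> vary with \<open>x\<close>. Expanding the argument in the basis leaves sums of
    products, to which the induction hypothesis applies.\<close>
  have eq: "fder g (f x) (fder f x b) =
     (\<Sum>i\<in>Basis. (fder f x b \<bullet> i) *\<^sub>R fder g (f x) i)" if "x \<in> S" for x b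
  proof (rule derivative_basis_sum[OF linear_frechet_derivative])
    show "g differentiable at (f x)" using Suc.prems(1,3) that by auto
  qed
  show ?case
  proof (subst Ck_Suc_iff[OF assms(1) *], assumption, rule ballI)
    fix b :: 'a assume b: "b \<in> Basis"
    have *: "Ck k S (\<lambda>x. \<Sum>i\<in>Basis. (fder f x b \<bullet> i) *\<^sub>R fder g (f x) i)"
    proof (intro Ck_sum assms(1) finite_Basis Ck_bounded_bilinear[OF _ bounded_bilinear_scaleR])
      fix i :: 'b assume i: "i \<in> Basis"
      show "Ck k S (\<lambda>x. fder f x b \<bullet> i)"
        by (intro Ck_bounded_linear[where L="\<lambda>y. y \<bullet> i"] assms(1) bounded_linear_inner_left Ck_Suc_along[OF Suc.prems(2) b])
      show "Ck k S (\<lambda>x. fder g (f x) i)"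
        by (rule Suc.IH[where g="\<lambda>y. fder g y i"])
           (use Suc.prems(1) Ck_Suc_imp[OF Suc.prems(2)] Ck_Suc_along[OF Suc.prems(3) i] in auto)
    qed
    show "Ck k S (\<lambda>x. fder g (f x) (fder f x b))"
      by (rule Ck_cong[OF assms(1) _ *]) (rule eq[symmetric])
  qed
qed

text \<open>Real powers are closed under differentiation up to constants, so the induction varies
  \<open>a\<close>. The exponents -1, 1/2 and -1/2 later supply reciprocals and square roots of
  positive functions.\<close>

lemma Ck_powr: "Ck k {0::real<..} (\<lambda>x. x powr a)"
proof (induction k arbitrary: a)
  case 0
  then show ?case by (auto intro!: continuous_intros)
next
  case (Suc k)
  have *: "((\<lambda>x. x powr a) has_derivative (\<lambda>h. h *\<^sub>R (a * x powr (a - 1)))) (at x)" if "x \<in> {0<..}" for x :: real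
    using has_real_derivative_powr[of x a] that by (simp add: has_field_derivative_def mult_commute_abs)
  have "Ck k {0<..} (\<lambda>x. b *\<^sub>R (a * x powr (a - 1)))" for b :: real
    by (rule Ck_bounded_linear[OF _ bounded_linear_scaleR_right], simp,
        rule Ck_bounded_linear[OF _ bounded_linear_mult_right], simp, rule Suc.IH)
  then have "\<forall>b\<in>Basis. Ck k {0::real<..} (\<lambda>x. b *\<^sub>R (a * x powr (a - 1)))"
    by blast
  then show ?case
    using Ck_Suc_iff[OF open_greaterThan *] by blast
qed

section \<open>Smooth functions\<close>

lemma smooth_on_differentiable: "smooth_on S f \<Longrightarrow> x \<in> S \<Longrightarrow> f differentiable at x"
  unfolding smooth_on_def by (drule spec[of _ "Suc 0"]) simp

lemma smooth_on_deriv: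
  "smooth_on S f \<Longrightarrow> x \<in> S \<Longrightarrow> (f has_derivative fder f x) (at x)"
  using frechet_derivative_works smooth_on_differentiable by blast

lemma smooth_on_linear: "smooth_on S f \<Longrightarrow> x \<in> S \<Longrightarrow> linear (fder f x)"
  by (rule linear_frechet_derivative[OF smooth_on_differentiable])

lemma smooth_on_continuous_on: "smooth_on S f \<Longrightarrow> continuous_on S f"
  unfolding smooth_on_def by (drule spec[of _ 0]) simp

lemma smooth_on_open_vimage: "open S \<Longrightarrow> smooth_on S f \<Longrightarrow> open T \<Longrightarrow> open {x \<in> S. f x \<in> T}"
  using continuous_on_open_vimage[of S f] smooth_on_continuous_on[of S f]
  by (simp add: vimage_def Int_def conj_commute)

lemma smooth_on_isCont: "smooth_on S f \<Longrightarrow> x \<in> S \<Longrightarrow> isCont f x"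
  using differentiable_imp_continuous_within smooth_on_differentiable by blast

lemma smooth_on_subset: "smooth_on S f \<Longrightarrow> T \<subseteq> S \<Longrightarrow> smooth_on T f"
  unfolding smooth_on_def by (blast intro: Ck_subset)

lemma smooth_on_cong: "open S \<Longrightarrow> smooth_on S f \<Longrightarrow> (\<And>x. x \<in> S \<Longrightarrow> f x = g x) \<Longrightarrow> smooth_on S g"
  unfolding smooth_on_def by (blast intro: Ck_cong)

lemma smooth_on_const: "smooth_on S (\<lambda>_. c)"
  by (simp add: smooth_on_def Ck_const)

lemma smooth_on_ident: "open S \<Longrightarrow> smooth_on S (\<lambda>x. x)"
  unfolding smooth_on_def
proof
  fix k assume S: "open S"
  have "Ck (Suc k) S (\<lambda>x. x)"
    using Ck_Suc_iff[OF S has_derivative_ident] Ck_const by blast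
  then show "Ck k S (\<lambda>x. x)"
    by (rule Ck_Suc_imp)
qed

lemma smooth_on_add: "open S \<Longrightarrow> smooth_on S f \<Longrightarrow> smooth_on S g \<Longrightarrow> smooth_on S (\<lambda>x. f x + g x)"
  by (simp add: smooth_on_def Ck_add)

lemma smooth_on_bounded_linear:
  "bounded_linear L \<Longrightarrow> open S \<Longrightarrow> smooth_on S f \<Longrightarrow> smooth_on S (\<lambda>x. L (f x))"
  by (simp add: smooth_on_def Ck_bounded_linear)

lemma smooth_on_bounded_bilinear:
  "bounded_bilinear B \<Longrightarrow> open S \<Longrightarrow> smooth_on S f \<Longrightarrow> smooth_on S g \<Longrightarrow> smooth_on S (\<lambda>x. B (f x) (g x))"
  by (simp add: smooth_on_def Ck_bounded_bilinear)

lemmas smooth_on_scaleR = smooth_on_bounded_bilinear[OF bounded_bilinear_scaleR]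
lemma smooth_on_mult:
  fixes f g :: "'a::euclidean_space \<Rightarrow> real"
  shows "open S \<Longrightarrow> smooth_on S f \<Longrightarrow> smooth_on S g \<Longrightarrow> smooth_on S (\<lambda>x. f x * g x)"
  by (rule smooth_on_bounded_bilinear[OF bounded_bilinear_mult])

lemmas smooth_on_minus = smooth_on_bounded_linear[OF bounded_linear_minus[OF bounded_linear_ident]]
lemmas smooth_on_fst = smooth_on_bounded_linear[OF bounded_linear_fst]
lemmas smooth_on_snd = smooth_on_bounded_linear[OF bounded_linear_snd]

lemma smooth_on_diff:
  assumes "open S" "smooth_on S f" "smooth_on S g"
  shows "smooth_on S (\<lambda>x. f x - g x)"
  using smooth_on_add[OF assms(1,2) smooth_on_minus[OF assms(1,3)]] by simp

lemma smooth_on_Pair: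
  assumes "open S" "smooth_on S f" "smooth_on S g"
  shows "smooth_on S (\<lambda>x. (f x, g x))"
proof -
  have "smooth_on S (\<lambda>x. (f x, 0) + (0, g x))"
    by (intro smooth_on_add assms smooth_on_bounded_linear[where L="\<lambda>y. (y, 0)"]
          smooth_on_bounded_linear[where L="\<lambda>y. (0, y)"] bounded_linear_Pair bounded_linear_ident bounded_linear_zero)
  then show ?thesis by simp
qed

lemma smooth_on_compose:
  fixes f :: "'a::euclidean_space \<Rightarrow> 'b::euclidean_space" and g :: "'b \<Rightarrow> 'c::real_normed_vector"
  shows "open S \<Longrightarrow> open T \<Longrightarrow> f ` S \<subseteq> T \<Longrightarrow> smooth_on S f \<Longrightarrow> smooth_on T g \<Longrightarrow> smooth_on S (\<lambda>x. g (f x))"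
  unfolding smooth_on_def by (blast intro: Ck_compose)

lemma smooth_on_powr:
  fixes f :: "'a::euclidean_space \<Rightarrow> real"
  shows "open S \<Longrightarrow> smooth_on S f \<Longrightarrow> (\<And>x. x \<in> S \<Longrightarrow> f x > 0) \<Longrightarrow> smooth_on S (\<lambda>x. f x powr a)"
  by (rule smooth_on_compose[where T="{0<..}" and f=f]) (auto simp: smooth_on_def Ck_powr)

lemma smooth_on_along:
  assumes "open S" "smooth_on S f"
  shows "smooth_on S (along (\<lambda>_. v) f)"
proof -
  have "smooth_on S (\<lambda>x. fder f x i)" if "i \<in> Basis" for i
    using assms that unfolding smooth_on_def by (blast intro: Ck_Suc_along)
  then have "Ck k S (\<lambda>x. \<Sum>i\<in>Basis. (v \<bullet> i) *\<^sub>R fder f x i)" for k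
    by (intro Ck_sum assms finite_Basis Ck_bounded_linear[OF _ bounded_linear_scaleR_right]) (auto simp: smooth_on_def)
  then have "smooth_on S (\<lambda>x. \<Sum>i\<in>Basis. (v \<bullet> i) *\<^sub>R fder f x i)"
    by (simp add: smooth_on_def)
  moreover have "(\<Sum>i\<in>Basis. (v \<bullet> i) *\<^sub>R fder f x i) = along (\<lambda>_. v) f x" if "x \<in> S" for x
    unfolding along_def
    by (rule derivative_basis_sum[symmetric]) (rule smooth_on_linear[OF assms(2) that])
  ultimately show ?thesis
    by (rule smooth_on_cong[OF assms(1)])
qed

lemma smooth_on_frechet:
  "open S \<Longrightarrow> smooth_on S f \<Longrightarrow> smooth_on S (\<lambda>x. fder f x v)"
  using smooth_on_along unfolding along_def by blast

subsection \<open>Hypersurfaces and second derivatives\<close>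

definition hess :: "('a::real_normed_vector \<Rightarrow> 'b::real_normed_vector) \<Rightarrow> 'a \<Rightarrow> 'a \<Rightarrow> 'a \<Rightarrow> 'b" where
  "hess f x v w = fder (\<lambda>y. fder f y w) x v"

text \<open>The points \<open>x + \<tau> (v + \<sigma> y\<^sub>0)\<close> with \<open>\<bar>\<sigma>\<bar> \<le> \<epsilon>\<close> of the hypersurface, found by the intermediate
  value theorem, replace a curve in it with velocity \<open>v\<close>.\<close>

lemma derivative_zero_on_tangent:
  fixes f h :: "'a::real_normed_vector \<Rightarrow> real"
  assumes f: "(f has_derivative f') (at x)" "f x = 0" "f' y0 \<noteq> 0" "f' v = 0"
    and h: "(h has_derivative h') (at x)"
    and S: "open S" "x \<in> S" "continuous_on S f" "\<And>y. y \<in> S \<Longrightarrow> f y = 0 \<Longrightarrow> h y = 0"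
  shows "h' v = 0"
proof -
  have "\<exists>y1. f' y1 > 0"
    using f(3) has_derivative_linear[OF f(1)] by (metis linear_neg neg_0_less_iff_less neqE)
  then obtain y1 where y1: "f' y1 > 0" by blast
  define K where "K = \<bar>h' y1\<bar> + norm v + norm y1"
  have lf: "linear f'" and lh: "linear h'"
    using f(1) h by (auto dest: has_derivative_linear)
  have bound: "\<bar>h' v\<bar> \<le> e * K" if e: "0 < e" "e \<le> 1" for e
  proof -
    define R where "R = norm v + e * norm y1 + 1"
    have R: "R > 0" using e by (simp add: R_def add_nonneg_pos)
    have nb: "norm (v + \<sigma> *\<^sub>R y1) \<le> norm v + e * norm y1" if "\<bar>\<sigma>\<bar> \<le> e" for \<sigma>
    proof -
      have "norm (v + \<sigma> *\<^sub>R y1) \<le> norm v + \<bar>\<sigma>\<bar> * norm y1"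
        by (metis norm_scaleR norm_triangle_ineq)
      also have "\<dots> \<le> norm v + e * norm y1"
        using that by (simp add: mult_right_mono)
      finally show ?thesis .
    qed
    have nbR: "norm (v + \<sigma> *\<^sub>R y1) < R" if "\<bar>\<sigma>\<bar> \<le> e" for \<sigma>
      using nb[OF that] by (simp add: R_def)
    obtain d1 where d1: "d1 > 0" "\<And>y. norm (y - x) < d1 \<Longrightarrow> norm (h y - h x - h' (y - x)) \<le> e * norm (y - x)"
      using h e(1) unfolding has_derivative_at_alt by blast
    \<comment> \<open>Chosen so that the error of the linear approximation of \<open>f\<close> at
      every \<open>c \<sigma>\<close>, which is below \<open>e' * \<tau> * (2 * R)\<close>, stays
      below \<open>\<tau> * (e * f' y1)\<close>, the linear term at \<open>\<sigma> = e\<close>.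
      Hence \<open>f\<close> changes sign between \<open>c (- e)\<close> and
      \<open>c e\<close>.\<close>
    define e' where "e' = e * f' y1 / (2 * R)"
    have e': "e' > 0" using e y1 R by (simp add: e'_def)
    obtain d2 where d2: "d2 > 0" "\<And>y. norm (y - x) < d2 \<Longrightarrow> norm (f y - f x - f' (y - x)) \<le> e' * norm (y - x)"
      using f(1) e' unfolding has_derivative_at_alt by blast
    obtain d3 where d3: "d3 > 0" "ball x d3 \<subseteq> S"
      using S(1,2) open_contains_ball by blast
    define d where "d = min d1 (min d2 d3)"
    define \<tau> where "\<tau> = d / (2 * R)"
    have d: "d > 0" using d1 d2 d3 by (simp add: d_def)
    have \<tau>: "\<tau> > 0" "\<tau> * R < d" using d R by (auto simp: \<tau>_def field_simps)
    define c where "c \<sigma> = x + \<tau> *\<^sub>R (v + \<sigma> *\<^sub>R y1)" for \<sigma>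
    have cd: "norm (c \<sigma> - x) < d" if "\<bar>\<sigma>\<bar> \<le> e" for \<sigma>
    proof -
      have "norm (c \<sigma> - x) = \<tau> * norm (v + \<sigma> *\<^sub>R y1)"
        using \<tau> by (simp add: c_def)
      also have "\<dots> \<le> \<tau> * R"
        using nbR[OF that] \<tau> by (simp add: mult_left_mono)
      finally show ?thesis using \<tau> by simp
    qed
    have f'c: "f' (c \<sigma> - x) = \<tau> * (\<sigma> * f' y1)" for \<sigma>
      using lf f(4) by (simp add: c_def linear_cmul linear_add)
    have fc: "\<bar>f (c \<sigma>) - \<tau> * (\<sigma> * f' y1)\<bar> < \<tau> * (e * f' y1)" if "\<bar>\<sigma>\<bar> \<le> e" for \<sigma>
    proof -
      have "\<bar>f (c \<sigma>) - \<tau> * (\<sigma> * f' y1)\<bar> \<le> e' * norm (c \<sigma> - x)"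
        using d2(2)[of "c \<sigma>"] cd[OF that] f(2) f'c by (simp add: d_def)
      also have "\<dots> = e' * \<tau> * norm (v + \<sigma> *\<^sub>R y1)"
        using \<tau> by (simp add: c_def)
      also have "\<dots> < e' * \<tau> * (2 * R)"
        using nbR[OF that] e' \<tau> R by (intro mult_strict_left_mono) auto
      also have "\<dots> = \<tau> * (e * f' y1)"
        using R by (simp add: e'_def)
      finally show ?thesis .
    qed
    have neg: "f (c (- e)) \<le> 0" and pos: "0 \<le> f (c e)"
      using fc[of "- e"] fc[of e] e by (auto simp: abs_if split: if_splits)
    have cS: "c \<sigma> \<in> S" if "\<bar>\<sigma>\<bar> \<le> e" for \<sigma>
      using cd[OF that] d3(2) by (auto simp: d_def dist_norm norm_minus_commute)
    have "continuous_on {- e..e} (\<lambda>\<sigma>. f (c \<sigma>))"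
      by (rule continuous_on_compose2[OF S(3)])
         (auto simp: c_def intro!: continuous_intros cS[unfolded c_def])
    then obtain \<sigma> where "- e \<le> \<sigma>" "\<sigma> \<le> e" "f (c \<sigma>) = 0"
      using IVT'[of "\<lambda>\<sigma>. f (c \<sigma>)" "- e" 0 e] neg pos e by auto
    then have \<sigma>: "\<bar>\<sigma>\<bar> \<le> e" "f (c \<sigma>) = 0" by auto
    have "h (c \<sigma>) = 0" "h x = 0"
      using S(4) cS[OF \<sigma>(1)] \<sigma>(2) S(2) f(2) by auto
    then have "\<bar>h' (c \<sigma> - x)\<bar> \<le> e * norm (c \<sigma> - x)"
      using d1(2)[of "c \<sigma>"] cd[OF \<sigma>(1)] by (simp add: d_def)
    moreover have "h' (c \<sigma> - x) = \<tau> * (h' v + \<sigma> * h' y1)"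
      using lh by (simp add: c_def linear_cmul linear_add)
    moreover have "norm (c \<sigma> - x) = \<tau> * norm (v + \<sigma> *\<^sub>R y1)"
      using \<tau> by (simp add: c_def)
    ultimately have "\<tau> * \<bar>h' v + \<sigma> * h' y1\<bar> \<le> \<tau> * (e * norm (v + \<sigma> *\<^sub>R y1))"
      using \<tau> by (simp add: abs_mult mult.left_commute)
    then have "\<bar>h' v + \<sigma> * h' y1\<bar> \<le> e * norm (v + \<sigma> *\<^sub>R y1)"
      using \<tau> by simp
    also have "\<dots> \<le> e * (norm v + norm y1)"
    proof -
      have "e * norm y1 \<le> norm y1" using e by (simp add: mult_left_le_one_le)
      then show ?thesis using nb[OF \<sigma>(1)] e by (intro mult_left_mono) auto
    qed
    finally have "\<bar>h' v + \<sigma> * h' y1\<bar> \<le> e * (norm v + norm y1)" .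
    moreover have "\<bar>\<sigma> * h' y1\<bar> \<le> e * \<bar>h' y1\<bar>"
      using \<sigma>(1) by (simp add: abs_mult mult_right_mono)
    ultimately show ?thesis
      unfolding K_def by (simp add: algebra_simps)
  qed
  have "\<bar>h' v\<bar> \<le> 0"
  proof (rule field_le_epsilon)
    fix e :: real assume e: "e > 0"
    have K: "K \<ge> 0" by (simp add: K_def)
    define e1 where "e1 = min 1 (e / (K + 1))"
    have e1: "0 < e1" "e1 \<le> 1" "e1 \<le> e / (K + 1)" using e K by (auto simp: e1_def)
    have "\<bar>h' v\<bar> \<le> e1 * K" using bound e1 by blast
    also have "\<dots> \<le> e / (K + 1) * K" using e1 K by (intro mult_right_mono) auto
    also have "\<dots> \<le> e" using K e by (simp add: field_simps)
    finally show "\<bar>h' v\<bar> \<le> 0 + e" by simp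
  qed
  then show ?thesis by simp
qed

section \<open>Second derivatives\<close>

lemma hess_deriv:
  assumes "open S" "smooth_on S f" "x \<in> S"
  shows "((\<lambda>y. fder f y w) has_derivative (\<lambda>v. hess f x v w)) (at x)"
  using smooth_on_deriv[OF smooth_on_frechet[OF assms(1,2)] assms(3)]
  unfolding hess_def by simp

lemma smooth_on_hess: "open S \<Longrightarrow> smooth_on S f \<Longrightarrow> smooth_on S (\<lambda>x. hess f x v w)"
  unfolding hess_def by (intro smooth_on_frechet)

lemma hess_linear1:
  assumes "open S" "smooth_on S f" "x \<in> S" shows "linear (\<lambda>v. hess f x v w)"
  using has_derivative_linear[OF hess_deriv[OF assms]] .

lemma hess_linear2:
  assumes "open S" "smooth_on S f" "x \<in> S" shows "linear (\<lambda>w. hess f x v w)"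
proof -
  have l: "linear (fder f y)" if "y \<in> S" for y
    by (rule smooth_on_linear[OF assms(2) that])
  have cong: "hess f x v w = G' v" if "\<And>y. y \<in> S \<Longrightarrow> fder f y w = G y"
    "(G has_derivative G') (at x)" for w G G'
  proof -
    have "((\<lambda>y. fder f y w) has_derivative G') (at x)"
      by (rule has_derivative_transform_within_open[OF that(2) assms(1,3)]) (simp add: that)
    then show ?thesis unfolding hess_def by (rule fder_eq)
  qed
  show ?thesis
  proof (rule linearI)
    show "hess f x v (a + b) = hess f x v a + hess f x v b" for a b
      by (rule cong[OF _ has_derivative_add[OF hess_deriv[OF assms] hess_deriv[OF assms]]])
         (simp add: l linear_add)
    show "hess f x v (c *\<^sub>R b) = c *\<^sub>R hess f x v b" for b c
      by (rule cong[OF _ has_derivative_scaleR_right[OF hess_deriv[OF assms]]])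
         (simp add: l linear_cmul)
  qed
qed

lemma hess_bounded_linear:
  assumes "open S" "smooth_on S f" "x \<in> S" "bounded_linear L"
  shows "hess (\<lambda>x. L (f x)) x v w = L (hess f x v w)"
proof -
  have "fder (\<lambda>x. L (f x)) y w = L (fder f y w)" if "y \<in> S" for y
    using frechet_derivative_at[OF bounded_linear.has_derivative[OF assms(4) smooth_on_deriv[OF assms(2) that]]]
    by metis
  then have "((\<lambda>y. fder (\<lambda>x. L (f x)) y w) has_derivative (\<lambda>v. L (hess f x v w))) (at x)"
    by (intro has_derivative_transform_within_open[OF
          bounded_linear.has_derivative[OF assms(4) hess_deriv[OF assms(1-3)]] assms(1,3)]) simp
  then show ?thesis unfolding hess_def by (rule fder_eq)
qed

text \<open>Since \<open>h\<close> vanishes where \<open>f\<close> does, dh is a multiple of df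
  along the hypersurface. The function \<open>G\<close> below is this proportionality cleared of
  denominators. It vanishes on the hypersurface, and so does its derivative along the tangent vector
  \<open>v\<close>; the mixed terms of that derivative carry the factors dh(v) and df(v), which are
  zero. The factor itself is never differentiated.\<close>

lemma hess_on_hypersurface:
  fixes f h :: "'a::euclidean_space \<Rightarrow> real"
  assumes S: "open S" "x \<in> S" and f: "smooth_on S f" "f x = 0" and h: "smooth_on S h"
    and fh: "\<And>y. y \<in> S \<Longrightarrow> f y = 0 \<Longrightarrow> h y = 0"
    and y0: "fder f x y0 \<noteq> 0" and v: "fder f x v = 0"
  shows "fder h x v = 0"
    and "hess h x v v * fder f x y0 = fder h x y0 * hess f x v v"
proof -
  let ?Df = "\<lambda>y. fder f y" and ?Dh = "\<lambda>y. fder h y"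
  note df = smooth_on_deriv[OF f(1)] and dh = smooth_on_deriv[OF h]
  show hv: "?Dh x v = 0"
    by (rule derivative_zero_on_tangent[OF df f(2) y0 v dh]) (use S fh smooth_on_continuous_on[OF f(1)] in auto)
  define G where "G y = ?Dh y v * ?Df y y0 - ?Dh y y0 * ?Df y v" for y
  have "open {y \<in> S. ?Df y y0 \<in> - {0}}"
    by (rule smooth_on_open_vimage[OF S(1) smooth_on_frechet[OF S(1) f(1)]]) auto
  then obtain T where T: "open T" "x \<in> T" "T \<subseteq> S" "\<And>y. y \<in> T \<Longrightarrow> ?Df y y0 \<noteq> 0"
    using S(2) y0 by (intro that[of "{y \<in> S. ?Df y y0 \<in> - {0}}"]) auto
  have G0: "G y = 0" if y: "y \<in> T" "f y = 0" for y
  proof -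
    have lf: "linear (?Df y)" and lh: "linear (?Dh y)"
      using y T f(1) h by (auto intro!: linear_frechet_derivative smooth_on_differentiable)
    \<comment> \<open>This combination is killed by the differential of \<open>f\<close> at
      \<open>y\<close>, hence by that of \<open>h\<close>; this is \<open>G y = 0\<close>.\<close>
    let ?w = "?Df y y0 *\<^sub>R v - ?Df y v *\<^sub>R y0"
    have "?Dh y ?w = 0"
    proof (rule derivative_zero_on_tangent[OF df y(2) T(4)[OF y(1)] _ dh])
      show "?Df y ?w = 0" using lf by (simp add: linear_diff linear_cmul)
    qed (use y T fh S smooth_on_continuous_on[OF f(1)] in auto)
    then show ?thesis using lh by (simp add: linear_diff linear_cmul G_def mult.commute)
  qed
  have "(G has_derivative (\<lambda>u. (?Dh x v * hess f x u y0 + hess h x u v * ?Df x y0)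
      - (?Dh x y0 * hess f x u v + hess h x u y0 * ?Df x v))) (at x)"
    unfolding G_def
    by (intro has_derivative_diff has_derivative_mult hess_deriv[OF S(1) f(1) S(2)] hess_deriv[OF S(1) h S(2)])
  from derivative_zero_on_tangent[OF df f(2) y0 v this T(1,2)]
  have "(?Dh x v * hess f x v y0 + hess h x v v * ?Df x y0) - (?Dh x y0 * hess f x v v + hess h x v y0 * ?Df x v) = 0"
    using G0 S T smooth_on_continuous_on[OF f(1)] continuous_on_subset by blast
  then show "hess h x v v * ?Df x y0 = ?Dh x y0 * hess f x v v"
    using hv v by simp
qed

text \<open>Two mean value arguments, first in the direction \<open>w\<close> and then in
  \<open>v\<close>. The left side of the identity is symmetric in \<open>v\<close> and
  \<open>w\<close>, which is what forces the symmetry of \<open>hess\<close>.\<close>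

lemma mixed_difference:
  fixes f :: "'a::euclidean_space \<Rightarrow> real"
  assumes S: "open S" "smooth_on S f" and s: "s > 0"
    and box: "\<And>\<sigma> \<tau>. 0 \<le> \<sigma> \<Longrightarrow> \<sigma> \<le> s \<Longrightarrow> 0 \<le> \<tau> \<Longrightarrow> \<tau> \<le> s \<Longrightarrow> x + \<sigma> *\<^sub>R v + \<tau> *\<^sub>R w \<in> S"
  shows "\<exists>\<sigma> \<tau>. 0 < \<sigma> \<and> \<sigma> < s \<and> 0 < \<tau> \<and> \<tau> < s \<and>
    f (x + s *\<^sub>R v + s *\<^sub>R w) - f (x + s *\<^sub>R v) - f (x + s *\<^sub>R w) + f x = s\<^sup>2 * hess f (x + \<sigma> *\<^sub>R v + \<tau> *\<^sub>R w) v w"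
proof -
  let ?c = "\<lambda>\<sigma> \<tau>. x + \<sigma> *\<^sub>R v + \<tau> *\<^sub>R w"
  let ?Df = "\<lambda>y. fder f y"
  have df: "((\<lambda>\<tau>. f (?c \<sigma> \<tau>)) has_real_derivative ?Df (?c \<sigma> \<tau>) w) (at \<tau>)"
    if "0 \<le> \<sigma>" "\<sigma> \<le> s" "0 \<le> \<tau>" "\<tau> \<le> s" for \<sigma> \<tau>
  proof -
    have "((\<lambda>\<tau>. x + \<sigma> *\<^sub>R v + \<tau> *\<^sub>R w) has_derivative (\<lambda>h. h *\<^sub>R w)) (at \<tau>)"
      by (auto intro!: derivative_eq_intros)
    from has_derivative_compose[OF this smooth_on_deriv[OF S(2) box[OF that]]]
    show ?thesis
      using linear_cmul[OF smooth_on_linear[OF S(2) box[OF that]]]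
      by (simp add: has_field_derivative_def mult_commute_abs)
  qed
  have ddf: "((\<lambda>\<sigma>. ?Df (?c \<sigma> \<tau>) w) has_real_derivative hess f (?c \<sigma> \<tau>) v w) (at \<sigma>)"
    if "0 \<le> \<sigma>" "\<sigma> \<le> s" "0 \<le> \<tau>" "\<tau> \<le> s" for \<sigma> \<tau>
  proof -
    have "((\<lambda>\<sigma>. x + \<sigma> *\<^sub>R v + \<tau> *\<^sub>R w) has_derivative (\<lambda>h. h *\<^sub>R v)) (at \<sigma>)"
      by (auto intro!: derivative_eq_intros)
    from has_derivative_compose[OF this hess_deriv[OF S box[OF that], where w=w]]
    show ?thesis
      using linear_cmul[OF hess_linear1[OF S box[OF that]]]
      by (simp add: has_field_derivative_def mult_commute_abs)
  qed
  define \<phi> where "\<phi> \<tau> = f (?c s \<tau>) - f (?c 0 \<tau>)" for \<tau>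
  have "DERIV \<phi> \<tau> :> ?Df (?c s \<tau>) w - ?Df (?c 0 \<tau>) w" if "0 \<le> \<tau>" "\<tau> \<le> s" for \<tau>
    unfolding \<phi>_def using that s by (intro DERIV_diff df) auto
  from MVT2[OF s this] obtain \<tau> where \<tau>: "0 < \<tau>" "\<tau> < s"
      "\<phi> s - \<phi> 0 = (s - 0) * (?Df (?c s \<tau>) w - ?Df (?c 0 \<tau>) w)"
    by blast
  have "\<exists>\<sigma>>0. \<sigma> < s \<and> ?Df (?c s \<tau>) w - ?Df (?c 0 \<tau>) w = (s - 0) * hess f (?c \<sigma> \<tau>) v w"
  proof (rule MVT2[OF s, where f="\<lambda>\<sigma>. ?Df (?c \<sigma> \<tau>) w"])
    show "((\<lambda>\<sigma>. ?Df (?c \<sigma> \<tau>) w) has_real_derivative hess f (?c \<sigma> \<tau>) v w) (at \<sigma>)"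
      if "0 \<le> \<sigma>" "\<sigma> \<le> s" for \<sigma>
      using that \<tau>(1,2) by (intro ddf) auto
  qed
  then obtain \<sigma> where \<sigma>: "0 < \<sigma>" "\<sigma> < s"
      "?Df (?c s \<tau>) w - ?Df (?c 0 \<tau>) w = (s - 0) * hess f (?c \<sigma> \<tau>) v w"
    by blast
  have "f (?c s s) - f (x + s *\<^sub>R v) - f (x + s *\<^sub>R w) + f x = \<phi> s - \<phi> 0"
    by (simp add: \<phi>_def)
  also have "\<dots> = s\<^sup>2 * hess f (?c \<sigma> \<tau>) v w"
    unfolding \<tau>(3) \<sigma>(3) by (simp add: power2_eq_square)
  finally show ?thesis using \<sigma> \<tau> by blast
qed

lemma hess_sym_real:
  fixes f :: "'a::euclidean_space \<Rightarrow> real"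
  assumes S: "open S" "smooth_on S f" "x \<in> S"
  shows "hess f x v w = hess f x w v"
proof -
  have "\<bar>hess f x v w - hess f x w v\<bar> \<le> 0"
  proof (rule field_le_epsilon)
    fix e :: real assume e: "e > 0"
    have ev: "eventually (\<lambda>y. dist (hess f y a b) (hess f x a b) < e/2) (nhds x)" for a b
      using tendstoD[OF smooth_on_isCont[OF smooth_on_hess[OF S(1,2)] S(3), unfolded isCont_def] half_gt_zero[OF e]]
      by (simp add: eventually_nhds_conv_at e)
    have "eventually (\<lambda>y. dist (hess f y v w) (hess f x v w) < e/2) (nhds x)"
        "eventually (\<lambda>y. dist (hess f y w v) (hess f x w v) < e/2) (nhds x)"
      by (rule ev)+
    moreover have "eventually (\<lambda>y. y \<in> S) (nhds x)"
      using S eventually_nhds by blast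
    ultimately have "eventually (\<lambda>y. dist (hess f y v w) (hess f x v w) < e/2 \<and>
        dist (hess f y w v) (hess f x w v) < e/2 \<and> y \<in> S) (nhds x)"
      by eventually_elim auto
    then obtain d where d: "d > 0" "\<And>y. dist y x < d \<Longrightarrow> \<bar>hess f y v w - hess f x v w\<bar> < e/2"
        "\<And>y. dist y x < d \<Longrightarrow> \<bar>hess f y w v - hess f x w v\<bar> < e/2" "\<And>y. dist y x < d \<Longrightarrow> y \<in> S"
      unfolding eventually_nhds_metric dist_real_def by blast
    \<comment> \<open>Small enough for the whole parallelogram with sides \<open>s v\<close> and
      \<open>s w\<close> to lie within \<open>d\<close> of \<open>x\<close>; the summand 1 covers
      the case where both vectors are zero.\<close>
    define s where "s = d / (norm v + norm w + 1)"
    have nn: "norm v + norm w + 1 > 0" by (simp add: add_nonneg_pos)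
    have s: "s > 0" "s * (norm v + norm w) < d"
      using d(1) nn by (auto simp: s_def field_simps)
    have near: "dist (x + \<sigma> *\<^sub>R a + \<tau> *\<^sub>R b) x < d"
      if "0 \<le> \<sigma>" "\<sigma> \<le> s" "0 \<le> \<tau>" "\<tau> \<le> s" "norm a + norm b = norm v + norm w" for \<sigma> \<tau> a b
    proof -
      have "dist (x + \<sigma> *\<^sub>R a + \<tau> *\<^sub>R b) x \<le> \<sigma> * norm a + \<tau> * norm b"
        using norm_triangle_ineq[of "\<sigma> *\<^sub>R a" "\<tau> *\<^sub>R b"] that by (simp add: dist_norm add.assoc)
      also have "\<dots> \<le> s * norm a + s * norm b"
        using that by (intro add_mono mult_right_mono) auto
      finally show ?thesis using s(2) that(5) by (simp add: distrib_left[symmetric])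
    qed
    have mix: "\<exists>y. dist y x < d \<and> f (x + s *\<^sub>R a + s *\<^sub>R b) - f (x + s *\<^sub>R a) - f (x + s *\<^sub>R b) + f x = s\<^sup>2 * hess f y a b"
      if "norm a + norm b = norm v + norm w" for a b
      using mixed_difference[OF S(1,2) s(1), of x a b] d(4) near[OF _ _ _ _ that] less_imp_le by metis
    obtain y y' where y: "dist y x < d" "dist y' x < d" and
      "f (x + s *\<^sub>R v + s *\<^sub>R w) - f (x + s *\<^sub>R v) - f (x + s *\<^sub>R w) + f x = s\<^sup>2 * hess f y v w"
      "f (x + s *\<^sub>R w + s *\<^sub>R v) - f (x + s *\<^sub>R w) - f (x + s *\<^sub>R v) + f x = s\<^sup>2 * hess f y' w v"
      using mix[of v w] mix[of w v] by (auto simp: add.commute)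
    moreover have "f (x + s *\<^sub>R w + s *\<^sub>R v) = f (x + s *\<^sub>R v + s *\<^sub>R w)" by (simp add: add_ac)
    ultimately have "s\<^sup>2 * hess f y v w = s\<^sup>2 * hess f y' w v" by linarith
    then have "hess f y v w = hess f y' w v" using s(1) by simp
    moreover note d(2)[OF y(1)] d(3)[OF y(2)]
    ultimately show "\<bar>hess f x v w - hess f x w v\<bar> \<le> 0 + e" by linarith
  qed
  then show ?thesis by simp
qed

lemma hess_sym:
  fixes f :: "'a::euclidean_space \<Rightarrow> 'b::euclidean_space"
  assumes "open S" "smooth_on S f" "x \<in> S"
  shows "hess f x v w = hess f x w v"
proof (rule euclidean_eqI)
  fix b :: 'b
  have "hess (\<lambda>y. f y \<bullet> b) x v w = hess (\<lambda>y. f y \<bullet> b) x w v"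
    by (rule hess_sym_real[OF assms(1) smooth_on_bounded_linear[OF bounded_linear_inner_left assms(1,2)] assms(3)])
  then show "hess f x v w \<bullet> b = hess f x w v \<bullet> b"
    using hess_bounded_linear[OF assms bounded_linear_inner_left] by metis
qed



subsection \<open>Null vectors\<close>

text \<open>The polar form of \<open>r t - s^2\<close>, so that \<open>mink v v\<close> is twice
  this quadratic form; hence the halves in \<open>mink u u / 2\<close> later on. It has one positive
  and two negative directions.\<close>

fun mink :: "real3 \<Rightarrow> real3 \<Rightarrow> real" where
  "mink (r, s, t) (r', s', t') = r * t' + t * r' - 2 * s * s'"

lemma mink_sym: "mink v w = mink w v"
  by (cases v; cases w) (auto simp: algebra_simps)

lemma mink_bilinear: "bounded_bilinear mink"
proof -
  have eq: "mink v w = fst v * snd (snd w) + snd (snd v) * fst w - 2 * (fst (snd v) * fst (snd w))" for v w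
    by (cases v; cases w) auto
  have "bilinear mink"
    unfolding bilinear_def by (auto intro!: linearI simp: eq algebra_simps)
  then show ?thesis by (simp add: bilinear_conv_bounded_bilinear)
qed

lemmas mink_left = bounded_bilinear.bounded_linear_left[OF mink_bilinear]
lemmas mink_FDERIV = bounded_bilinear.FDERIV[OF mink_bilinear]
lemmas mink_simps = bounded_bilinear.add_left[OF mink_bilinear] bounded_bilinear.add_right[OF mink_bilinear]
  bounded_bilinear.diff_left[OF mink_bilinear] bounded_bilinear.diff_right[OF mink_bilinear]
  bounded_bilinear.scaleR_left[OF mink_bilinear] bounded_bilinear.scaleR_right[OF mink_bilinear]
  bounded_bilinear.minus_left[OF mink_bilinear] bounded_bilinear.minus_right[OF mink_bilinear]
  bounded_bilinear.zero_left[OF mink_bilinear] bounded_bilinear.zero_right[OF mink_bilinear]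

lemma linear_triple:
  fixes l :: "real3 \<Rightarrow> 'a::real_vector"
  assumes "linear l"
  shows "l (r, s, t) = r *\<^sub>R l (1, 0, 0) + s *\<^sub>R l (0, 1, 0) + t *\<^sub>R l (0, 0, 1)"
proof -
  have "(r, s, t) = r *\<^sub>R (1, 0, 0) + s *\<^sub>R (0, 1, 0) + t *\<^sub>R (0, 0, 1 :: real)" by simp
  then show ?thesis
    by (simp only: linear_add[OF assms, symmetric] linear_cmul[OF assms, symmetric])
qed

definition mink_dual :: "(real3 \<Rightarrow> real) \<Rightarrow> real3" where
  "mink_dual l = (l (0, 0, 1), - (l (0, 1, 0) / 2), l (1, 0, 0))"

lemma mink_dual:
  assumes "linear l" shows "mink (mink_dual l) w = l w"
proof (cases w)
  case (fields r s t)
  show ?thesis unfolding fields linear_triple[OF assms, of r s t] by (simp add: mink_dual_def)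
qed

text \<open>The vector is the Euclidean cross product of \<open>v1\<close> and \<open>v2\<close>
  with its index raised by \<open>mink\<close>, and its square comes from a Gram identity. Two
  independent null vectors span a plane of signature (1,1), so the normal of this plane has negative
  square.\<close>

lemma null_complement:
  assumes "mink v1 v1 = 0" "mink v2 v2 = 0"
  obtains k where "mink k v1 = 0" "mink k v2 = 0" "mink k k = - ((mink v1 v2)\<^sup>2 / 2)"
proof -
  obtain r1 s1 t1 where v1: "v1 = (r1, s1, t1)" by (cases v1)
  obtain r2 s2 t2 where v2: "v2 = (r2, s2, t2)" by (cases v2)
  let ?k = "(r1 * s2 - s1 * r2, - ((t1 * r2 - r1 * t2) / 2), s1 * t2 - t1 * s2)"
  have 1: "r1 * t1 = s1 * s1" "r2 * t2 = s2 * s2" using assms by (auto simp: v1 v2)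
  have "4 * ((r1 * s2 - s1 * r2) * (s1 * t2 - t1 * s2)) - (t1 * r2 - r1 * t2)\<^sup>2 + (r1 * t2 + t1 * r2 - 2 * s1 * s2)\<^sup>2
     = 4 * (r1 * t1 - s1 * s1) * (r2 * t2 - s2 * s2)"
    by (simp add: power2_eq_square algebra_simps)
  then have "mink ?k ?k = - ((mink v1 v2)\<^sup>2 / 2)"
    using 1 by (simp add: v1 v2 power2_eq_square field_simps)
  moreover have "mink ?k v1 = 0" "mink ?k v2 = 0"
    by (simp_all add: v1 v2 field_simps)
  ultimately show ?thesis
    by (intro that[of ?k])
qed

lemma mink_zero:
  assumes "mink v1 v1 = 0" "mink v2 v2 = 0" "mink v1 v2 \<noteq> 0" "mink n v1 = 0" "mink n v2 = 0" "mink n n \<noteq> 0"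
    and x: "mink x v1 = 0" "mink x v2 = 0" "mink x n = 0"
  shows "x = 0"
proof -
  obtain r1 s1 t1 where v1: "v1 = (r1, s1, t1)" by (cases v1)
  obtain r2 s2 t2 where v2: "v2 = (r2, s2, t2)" by (cases v2)
  obtain r3 s3 t3 where n: "n = (r3, s3, t3)" by (cases n)
  obtain r s t where xx: "x = (r, s, t)" by (cases x)
  let ?D = "r1 * (s2 * t3 - t2 * s3) - s1 * (r2 * t3 - t2 * r3) + t1 * (r2 * s3 - s2 * r3)"
  \<comment> \<open>Gram determinant of \<open>v1\<close>, \<open>v2\<close>, \<open>n\<close>; the
    factor 2 is the determinant of \<open>mink\<close> in the standard basis.\<close>
  have gram: "2 * ?D\<^sup>2 = mink v1 v1 * (mink v2 v2 * mink n n - mink n v2 * mink n v2)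
     - mink v1 v2 * (mink v1 v2 * mink n n - mink n v2 * mink n v1)
     + mink n v1 * (mink v1 v2 * mink n v2 - mink v2 v2 * mink n v1)"
    by (simp add: v1 v2 n power2_eq_square algebra_simps)
  have D: "?D \<noteq> 0"
  proof
    assume "?D = 0"
    then have "mink v1 v2 * (mink v1 v2 * mink n n) = 0" using gram assms by simp
    then show False using assms by simp
  qed
  \<comment> \<open>Cramer's rule for \<open>x\<close> with its index lowered, which has the
    components \<open>t\<close>, \<open>- 2 * s\<close>, \<open>r\<close>.\<close>
  have "?D * t = mink x v1 * (s2 * t3 - t2 * s3) + mink x v2 * (s3 * t1 - t3 * s1) + mink x n * (s1 * t2 - t1 * s2)"
    "?D * (- 2 * s) = mink x v1 * (t2 * r3 - r2 * t3) + mink x v2 * (t3 * r1 - r3 * t1) + mink x n * (t1 * r2 - r1 * t2)"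
    "?D * r = mink x v1 * (r2 * s3 - s2 * r3) + mink x v2 * (r3 * s1 - s3 * r1) + mink x n * (r1 * s2 - s1 * r2)"
    by (simp_all add: v1 v2 n xx algebra_simps)
  then show ?thesis using D x by (simp add: xx zero_prod_def)
qed

lemma mink_basis:
  assumes "mink v1 v1 = 0" "mink v2 v2 = 0" "mink v1 v2 \<noteq> 0" "mink n v1 = 0" "mink n v2 = 0" "mink n n \<noteq> 0"
  shows "w = (mink w v2 / mink v1 v2) *\<^sub>R v1 + (mink w v1 / mink v1 v2) *\<^sub>R v2 + (mink w n / mink n n) *\<^sub>R n"
proof -
  have "w - ((mink w v2 / mink v1 v2) *\<^sub>R v1 + (mink w v1 / mink v1 v2) *\<^sub>R v2 + (mink w n / mink n n) *\<^sub>R n) = 0"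
    using assms by (intro mink_zero[OF assms])
      (simp_all add: mink_simps mink_sym[of v2 v1] mink_sym[of v1 n] mink_sym[of v2 n])
  then show ?thesis by simp
qed

text \<open>Two null vectors that span the kernel of \<open>l\<close> when \<open>l\<close> is
  nonzero. The condition on \<open>mink v1 v2\<close> encodes independence, because orthogonal null
  vectors are proportional in this signature.\<close>

definition null_pair :: "(real3 \<Rightarrow> real) \<Rightarrow> real3 \<Rightarrow> real3 \<Rightarrow> bool" where
  "null_pair l v1 v2 \<longleftrightarrow> l v1 = 0 \<and> l v2 = 0 \<and> mink v1 v1 = 0 \<and> mink v2 v2 = 0 \<and> mink v1 v2 \<noteq> 0"

lemma null_pair_kernel:
  assumes "null_pair l v1 v2" "linear l" "l u \<noteq> 0" "l w = 0"
  shows "w = (mink w v2 / mink v1 v2) *\<^sub>R v1 + (mink w v1 / mink v1 v2) *\<^sub>R v2"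
proof -
  obtain k where k: "mink k v1 = 0" "mink k v2 = 0" "mink k k = - ((mink v1 v2)\<^sup>2 / 2)"
    using assms null_complement unfolding null_pair_def by blast
  have kk: "mink k k \<noteq> 0" using k(3) assms by (simp add: null_pair_def)
  have b: "w = (mink w v2 / mink v1 v2) *\<^sub>R v1 + (mink w v1 / mink v1 v2) *\<^sub>R v2 + (mink w k / mink k k) *\<^sub>R k" for w
    using assms(1) k kk by (intro mink_basis) (auto simp: null_pair_def)
  have lb: "l w = (mink w k / mink k k) * l k" for w
    by (subst b[of w]) (use assms in \<open>simp add: null_pair_def linear_add linear_cmul\<close>)
  have "l k \<noteq> 0" using lb[of u] assms(3) by auto
  then have "mink w k = 0" using lb[of w] assms(4) kk by simp
  then show ?thesis using b[of w] by simp
qed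

lemma null_pair_null:
  assumes "null_pair l v1 v2" "linear l" "l u \<noteq> 0" "l w = 0" "mink w w = 0"
  shows "\<exists>c. w = c *\<^sub>R v1 \<or> w = c *\<^sub>R v2"
proof -
  define x y where "x = mink w v2 / mink v1 v2" "y = mink w v1 / mink v1 v2"
  have w: "w = x *\<^sub>R v1 + y *\<^sub>R v2" using null_pair_kernel[OF assms(1-4)] by (simp add: x_y_def)
  have "mink w w = 2 * x * y * mink v1 v2"
    unfolding w using assms(1) by (simp add: mink_simps null_pair_def mink_sym[of v2 v1])
  then have "x = 0 \<or> y = 0" using assms(1,5) by (simp add: null_pair_def)
  then show ?thesis using w by auto
qed

lemma null_pair_unique:
  assumes "null_pair l v1 v2" "linear l" "l u \<noteq> 0" "null_pair l w1 w2"
  shows "\<exists>c d. c \<noteq> 0 \<and> d \<noteq> 0 \<and> (w1 = c *\<^sub>R v1 \<and> w2 = d *\<^sub>R v2 \<or> w1 = c *\<^sub>R v2 \<and> w2 = d *\<^sub>R v1)"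
proof -
  obtain c where c: "w1 = c *\<^sub>R v1 \<or> w1 = c *\<^sub>R v2"
    using null_pair_null[OF assms(1-3), of w1] assms(4) by (auto simp: null_pair_def)
  obtain d where d: "w2 = d *\<^sub>R v1 \<or> w2 = d *\<^sub>R v2"
    using null_pair_null[OF assms(1-3), of w2] assms(4) by (auto simp: null_pair_def)
  have "mink w1 w2 \<noteq> 0" using assms(4) by (simp add: null_pair_def)
  then have "c \<noteq> 0" "d \<noteq> 0" "\<not> (w1 = c *\<^sub>R v1 \<and> w2 = d *\<^sub>R v1)" "\<not> (w1 = c *\<^sub>R v2 \<and> w2 = d *\<^sub>R v2)"
    using c d assms(1) by (auto simp: mink_simps null_pair_def)
  then show ?thesis using c d by blast
qed

text \<open>The vector dual to \<open>l\<close> is orthogonal to both null vectors, hence a nonzero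
  multiple of their complement, which has negative square. Together with
  \<open>discr_mink_dual\<close> this recovers hyperbolicity from the mere existence of a null pair,
  the form in which it is carried through a contact transformation.\<close>

lemma null_pair_timelike:
  assumes "null_pair l v1 v2" "linear l" "l u \<noteq> 0"
  shows "mink (mink_dual l) (mink_dual l) < 0"
proof -
  let ?n = "mink_dual l"
  obtain k where k: "mink k v1 = 0" "mink k v2 = 0" "mink k k = - ((mink v1 v2)\<^sup>2 / 2)"
    using assms null_complement unfolding null_pair_def by blast
  have kk: "mink k k < 0" using k(3) assms by (simp add: null_pair_def)
  have n: "mink ?n v1 = 0" "mink ?n v2 = 0"
    using assms by (auto simp: mink_dual null_pair_def)
  have b: "?n = (mink ?n v2 / mink v1 v2) *\<^sub>R v1 + (mink ?n v1 / mink v1 v2) *\<^sub>R v2 + (mink ?n k / mink k k) *\<^sub>R k"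
    using assms(1) k kk by (intro mink_basis) (auto simp: null_pair_def)
  define x where "x = mink ?n k / mink k k"
  have nx: "?n = x *\<^sub>R k" using b n by (simp add: x_def)
  have "x \<noteq> 0"
  proof
    assume "x = 0"
    then show False using nx assms(3) mink_dual[OF assms(2), of u] by (simp add: mink_simps)
  qed
  then have "x * x > 0" by (auto simp: zero_less_mult_iff linorder_neq_iff)
  then show ?thesis using nx kk by (simp add: mink_simps mult_pos_neg flip: mult.assoc)
qed

subsection \<open>The invariants as second derivatives in the null directions\<close>

abbreviation vderiv :: "(jet2 \<Rightarrow> real) \<Rightarrow> jet2 \<Rightarrow> real3 \<Rightarrow> real" where
  "vderiv F m \<equiv> (\<lambda>v. fder F m (0, v))"

definition vhess :: "(jet2 \<Rightarrow> real) \<Rightarrow> jet2 \<Rightarrow> real3 \<Rightarrow> real" where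
  "vhess F m v = hess F m (0, v) (0, v)"

text \<open>Each pattern reads only what survives an exchange of the two values, positive factors
  and a common sign. It can therefore be tested on any null pair, any moving frame and any defining
  function.\<close>

fun null_pattern :: "pde_class \<Rightarrow> real \<Rightarrow> real \<Rightarrow> bool" where
  "null_pattern MongeAmpere a b \<longleftrightarrow> a = 0 \<and> b = 0"
| "null_pattern Goursat a b \<longleftrightarrow> (a = 0) \<noteq> (b = 0)"
| "null_pattern TwoElliptic a b \<longleftrightarrow> a * b > 0"
| "null_pattern TwoHyperbolic a b \<longleftrightarrow> a * b < 0"

lemma null_pattern_swap: "null_pattern k a b \<longleftrightarrow> null_pattern k b a"
  by (cases k) (auto simp: mult.commute)

lemma null_pattern_scale:
  assumes "c * d > 0"
  shows "null_pattern k (c * a) (d * b) \<longleftrightarrow> null_pattern k a b"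
proof -
  have "c * a * (d * b) = (c * d) * (a * b)" by simp
  then show ?thesis using assms
    by (cases k) (auto simp: zero_less_mult_iff mult_less_0_iff)
qed

lemma null_pattern_disjoint: "null_pattern k a b \<Longrightarrow> null_pattern k' a b \<Longrightarrow> k = k'"
  by (cases k; cases k') auto

lemma vderiv_linear:
  assumes "F differentiable at m" shows "linear (vderiv F m)"
proof -
  have "linear (\<lambda>v. fder F m ((\<lambda>v. (0, v)) v))"
    by (rule linear_compose[unfolded o_def, of "\<lambda>v. (0, v)"])
       (auto intro!: linearI linear_frechet_derivative assms)
  then show ?thesis by simp
qed

lemma vhess_scale:
  assumes "open U" "smooth_on U F" "m \<in> U"
  shows "vhess F m (c *\<^sub>R v) = c\<^sup>2 * vhess F m v"
proof -
  have "(0, c *\<^sub>R v) = c *\<^sub>R ((0, v) :: jet2)" by simp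
  then show ?thesis
    unfolding vhess_def
    by (simp only: linear_cmul[OF hess_linear1[OF assms]] linear_cmul[OF hess_linear2[OF assms]])
       (simp add: power2_eq_square)
qed

lemma null_pattern_null_pair:
  assumes "open U" "smooth_on U F" "m \<in> U" "vderiv F m u \<noteq> 0"
    and "null_pair (vderiv F m) v1 v2" "null_pair (vderiv F m) w1 w2"
  shows "null_pattern k (vhess F m v1) (vhess F m v2) \<longleftrightarrow> null_pattern k (vhess F m w1) (vhess F m w2)"
proof -
  have l: "linear (vderiv F m)" by (rule vderiv_linear[OF smooth_on_differentiable[OF assms(2,3)]])
  obtain c d where cd: "c \<noteq> 0" "d \<noteq> 0" "w1 = c *\<^sub>R v1 \<and> w2 = d *\<^sub>R v2 \<or> w1 = c *\<^sub>R v2 \<and> w2 = d *\<^sub>R v1"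
    using null_pair_unique[OF assms(5) l assms(4,6)] by blast
  have "c\<^sup>2 * d\<^sup>2 > 0" using cd by simp
  then show ?thesis
    using cd(3) null_pattern_scale[of "c\<^sup>2" "d\<^sup>2" k] null_pattern_swap
    by (auto simp: vhess_scale[OF assms(1-3)])
qed

lemma discr_mink_dual: "mink (mink_dual (vderiv F m)) (mink_dual (vderiv F m)) = 2 * discr F m"
  by (simp add: mink_dual_def discr_def along_def power2_eq_square)

lemma smooth_on_d:
  assumes "open U" "smooth_on U F" shows "smooth_on U (d_r F)" "smooth_on U (d_s F)" "smooth_on U (d_t F)"
  using smooth_on_along[OF assms] by auto

lemma smooth_on_discr:
  assumes "open U" "smooth_on U F" shows "smooth_on U (discr F)"
  unfolding discr_def[abs_def] power2_eq_square
  by (intro smooth_on_diff smooth_on_mult smooth_on_const smooth_on_d assms)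

text \<open>The sign of \<open>F\<close> is normalised at one point only, while \<open>I1\<close>
  and \<open>I2\<close> differentiate quotients by \<open>lambda_plus\<close>. The normalisation
  makes \<open>lambda_plus\<close> positive at the point, and this set is an open neighbourhood on
  which it stays positive and smooth, even where \<open>F_s\<close> turns negative.\<close>

definition lambda_domain :: "jet2 set \<Rightarrow> (jet2 \<Rightarrow> real) \<Rightarrow> jet2 set" where
  "lambda_domain U F = {m \<in> U. discr F m < 0 \<and> lambda_plus F m > 0}"

lemma lambda_domain:
  assumes "open U" "smooth_on U F"
  shows "open (lambda_domain U F)" "smooth_on (lambda_domain U F) (lambda_plus F)"
proof -
  let ?V = "{m \<in> U. discr F m < 0}"
  have V: "open ?V"
    using smooth_on_open_vimage[OF assms(1) smooth_on_discr[OF assms] open_lessThan[of 0]] by simp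
  have "smooth_on ?V (\<lambda>m. (1/2) * d_s F m + (- discr F m) powr (1/2))"
    by (intro smooth_on_add smooth_on_mult smooth_on_powr smooth_on_minus V smooth_on_const
        smooth_on_subset[OF smooth_on_discr[OF assms]] smooth_on_subset[OF smooth_on_d(2)[OF assms]]) auto
  then have L: "smooth_on ?V (lambda_plus F)"
    by (rule smooth_on_cong[OF V]) (auto simp: lambda_plus_def powr_half_sqrt)
  show "open (lambda_domain U F)"
    using smooth_on_open_vimage[OF V L open_greaterThan[of 0]] by (simp add: lambda_domain_def)
  show "smooth_on (lambda_domain U F) (lambda_plus F)"
    by (rule smooth_on_subset[OF L]) (auto simp: lambda_domain_def)
qed

lemma lambda_plus_root:
  assumes "discr F m < 0"
  shows "(lambda_plus F m)\<^sup>2 = d_s F m * lambda_plus F m - d_r F m * d_t F m"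
proof -
  have "(sqrt (- discr F m))\<^sup>2 = - discr F m" using assms by simp
  then show ?thesis
    unfolding lambda_plus_def power2_sum by (simp add: discr_def power2_eq_square algebra_simps)
qed

text \<open>The two roots of the characteristic equation \<open>F\<^sub>r \<phi>\<^sup>2 - F\<^sub>s \<phi> + F\<^sub>t = 0\<close>, read from either end,
  are the arguments differentiated in \<open>I\<^sub>1\<close> and \<open>I\<^sub>2\<close>; the cofactors of the last row are the null vectors below.\<close>

definition null1 :: "(jet2 \<Rightarrow> real) \<Rightarrow> jet2 \<Rightarrow> real3" where
  "null1 F m = ((d_t F m)\<^sup>2, - (d_t F m * lambda_plus F m), (lambda_plus F m)\<^sup>2)"

definition null2 :: "(jet2 \<Rightarrow> real) \<Rightarrow> jet2 \<Rightarrow> real3" where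
  "null2 F m = ((lambda_plus F m)\<^sup>2, - (d_r F m * lambda_plus F m), (d_r F m)\<^sup>2)"

lemma null_pair_null12:
  assumes "F differentiable at m" "discr F m < 0" "lambda_plus F m > 0"
  shows "null_pair (vderiv F m) (null1 F m) (null2 F m)"
proof -
  define a b c L where abc: "a = d_r F m" "b = d_s F m" "c = d_t F m" "L = lambda_plus F m"
  have root: "L * L = b * L - a * c"
    using lambda_plus_root[OF assms(2)] by (simp add: abc power2_eq_square)
  have ld: "vderiv F m (r, s, t) = r * a + s * b + t * c" for r s t
    by (subst linear_triple[OF vderiv_linear[OF assms(1)]]) (simp add: abc along_def)
  have "vderiv F m (null1 F m) = c * (a * c - b * L + L * L)" "vderiv F m (null2 F m) = a * (L * L - b * L + a * c)"
    unfolding null1_def null2_def ld by (simp_all add: abc[symmetric] power2_eq_square algebra_simps)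
  then have 1: "vderiv F m (null1 F m) = 0" "vderiv F m (null2 F m) = 0" using root by auto
  \<comment> \<open>\<open>L\<close> and \<open>a * c / L\<close> are the two roots of
    \<open>X^2 - b X + a c\<close>, and their difference is twice the square root of
    \<open>- discr F m\<close>.\<close>
  have "L * L - a * c = L * (2 * sqrt (- discr F m))"
    using root by (simp add: abc lambda_plus_def algebra_simps)
  then have "L * L - a * c \<noteq> 0" using assms(2,3) by (simp add: abc)
  moreover have "mink (null1 F m) (null2 F m) = (L * L - a * c)\<^sup>2"
    by (simp add: null1_def null2_def abc[symmetric] power2_eq_square algebra_simps)
  ultimately show ?thesis
    using 1 by (simp add: null_pair_def) (simp add: null1_def null2_def power2_eq_square)
qed

text \<open>Implicit differentiation of the characteristic equation; its coefficients are first
  derivatives of \<open>F\<close>, so their derivatives are entries of the Hessian. The two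
  directions \<open>eA\<close> and \<open>eB\<close> are kept abstract because the equations for
  \<open>I1\<close> and \<open>I2\<close> differ by exchanging the \<open>r\<close> and
  \<open>t\<close> directions.\<close>

lemma root_derivative:
  fixes \<phi> :: "jet2 \<Rightarrow> real"
  assumes F: "open U" "smooth_on U F" "m \<in> U" and \<phi>: "(\<phi> has_derivative \<phi>') (at m)"
    and N: "open N" "m \<in> N" "\<And>y. y \<in> N \<Longrightarrow> A y * (\<phi> y)\<^sup>2 - d_s F y * \<phi> y + B y = 0"
    and AB: "A = along (\<lambda>_. eA) F" "B = along (\<lambda>_. eB) F"
  shows "(2 * A m * \<phi> m - d_s F m) * \<phi>' w = - hess F m w ((\<phi> m)\<^sup>2 *\<^sub>R eA - \<phi> m *\<^sub>R (0, 0, 1, 0) + eB)"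
proof -
  let ?e = "(0, 0, 1, 0) :: jet2"
  have d1: "((\<lambda>y. along (\<lambda>_. eA) F y * (\<phi> y)\<^sup>2 - along (\<lambda>_. ?e) F y * \<phi> y + along (\<lambda>_. eB) F y) has_derivative
     (\<lambda>w. A m * (2 * \<phi> m * \<phi>' w) + hess F m w eA * (\<phi> m)\<^sup>2 - (d_s F m * \<phi>' w + hess F m w ?e * \<phi> m) + hess F m w eB)) (at m)"
    unfolding AB along_def
    by ((rule derivative_eq_intros \<phi> hess_deriv[OF F] refl)+) (simp add: fun_eq_iff algebra_simps)
  have "A m * (2 * \<phi> m * \<phi>' w) + hess F m w eA * (\<phi> m)\<^sup>2 - (d_s F m * \<phi>' w + hess F m w ?e * \<phi> m) + hess F m w eB = 0"
    by (rule derivative_locally_const[OF d1 N(1,2), of 0]) (use N(3) AB in auto)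
  moreover have "hess F m w ((\<phi> m)\<^sup>2 *\<^sub>R eA - \<phi> m *\<^sub>R ?e + eB) = (\<phi> m)\<^sup>2 * hess F m w eA - \<phi> m * hess F m w ?e + hess F m w eB"
    by (simp only: linear_add[OF hess_linear2[OF F]] linear_diff[OF hess_linear2[OF F]]
        linear_cmul[OF hess_linear2[OF F]] real_scaleR_def)
  ultimately show ?thesis by (simp add: algebra_simps)
qed

text \<open>In the direction \<open>(0, v)\<close> the vector fed into the Hessian by
  \<open>root_derivative\<close> is \<open>(0, v)\<close> divided by \<open>L^2\<close>, so the
  second derivative along \<open>v\<close> itself appears. The coefficient of the derivative of
  \<phi> equals \<open>- 2 * q\<close>, nonzero because the roots are distinct.\<close>

lemma characteristic_derivative:
  fixes a b c L :: real
  assumes F: "open U" "smooth_on U F" "m \<in> U" and \<phi>: "(\<phi> has_derivative \<phi>') (at m)"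
    and N: "open N" "m \<in> N" "\<And>y. y \<in> N \<Longrightarrow> along (\<lambda>_. eA) F y * (\<phi> y)\<^sup>2 - d_s F y * \<phi> y + along (\<lambda>_. eB) F y = 0"
    and \<phi>m: "\<phi> m = c / L" and L: "L > 0" and root: "L * L = d_s F m * L - along (\<lambda>_. eA) F m * c"
    and q: "d_s F m = 2 * L - 2 * q" "q \<noteq> 0"
    and v: "((0, v) :: jet2) = (c * c) *\<^sub>R eA - (c * L) *\<^sub>R (0, 0, 1, 0) + (L * L) *\<^sub>R eB"
  shows "(c * c) * \<phi>' eA - (c * L) * \<phi>' (0, 0, 1, 0) + (L * L) * \<phi>' eB = 0 \<longleftrightarrow> vhess F m v = 0"
proof -
  let ?a = "along (\<lambda>_. eA) F m" and ?b = "d_s F m"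
  have l: "linear \<phi>'" using \<phi> by (rule has_derivative_linear)
  have 1: "(c * c) * \<phi>' eA - (c * L) * \<phi>' (0, 0, 1, 0) + (L * L) * \<phi>' eB = \<phi>' (0, v)"
    by (simp only: v linear_add[OF l] linear_diff[OF l] linear_cmul[OF l] real_scaleR_def)
  have "(\<phi> m)\<^sup>2 *\<^sub>R eA - \<phi> m *\<^sub>R (0, 0, 1, 0) + eB = (1 / (L * L)) *\<^sub>R (0, v)"
    unfolding v using L by (simp add: \<phi>m power2_eq_square scaleR_add_right scaleR_diff_right)
  from root_derivative[OF F \<phi> N refl refl, of "(0, v)", unfolded this linear_cmul[OF hess_linear2[OF F]]]
  have 2: "(2 * ?a * \<phi> m - ?b) * \<phi>' (0, v) = - vhess F m v / (L * L)"
    by (simp add: vhess_def)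
  have "(2 * ?a * \<phi> m - ?b) * L = 2 * (?a * c) - ?b * L" using L by (simp add: \<phi>m field_simps)
  also have "\<dots> = - 2 * q * L"
  proof -
    have "?b * L = 2 * (L * L) - 2 * q * L" unfolding q(1) by (simp add: algebra_simps)
    then show ?thesis using root by linarith
  qed
  finally have "2 * ?a * \<phi> m - ?b \<noteq> 0" using L q(2) by auto
  then show ?thesis
    using 1 2 L by (metis divide_eq_0_iff mult_eq_0_iff neg_equal_0_iff_equal less_irrefl)
qed

lemma I12_vhess:
  assumes F: "open U" "smooth_on U F" "m \<in> U" and d: "discr F m < 0" and l: "lambda_plus F m > 0"
  shows "I1 F m = 0 \<longleftrightarrow> vhess F m (null1 F m) = 0" "I2 F m = 0 \<longleftrightarrow> vhess F m (null2 F m) = 0"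
proof -
  define a b c L where abc: "a = d_r F m" "b = d_s F m" "c = d_t F m" "L = lambda_plus F m"
  have L: "L > 0" using l by (simp add: abc)
  have root: "L * L = b * L - a * c"
    using lambda_plus_root[OF d] by (simp add: abc power2_eq_square)
  define q where "q = sqrt (- discr F m)"
  have q: "b = 2 * L - 2 * q" "q \<noteq> 0" using d by (auto simp: q_def abc lambda_plus_def)
  let ?N = "lambda_domain U F"
  have N: "open ?N" "m \<in> ?N" using lambda_domain[OF F(1,2)] F d l by (auto simp: lambda_domain_def)
  have NU: "?N \<subseteq> U" by (auto simp: lambda_domain_def)
  define \<phi> \<psi> where \<phi>\<psi>: "\<phi> = (\<lambda>m. d_t F m / lambda_plus F m)" "\<psi> = (\<lambda>m. d_r F m / lambda_plus F m)"
  have quot: "smooth_on ?N (\<lambda>m. g m / lambda_plus F m)" if "smooth_on U g" for g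
  proof -
    have "smooth_on ?N (\<lambda>m. g m * lambda_plus F m powr (- 1))"
      by (intro smooth_on_mult smooth_on_powr N(1) smooth_on_subset[OF that NU] lambda_domain[OF F(1,2)])
        (auto simp: lambda_domain_def)
    from smooth_on_cong[OF N(1) this] show ?thesis
      by (simp add: lambda_domain_def powr_minus_divide)
  qed
  obtain \<phi>' \<psi>' where d\<phi>: "(\<phi> has_derivative \<phi>') (at m)" and d\<psi>: "(\<psi> has_derivative \<psi>') (at m)"
    using smooth_on_deriv[OF quot[OF smooth_on_d(3)[OF F(1,2)]] N(2)]
      smooth_on_deriv[OF quot[OF smooth_on_d(1)[OF F(1,2)]] N(2)] unfolding \<phi>\<psi> by blast
  have rr: "d_r F y * (\<phi> y)\<^sup>2 - d_s F y * \<phi> y + d_t F y = 0" "d_t F y * (\<psi> y)\<^sup>2 - d_s F y * \<psi> y + d_r F y = 0"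
    if "y \<in> ?N" for y
  proof -
    define L where "L = lambda_plus F y"
    have y: "L > 0" and r: "L * L = d_s F y * L - d_r F y * d_t F y"
      using that lambda_plus_root[of F y] by (auto simp: lambda_domain_def L_def power2_eq_square)
    have "(d_r F y * (\<phi> y)\<^sup>2 - d_s F y * \<phi> y + d_t F y) * (L * L) = d_t F y * (d_r F y * d_t F y - d_s F y * L + L * L)"
      "(d_t F y * (\<psi> y)\<^sup>2 - d_s F y * \<psi> y + d_r F y) * (L * L) = d_r F y * (d_r F y * d_t F y - d_s F y * L + L * L)"
      unfolding \<phi>\<psi> L_def[symmetric] using y by (simp_all add: power2_eq_square field_simps)
    then show "d_r F y * (\<phi> y)\<^sup>2 - d_s F y * \<phi> y + d_t F y = 0" "d_t F y * (\<psi> y)\<^sup>2 - d_s F y * \<psi> y + d_r F y = 0"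
      using y r by auto
  qed
  let ?r = "(0, 1, 0, 0) :: jet2" and ?s = "(0, 0, 1, 0) :: jet2" and ?t = "(0, 0, 0, 1) :: jet2"
  \<comment> \<open>Cofactor expansion along the last row. The cofactor of the last entry of
    \<open>I1\<close> is \<open>a * c - b * L\<close>; it is rewritten as \<open>- L * L\<close>
    plus the left side of the characteristic equation, which is zero. \<open>I2\<close> is treated
    likewise.\<close>
  have "I1 F m = - ((c * c) * \<phi>' ?r - (c * L) * \<phi>' ?s + (L * L) * \<phi>' ?t) + (a * c - b * L + L * L) * \<phi>' ?t"
    "I2 F m = - ((a * a) * \<psi>' ?t - (a * L) * \<psi>' ?s + (L * L) * \<psi>' ?r) + (a * c - b * L + L * L) * \<psi>' ?r"
    unfolding I1_def I2_def Let_def \<phi>\<psi>[symmetric]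
    by (simp_all add: det_3 along_const_eq[OF d\<phi>] along_const_eq[OF d\<psi>] abc[symmetric] algebra_simps)
  moreover have "(c * c) * \<phi>' ?r - (c * L) * \<phi>' ?s + (L * L) * \<phi>' ?t = 0 \<longleftrightarrow> vhess F m (null1 F m) = 0"
    by (rule characteristic_derivative[OF F d\<phi> N rr(1) _ L _ _ q(2)])
      (use root q(1) in \<open>simp_all add: \<phi>\<psi> abc null1_def power2_eq_square\<close>)
  moreover have "(a * a) * \<psi>' ?t - (a * L) * \<psi>' ?s + (L * L) * \<psi>' ?r = 0 \<longleftrightarrow> vhess F m (null2 F m) = 0"
    by (rule characteristic_derivative[OF F d\<psi> N rr(2) _ L _ _ q(2)])
      (use root q(1) in \<open>simp_all add: \<phi>\<psi> abc null2_def power2_eq_square mult.commute\<close>)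
  moreover have "a * c - b * L + L * L = 0" using root by simp
  ultimately show "I1 F m = 0 \<longleftrightarrow> vhess F m (null1 F m) = 0" "I2 F m = 0 \<longleftrightarrow> vhess F m (null2 F m) = 0"
    by (simp_all only: mult_zero_left add_0_right neg_equal_0_iff_equal)
qed

subsection \<open>Local parametrisation of a surface\<close>

text \<open>One coordinate has a nonzero coefficient in \<open>l\<close>. \<open>P\<close> forgets
  that coordinate, \<open>E\<close> restores it so as to land in the kernel, and \<open>y0\<close>
  is the coordinate vector rescaled to \<open>l y0 = 1\<close>.\<close>

lemma kernel_splitting:
  fixes l :: "real3 \<Rightarrow> real"
  assumes "linear l" "l u \<noteq> 0"
  obtains P E y0 where "bounded_linear (P :: real3 \<Rightarrow> real \<times> real)" "bounded_linear E" "P y0 = 0" "l y0 = 1"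
    "\<And>a. P (E a) = a" "\<And>w. w = E (P w) + l w *\<^sub>R y0"
proof -
  define a b c where abc: "a = l (1, 0, 0)" "b = l (0, 1, 0)" "c = l (0, 0, 1)"
  have l: "l w = fst w * a + fst (snd w) * b + snd (snd w) * c" for w
    using linear_triple[OF assms(1), of "fst w" "fst (snd w)" "snd (snd w)"] by (simp add: abc)
  have lin: "bounded_linear P" if "\<And>v w. P (v + w) = P v + P w" "\<And>x v. P (x *\<^sub>R v) = x *\<^sub>R P v"
    for P :: "'x::euclidean_space \<Rightarrow> 'y::euclidean_space"
    using that by (intro linear_conv_bounded_linear[THEN iffD1] linearI) auto
  have "a \<noteq> 0 \<or> b \<noteq> 0 \<or> c \<noteq> 0" using assms(2) l by auto
  then consider "a \<noteq> 0" | "b \<noteq> 0" | "c \<noteq> 0" by blast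
  then show ?thesis
  proof cases
    case 1
    show ?thesis
      by (rule that[of "\<lambda>w. (fst (snd w), snd (snd w))" "\<lambda>x. (- (fst x * b + snd x * c) / a, fst x, snd x)" "(1 / a, 0, 0)"])
         (use 1 in \<open>auto intro!: lin simp: l field_simps prod_eq_iff\<close>)
  next
    case 2
    show ?thesis
      by (rule that[of "\<lambda>w. (fst w, snd (snd w))" "\<lambda>x. (fst x, - (fst x * a + snd x * c) / b, snd x)" "(0, 1 / b, 0)"])
         (use 2 in \<open>auto intro!: lin simp: l field_simps prod_eq_iff\<close>)
  next
    case 3
    show ?thesis
      by (rule that[of "\<lambda>w. (fst w, fst (snd w))" "\<lambda>x. (fst x, snd x, - (fst x * a + snd x * b) / c)" "(0, 0, 1 / c)"])
         (use 3 in \<open>auto intro!: lin simp: l field_simps prod_eq_iff\<close>)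
  qed
qed

text \<open>The surface is a graph over \<open>D\<close>: \<open>P\<close> is the linear projection along \<open>y0\<close>, \<open>E\<close> a linear section of it, and
  \<open>g\<close> the inverse of \<open>P\<close> on the surface.\<close>

definition
  "surface_chart f x0 S P E y0 e D N g \<longleftrightarrow> bounded_linear P \<and> bounded_linear E \<and> P y0 = 0 \<and>
    (\<forall>w. w = E (P w) + fder f x0 w *\<^sub>R y0) \<and> e > 0 \<and>
    D = (ball (fst (P x0)) e \<times> ball (snd (P x0)) e :: (real \<times> real) set) \<and> open N \<and> x0 \<in> N \<and> N \<subseteq> S \<and> smooth_on D g \<and>
    (\<forall>a\<in>D. g a \<in> N \<and> f (g a) = 0 \<and> P (g a) = a) \<and>
    (\<forall>x\<in>N. f x = 0 \<longrightarrow> P x \<in> D \<and> g (P x) = x) \<and> (\<forall>x\<in>N. fder f x y0 > 0)"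

text \<open>The map \<open>G\<close> below replaces the component along \<open>y0\<close> by the
  value of \<open>f\<close>; its derivative at \<open>x0\<close> is the identity, and the surface is
  the preimage of the range of \<open>E\<close>. Only differentiability is taken from the inverse
  function theorem. Smoothness is bootstrapped from an explicit formula for the derivative.\<close>

lemma local_param:
  fixes f :: "real3 \<Rightarrow> real"
  assumes S: "open S" "smooth_on S f" "x0 \<in> S" "f x0 = 0" "fder f x0 u \<noteq> 0"
  shows "\<exists>(P :: real3 \<Rightarrow> real \<times> real) E y0 e D N \<rho>. surface_chart f x0 S P E y0 e D N \<rho>"
proof -
  let ?Df = "\<lambda>x. fder f x"
  have lin: "linear (?Df x)" if "x \<in> S" for x
    by (rule smooth_on_linear[OF S(2) that])
  obtain P :: "real3 \<Rightarrow> real \<times> real" and E y0 where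
    P: "bounded_linear P" and E: "bounded_linear E" and y0: "P y0 = 0" "?Df x0 y0 = 1"
    and PE: "\<And>a. P (E a) = a" and split: "\<And>w. w = E (P w) + ?Df x0 w *\<^sub>R y0"
    using kernel_splitting[OF lin[OF S(3)] S(5)] by blast
  let ?U = "{x \<in> S. ?Df x y0 > 0}"
  have U: "open ?U"
    using smooth_on_open_vimage[OF S(1) smooth_on_frechet[OF S(1,2)] open_greaterThan[of 0]] by simp
  have x0U: "x0 \<in> ?U" using S(3) y0 by simp
  define G where "G x = E (P x) + f x *\<^sub>R y0" for x
  define G' where "G' x w = E (P w) + ?Df x w *\<^sub>R y0" for x w
  have EP: "bounded_linear (\<lambda>w. E (P w))" using bounded_linear_compose[OF E P] by (simp add: o_def)
  have dG: "(G has_derivative G' x) (at x)" if "x \<in> S" for x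
    unfolding G_def G'_def
    by (intro has_derivative_add bounded_linear_imp_has_derivative EP has_derivative_scaleR_left smooth_on_deriv[OF S(2) that])
  have bl: "bounded_linear (G' x)" if "x \<in> S" for x
    using dG[OF that] has_derivative_bounded_linear by blast
  have dG': "(G has_derivative blinfun_apply (Blinfun (G' x))) (at x)" if "x \<in> ?U" for x
    using dG[of x] bl[of x] that by (simp add: bounded_linear_Blinfun_apply)
  have "continuous_on ?U (\<lambda>x. ?Df x j)" for j
    by (rule continuous_on_subset[OF smooth_on_continuous_on[OF smooth_on_frechet[OF S(1,2)]]]) auto
  then have "((\<lambda>x. Blinfun (G' x)) \<longlongrightarrow> Blinfun (G' a)) (at a within ?U)" if "a \<in> ?U" for a
  proof (intro tendsto_componentwise1)
    fix j :: "real3"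
    assume c: "\<And>j. continuous_on ?U (\<lambda>x. ?Df x j)"
    have "((\<lambda>x. G' x j) \<longlongrightarrow> G' a j) (at a within ?U)"
      unfolding G'_def using c[of j, unfolded continuous_on_def, rule_format, OF that]
      by (intro tendsto_intros)
    moreover have "eventually (\<lambda>x. G' x j = blinfun_apply (Blinfun (G' x)) j) (at a within ?U)"
      using bl unfolding eventually_at_filter by (intro always_eventually) (auto simp: bounded_linear_Blinfun_apply)
    ultimately show "((\<lambda>x. blinfun_apply (Blinfun (G' x)) j) \<longlongrightarrow> blinfun_apply (Blinfun (G' a)) j) (at a within ?U)"
      using bl that by (simp add: bounded_linear_Blinfun_apply tendsto_cong)
  qed
  then have cont: "continuous_on ?U (\<lambda>x. Blinfun (G' x))" by (simp add: continuous_on_def)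
  have inv: "id_blinfun o\<^sub>L Blinfun (G' x0) = id_blinfun"
  proof (rule blinfun_eqI)
    fix i
    have "G' x0 i = i" unfolding G'_def using split[of i] by (rule sym)
    then show "blinfun_apply (id_blinfun o\<^sub>L Blinfun (G' x0)) i = blinfun_apply id_blinfun i"
      using bl[OF S(3)] by (simp add: bounded_linear_Blinfun_apply)
  qed
  obtain U' V g g' where U': "open U'" "U' \<subseteq> ?U" "x0 \<in> U'" and V: "open V" "G x0 \<in> V" and hom: "homeomorphism U' V G g"
    and dg: "\<And>y. y \<in> V \<Longrightarrow> (g has_derivative g' y) (at y)"
  proof (rule inverse_function_theorem[OF U dG' cont x0U inv])
    fix U' V g g'
    assume "open U'" "U' \<subseteq> ?U" "x0 \<in> U'" "open V" "G x0 \<in> V" "homeomorphism U' V G g"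
      "\<And>y. y \<in> V \<Longrightarrow> (g has_derivative g' y) (at y)"
    then show thesis by (rule that)
  qed
  have Gx0: "G x0 = E (P x0)" by (simp add: G_def S)
  have PG: "P (G x) = P x" for x
    using bounded_linear.linear[OF P] y0 PE by (simp add: G_def linear_add linear_cmul)
  have GE: "f x = 0 \<longleftrightarrow> G x = E (P x)" for x
  proof -
    have "y0 \<noteq> 0" using y0(2) lin[OF S(3)] linear_0 by force
    then show ?thesis by (simp add: G_def)
  qed
  have "open (E -` V)" using V(1) E by (simp add: linear_continuous_on continuous_open_vimage linear_continuous_at)
  moreover have "P x0 \<in> E -` V" using V Gx0 by simp
  ultimately obtain A B where AB: "open A" "open B" "fst (P x0) \<in> A" "snd (P x0) \<in> B" "A \<times> B \<subseteq> E -` V"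
    by (auto elim!: open_prod_elim simp: mem_Times_iff)
  then obtain e1 e2 where "e1 > 0" "ball (fst (P x0)) e1 \<subseteq> A" "e2 > 0" "ball (snd (P x0)) e2 \<subseteq> B"
    by (metis open_contains_ball)
  define e where "e = min e1 e2"
  have e: "e > 0" using \<open>e1 > 0\<close> \<open>e2 > 0\<close> by (simp add: e_def)
  \<comment> \<open>A product of two intervals, so that a function whose derivative in one variable
    vanishes does not depend on that variable.\<close>
  define D where "D = ball (fst (P x0)) e \<times> ball (snd (P x0)) e"
  have "ball (fst (P x0)) e \<subseteq> A" "ball (snd (P x0)) e \<subseteq> B"
    using \<open>ball (fst (P x0)) e1 \<subseteq> A\<close> \<open>ball (snd (P x0)) e2 \<subseteq> B\<close> by (auto simp: e_def)
  then have DV: "E a \<in> V" if "a \<in> D" for a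
    using AB(5) that by (auto simp: D_def)
  have D: "open D" "P x0 \<in> D" using e by (auto simp: D_def open_Times mem_Times_iff)
  define \<rho> where "\<rho> a = g (E a)" for a
  define N where "N = U' \<inter> P -` D"
  have N: "open N" "x0 \<in> N" "N \<subseteq> ?U"
    using U' D P by (auto simp: N_def intro!: open_Int continuous_open_vimage linear_continuous_at)
  have \<rho>: "\<rho> a \<in> N \<and> f (\<rho> a) = 0 \<and> P (\<rho> a) = a" if "a \<in> D" for a
  proof -
    have "\<rho> a \<in> U'" "G (\<rho> a) = E a"
      using hom DV[OF that] by (auto simp: homeomorphism_def \<rho>_def)
    moreover have "P (\<rho> a) = a" using PG[of "\<rho> a"] \<open>G (\<rho> a) = E a\<close> PE by simp
    ultimately show ?thesis using GE[of "\<rho> a"] that by (simp add: N_def)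
  qed
  have \<rho>P: "P x \<in> D \<and> \<rho> (P x) = x" if "x \<in> N" "f x = 0" for x
    using that GE[of x] hom by (auto simp: N_def \<rho>_def homeomorphism_def)
  \<comment> \<open>The tangent vector at \<open>x\<close> that \<open>P\<close> projects to
    \<open>b\<close>: \<open>E b\<close> corrected along \<open>y0\<close> until the differential of
    \<open>f\<close> kills it. The exponent -1 is the reciprocal, smooth because the base is
    positive on \<open>N\<close>.\<close>
  define K where "K b x = E b - (?Df x (E b) * (?Df x y0) powr (- 1)) *\<^sub>R y0" for b x
  have sK: "smooth_on N (K b)" for b
    unfolding K_def
    by (intro smooth_on_diff smooth_on_scaleR smooth_on_mult smooth_on_const smooth_on_powr N
         smooth_on_subset[OF smooth_on_frechet[OF S(1,2)]]) (use N in auto)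
  have d\<rho>: "\<exists>L. (\<rho> has_derivative L) (at a) \<and> (\<forall>b. L b = K b (\<rho> a))" if a: "a \<in> D" for a
  proof -
    define L where "L h = g' (E a) (E h)" for h
    have L: "(\<rho> has_derivative L) (at a)"
      unfolding \<rho>_def L_def
      by (rule has_derivative_compose[OF bounded_linear_imp_has_derivative[OF E] dg[OF DV[OF a]]])
    have "\<rho> a \<in> S" using \<rho>[OF a] N by auto
    note l = lin[OF this]
    have PL: "P (L h) = h" for h
      by (rule derivative_local_unique[OF bounded_linear.has_derivative[OF P L] has_derivative_ident D(1) a])
        (use \<rho> in blast)
    have fL: "?Df (\<rho> a) (L h) = 0" for h
      by (rule derivative_locally_const[OF has_derivative_compose[OF L smooth_on_deriv[OF S(2) \<open>\<rho> a \<in> S\<close>]] D(1) a])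
        (use \<rho> in blast)
    have "L b = K b (\<rho> a)" for b
    proof -
      have pos: "?Df (\<rho> a) y0 > 0" using \<rho>[OF a] N by auto
      define s where "s = ?Df x0 (L b)"
      have Lb: "L b = E b + s *\<^sub>R y0" using split[of "L b"] PL[of b] by (simp add: s_def)
      have "?Df (\<rho> a) (E b) + s * ?Df (\<rho> a) y0 = 0"
        using fL[of b] unfolding Lb by (simp add: linear_add[OF l] linear_cmul[OF l])
      then have "s = - (?Df (\<rho> a) (E b) * (?Df (\<rho> a) y0) powr (- 1))"
        using pos by (simp add: powr_minus_divide field_simps)
      then show ?thesis unfolding Lb K_def by simp
    qed
    then show ?thesis using L by blast
  qed
  then obtain L where L: "\<And>a. a \<in> D \<Longrightarrow> (\<rho> has_derivative L a) (at a)" "\<And>a b. a \<in> D \<Longrightarrow> L a b = K b (\<rho> a)"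
    by metis
  \<comment> \<open>The partial derivatives of \<rho> are \<open>K b\<close> composed with \<rho>,
    so each order of differentiability yields the next one.\<close>
  have "Ck k D \<rho>" for k
  proof (induction k)
    case 0
    show ?case using L(1) by (auto intro!: continuous_at_imp_continuous_on has_derivative_continuous)
  next
    case (Suc k)
    have "Ck k D (\<lambda>a. K b (\<rho> a))" for b
      by (rule Ck_compose[OF D(1) N(1) _ Suc.IH]) (use \<rho> sK in \<open>auto simp: smooth_on_def\<close>)
    then have "Ck k D (\<lambda>a. L a b)" for b
      by (rule Ck_cong[OF D(1), rotated]) (simp add: L(2))
    then show ?case using Ck_Suc_iff[OF D(1) L(1)] by blast
  qed
  then have "smooth_on D \<rho>" by (simp add: smooth_on_def)
  moreover have "?Df x y0 > 0" if "x \<in> N" for x using N that by auto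
  ultimately have "surface_chart f x0 S P E y0 e D N \<rho>"
    unfolding surface_chart_def using P E y0 split e D_def N \<rho> \<rho>P by blast
  then show ?thesis by blast
qed

lemma surface_chart_derivative:
  assumes S: "open S" "smooth_on S f" and ch: "surface_chart f x0 S P E y0 e D N g" and a: "a \<in> D"
  shows "P (fder g a h) = h" "fder f (g a) (fder g a h) = 0"
    and "fder f (g a) v = 0 \<Longrightarrow> fder g a (P v) = v"
proof -
  let ?Df = "\<lambda>x. fder f x" and ?g' = "fder g a"
  have P: "bounded_linear P" and E: "bounded_linear E" and split: "\<And>w. w = E (P w) + ?Df x0 w *\<^sub>R y0"
    and oD: "open D" and N: "N \<subseteq> S" and sg: "smooth_on D g"
    and g: "\<And>a. a \<in> D \<Longrightarrow> g a \<in> N \<and> f (g a) = 0 \<and> P (g a) = a"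
    and pos: "\<And>x. x \<in> N \<Longrightarrow> ?Df x y0 > 0"
    using ch unfolding surface_chart_def by (auto simp: open_Times)
  note lP = bounded_linear.linear[OF P] and lE = bounded_linear.linear[OF E]
  have dg: "(g has_derivative ?g') (at a)" by (rule smooth_on_deriv[OF sg a])
  have gS: "g a \<in> S" using g[OF a] N by blast
  have lin: "linear (?Df (g a))"
    by (rule smooth_on_linear[OF S(2) gS])
  show Pg': "P (?g' h) = h" for h
    by (rule derivative_local_unique[OF bounded_linear.has_derivative[OF P dg] has_derivative_ident oD a])
      (use g in blast)
  show Dfg': "?Df (g a) (?g' h) = 0" for h
    by (rule derivative_locally_const[OF has_derivative_compose[OF dg smooth_on_deriv[OF S(2) gS]] oD a])
      (use g in blast)
  show "?g' (P v) = v" if v: "?Df (g a) v = 0"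
  proof -
    define w where "w = ?g' (P v) - v"
    have "P w = 0" using Pg' by (simp add: w_def linear_diff[OF lP])
    then have w: "w = ?Df x0 w *\<^sub>R y0" using split[of w] by (simp add: linear_0[OF lE])
    have "?Df (g a) w = 0"
      using Dfg' v by (simp add: w_def linear_diff[OF lin])
    moreover have "?Df (g a) w = ?Df x0 w * ?Df (g a) y0"
      by (subst w) (simp add: linear_cmul[OF lin])
    ultimately have "?Df x0 w = 0" using pos[of "g a"] g[OF a] by auto
    then have "w = 0" using w by simp
    then show ?thesis by (simp add: w_def)
  qed
qed

subsection \<open>Fibres\<close>

lemma fibre_open: "open U \<Longrightarrow> open {u. (\<xi>, u) \<in> U}"
proof -
  assume "open U"
  then have "open ((\<lambda>u. (\<xi>, u)) -` U)" by (intro open_vimage) (auto intro!: continuous_intros)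
  then show ?thesis by (simp add: vimage_def)
qed

lemma smooth_on_fibre:
  fixes F :: "jet2 \<Rightarrow> 'b::real_normed_vector"
  assumes "open U" "smooth_on U F"
  shows "smooth_on {u. (\<xi>, u) \<in> U} (\<lambda>u. F (\<xi>, u))"
  by (rule smooth_on_compose[OF fibre_open assms(1) _ _ assms(2)])
     (auto intro!: assms smooth_on_Pair smooth_on_const smooth_on_ident fibre_open)

lemma fibre_deriv:
  fixes F :: "jet2 \<Rightarrow> 'b::real_normed_vector"
  assumes "(F has_derivative F') (at (\<xi>, u))"
  shows "((\<lambda>u. F (\<xi>, u)) has_derivative (\<lambda>v. F' (0, v))) (at u)"
  by (rule has_derivative_compose[where f="\<lambda>u. (\<xi>, u)" and g=F and g'=F', OF _ assms]) (auto intro!: derivative_eq_intros)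

lemma fibre_frechet:
  fixes F :: "jet2 \<Rightarrow> real"
  assumes "smooth_on U F" "(\<xi>, u) \<in> U"
  shows "fder (\<lambda>u. F (\<xi>, u)) u = vderiv F (\<xi>, u)"
  using frechet_derivative_at[OF fibre_deriv[OF smooth_on_deriv[OF assms]]] by simp

lemma fibre_hess:
  fixes F :: "jet2 \<Rightarrow> real"
  assumes "open U" "smooth_on U F" "(\<xi>, u) \<in> U"
  shows "hess (\<lambda>u. F (\<xi>, u)) u v w = hess F (\<xi>, u) (0, v) (0, w)"
proof -
  let ?f = "\<lambda>u. F (\<xi>, u)"
  have "((\<lambda>u. fder ?f u w) has_derivative (\<lambda>v. hess F (\<xi>, u) (0, v) (0, w))) (at u)"
    by (rule has_derivative_transform_within_open[OF fibre_deriv[OF hess_deriv[OF assms]] fibre_open[OF assms(1), of \<xi>]])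
       (simp_all only: assms(3) fibre_frechet[OF assms(2)] mem_Collect_eq)
  then show ?thesis
    using frechet_derivative_at unfolding hess_def by metis
qed


subsection \<open>The quadric\<close>

text \<open>\<open>V\<close> is split as \<open>\<real> \<oplus> \<real>\<^sup>3 \<oplus> \<real>\<close>; \<open>qpt\<close> inverts the affine chart \<open>dehom\<close> of the quadric.\<close>

definition emb :: "real \<Rightarrow> real3 \<Rightarrow> real \<Rightarrow> vec" where
  "emb a v b = (a, fst v, fst (snd v), snd (snd v), b)"

definition qpt :: "real3 \<Rightarrow> vec" where
  "qpt u = emb 1 u (mink u u / 2)"

definition mid :: "vec \<Rightarrow> real3" where
  "mid w = (fst (snd w), fst (snd (snd w)), fst (snd (snd (snd w))))"

definition dehom :: "vec \<Rightarrow> real3" where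
  "dehom w = (1 / fst w) *\<^sub>R mid w"

lemma emb_simps:
  "emb a v b + emb a' v' b' = emb (a + a') (v + v') (b + b')"
  "emb a v b - emb a' v' b' = emb (a - a') (v - v') (b - b')"
  "c *\<^sub>R emb a v b = emb (c * a) (c *\<^sub>R v) (c * b)"
  "fst (emb a v b) = a" "mid (emb a v b) = v"
  "emb a v b = emb a' v' b' \<longleftrightarrow> a = a' \<and> v = v' \<and> b = b'"
  "emb a v b = 0 \<longleftrightarrow> a = 0 \<and> v = 0 \<and> b = 0"
  by (auto simp: emb_def mid_def prod_eq_iff zero_prod_def)

lemma emb_cases: obtains a v b where "w = emb a v b"
proof -
  obtain a r s t b where "w = (a, r, s, t, b)" by (cases w) auto
  then show ?thesis by (intro that[of a "(r, s, t)" b]) (simp add: emb_def)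
qed

lemma quad_emb: "quad (emb a v b) (emb a' v' b') = mink v v' - a * b' - b * a'"
  by (cases v; cases v') (auto simp: emb_def)

lemma quad_bilinear: "bounded_bilinear quad"
proof -
  have eq: "quad v w = mink (mid v) (mid w) - fst v * snd (snd (snd (snd w))) - snd (snd (snd (snd v))) * fst w" for v w
    by (cases v; cases w) (auto simp: mid_def)
  have "bilinear quad"
    unfolding bilinear_def
    by (auto intro!: linearI simp: eq mid_def mink_simps algebra_simps)
  then show ?thesis by (simp add: bilinear_conv_bounded_bilinear)
qed

lemmas quad_left = bounded_bilinear.bounded_linear_left[OF quad_bilinear]
lemmas quad_simps = bounded_bilinear.add_left[OF quad_bilinear] bounded_bilinear.add_right[OF quad_bilinear]
  bounded_bilinear.diff_left[OF quad_bilinear] bounded_bilinear.diff_right[OF quad_bilinear]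
  bounded_bilinear.scaleR_left[OF quad_bilinear] bounded_bilinear.scaleR_right[OF quad_bilinear]
  bounded_bilinear.zero_left[OF quad_bilinear] bounded_bilinear.zero_right[OF quad_bilinear]

lemma qpt_eq: "qpt (r, s, t) = (1, r, s, t, r * t - s\<^sup>2)"
  by (simp add: qpt_def emb_def power2_eq_square)

definition cone :: "(real3) set \<Rightarrow> vec set" where
  "cone C = {c *\<^sub>R qpt u | c u. c \<noteq> 0 \<and> u \<in> C}"

lemma quadric_cone_image: "quadric_cone (lagr \<xi> ` C) = cone C"
proof -
  have "quadric_cone (lagr \<xi> ` C) = (\<Union>u\<in>C. quadric_cone {lagr \<xi> u})"
    unfolding quadric_cone_def by blast
  also have "\<dots> = (\<Union>u\<in>C. {c *\<^sub>R qpt u | c. c \<noteq> 0})"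
  proof (rule SUP_cong[OF refl])
    fix u :: "real3"
    obtain r s t where u: "u = (r, s, t)" by (cases u)
    show "quadric_cone {lagr \<xi> u} = {c *\<^sub>R qpt u | c. c \<noteq> 0}"
      unfolding u qpt_eq by (rule quadric_cone_lagr)
  qed
  also have "\<dots> = cone C" unfolding cone_def by blast
  finally show ?thesis .
qed

lemma fibre_eq: "fibre \<Sigma> \<xi> = lagr \<xi> ` {u. (\<xi>, u) \<in> \<Sigma>}"
  using lagr_in_LG unfolding fibre_def by blast

lemma quadric_cone_fibre: "quadric_cone (fibre \<Sigma> \<xi>) = cone {u. (\<xi>, u) \<in> \<Sigma>}"
  unfolding fibre_eq quadric_cone_image ..

lemma dehom_qpt: "c \<noteq> 0 \<Longrightarrow> dehom (c *\<^sub>R qpt u) = u"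
  by (simp add: dehom_def qpt_def emb_simps)

lemma qpt_inj: "qpt u = c *\<^sub>R qpt u' \<longleftrightarrow> c = 1 \<and> u = u'"
  by (auto simp: qpt_def emb_simps)

lemma cone_qpt: "c \<noteq> 0 \<Longrightarrow> c *\<^sub>R qpt u \<in> cone C \<longleftrightarrow> u \<in> C"
proof -
  assume c: "c \<noteq> 0"
  have "u \<in> C" if "c' \<noteq> 0" "u' \<in> C" "c *\<^sub>R qpt u = c' *\<^sub>R qpt u'" for c' u'
    using that dehom_qpt[OF c, of u] dehom_qpt[OF that(1), of u'] by simp
  then show ?thesis unfolding cone_def using c by blast
qed

lemma cone_null:
  assumes "fst w \<noteq> 0" "quad w w = 0" shows "w = fst w *\<^sub>R qpt (dehom w)"
proof -
  obtain a v b where w: "w = emb a v b" by (rule emb_cases)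
  show ?thesis
    using assms unfolding w by (simp add: quad_emb dehom_def qpt_def emb_simps mink_simps)
qed

lemma open_dehom:
  assumes "open N" shows "open {w. fst w \<noteq> 0 \<and> dehom w \<in> N}"
proof -
  have "open {w :: vec. fst w \<noteq> 0}"
    by (intro open_Collect_neq continuous_intros)
  moreover have "continuous_on {w :: vec. fst w \<noteq> 0} dehom"
    unfolding dehom_def mid_def by (intro continuous_intros) auto
  ultimately have "open (dehom -` N \<inter> {w. fst w \<noteq> 0})"
    using assms continuous_on_open_vimage by blast
  then show ?thesis by (simp add: vimage_def Int_def conj_commute)
qed

lemma qpt_has_derivative:
  assumes "(g has_derivative g') (at x)"
  shows "((\<lambda>x. qpt (g x)) has_derivative (\<lambda>h. emb 0 (g' h) (mink (g x) (g' h)))) (at x)"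
proof -
  have "((\<lambda>x. mink (g x) (g x) / 2) has_derivative (\<lambda>h. mink (g x) (g' h))) (at x)"
    by (rule has_derivative_eq_rhs[OF bounded_linear.has_derivative[OF bounded_linear_divide[of 2]
          mink_FDERIV[OF assms assms]]])
       (use mink_sym in \<open>auto simp: fun_eq_iff\<close>)
  then show ?thesis
    unfolding qpt_def emb_def using assms
    by (intro has_derivative_Pair has_derivative_const has_derivative_fst has_derivative_snd)
qed

lemma smooth_on_emb:
  assumes "open S" "smooth_on S a" "smooth_on S v" "smooth_on S b"
  shows "smooth_on S (\<lambda>x. emb (a x) (v x) (b x))"
  unfolding emb_def by (intro smooth_on_Pair smooth_on_fst smooth_on_snd assms)

lemma smooth_on_mink:
  assumes "open S" "smooth_on S v" "smooth_on S w" shows "smooth_on S (\<lambda>x. mink (v x) (w x))"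
  by (rule smooth_on_bounded_bilinear[OF mink_bilinear assms])

lemma smooth_on_qpt:
  assumes "open S" "smooth_on S v" shows "smooth_on S (\<lambda>x. qpt (v x))"
proof -
  have "smooth_on S (\<lambda>x. emb 1 (v x) (1 / 2 * mink (v x) (v x)))"
    by (intro smooth_on_emb smooth_on_const smooth_on_mult smooth_on_mink assms)
  then show ?thesis by (simp add: qpt_def)
qed

lemma smooth_on_mid:
  assumes "open S" "smooth_on S v" shows "smooth_on S (\<lambda>x. mid (v x))"
  unfolding mid_def by (intro smooth_on_Pair smooth_on_fst smooth_on_snd assms)

text \<open>A second-order chain rule in which both the base point and the tangent vector depend on
  \<open>y\<close>. Expanding the vector in the basis reduces it to Hessians with constant second
  argument.\<close>

lemma has_derivative_frechet_apply:
  fixes g :: "'a::euclidean_space \<Rightarrow> 'b::euclidean_space" and f :: "'b \<Rightarrow> 'c::real_normed_vector"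
  assumes S: "open S" "x \<in> S" "\<And>y. y \<in> S \<Longrightarrow> g y \<in> T" and f: "open T" "smooth_on T f"
    and g: "(g has_derivative g') (at x)" and w: "(w has_derivative w') (at x)"
  shows "((\<lambda>y. fder f (g y) (w y)) has_derivative
     (\<lambda>h. hess f (g x) (g' h) (w x) + fder f (g x) (w' h))) (at x)"
proof -
  let ?Df = "\<lambda>y. fder f y"
  have lin: "linear (?Df y)" if "y \<in> T" for y
    by (rule smooth_on_linear[OF f(2) that])
  have gx: "g x \<in> T" using S by blast
  have "((\<lambda>y. \<Sum>i\<in>Basis. (w y \<bullet> i) *\<^sub>R ?Df (g y) i) has_derivative
      (\<lambda>h. \<Sum>i\<in>Basis. (w x \<bullet> i) *\<^sub>R hess f (g x) (g' h) i + (w' h \<bullet> i) *\<^sub>R ?Df (g x) i)) (at x)"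
    by (intro has_derivative_sum has_derivative_scaleR has_derivative_inner_left w
         has_derivative_compose[OF g hess_deriv[OF f gx]])
  moreover have "(\<Sum>i\<in>Basis. (w x \<bullet> i) *\<^sub>R hess f (g x) (g' h) i + (w' h \<bullet> i) *\<^sub>R ?Df (g x) i)
     = hess f (g x) (g' h) (w x) + ?Df (g x) (w' h)" for h
    unfolding sum.distrib derivative_basis_sum[OF hess_linear2[OF f gx], symmetric]
      derivative_basis_sum[OF lin[OF gx], symmetric] ..
  ultimately have "((\<lambda>y. \<Sum>i\<in>Basis. (w y \<bullet> i) *\<^sub>R ?Df (g y) i) has_derivative
      (\<lambda>h. hess f (g x) (g' h) (w x) + ?Df (g x) (w' h))) (at x)"
    by (simp only:)
  then show ?thesis
    by (rule has_derivative_transform_within_open[OF _ S(1,2)])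
       (use derivative_basis_sum[OF lin[OF S(3)], symmetric] in simp)
qed

lemma quad_qpt: "quad (qpt u) (qpt u) = 0"
  by (simp add: qpt_def quad_emb)

text \<open>The vectors tested here span the orthogonal space of \<open>qpt u\<close>, so
  \<open>n\<close> is a multiple of \<open>qpt u\<close>. A vector of nonzero square therefore
  cannot be normal to all tangent directions of the quadric, which makes normals of surfaces and
  sphere equations nondegenerate.\<close>

lemma quad_normal_null:
  assumes "quad n (qpt u) = 0" "\<And>h. quad n (emb 0 h (mink u h)) = 0"
  shows "quad n n = 0"
proof -
  obtain b k d where n: "n = emb b k d" by (rule emb_cases)
  have "mink (k - b *\<^sub>R u) w = 0" for w
    using assms(2)[of w] by (simp add: n quad_emb mink_simps)
  then have "k - b *\<^sub>R u = 0"
    by (intro mink_zero[of "(1, 0, 0)" "(0, 0, 1)" "(0, 1, 0)"]) auto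
  then have k: "k = b *\<^sub>R u" by simp
  have "d = b * (mink u u / 2)" using assms(1) by (simp add: n qpt_def quad_emb k mink_simps)
  then have "n = b *\<^sub>R qpt u" by (simp add: n k qpt_def emb_simps)
  then show ?thesis by (simp add: quad_simps quad_qpt)
qed

subsection \<open>Moving frames\<close>

lemma null_pair_proportional:
  assumes "null_pair l v1 v2" "linear l" "l u \<noteq> 0" "linear m" "m v1 = 0" "m v2 = 0"
  shows "\<exists>\<kappa>. \<forall>w. m w = \<kappa> * l w"
proof (intro exI allI)
  fix w
  let ?w = "w - (l w / l u) *\<^sub>R u"
  have "l ?w = 0" using assms(2,3) by (simp add: linear_diff linear_cmul)
  from null_pair_kernel[OF assms(1-3) this] obtain x y where "?w = x *\<^sub>R v1 + y *\<^sub>R v2" by blast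
  then have "m ?w = 0" using assms(4-6) by (simp add: linear_add linear_cmul)
  then show "m w = (m u / l u) * l w" using assms(3,4) by (simp add: linear_diff linear_cmul)
qed

text \<open>Write the lift as a multiple of \<open>qpt \<circ> g\<close>.  The second derivative of \<open>qpt\<close> along a null vector
  vanishes, so \<open>\<ell>\<^sub>i\<close> only sees the acceleration of \<open>g\<close>, which \<open>f \<circ> g = 0\<close> expresses by the Hessian of \<open>f\<close>.\<close>

lemma moving_frame_ell:
  assumes S: "open S" "smooth_on S f" and Z: "Z = {u \<in> S. f u = 0}"
    and nz: "\<And>u. u \<in> Z \<Longrightarrow> \<exists>w. fder f u w \<noteq> 0"
    and fr: "moving_frame (cone Z) D X N1 N2 n" and a: "a \<in> D"
  obtains p \<kappa> c v1 v2 where "p \<in> Z" "c \<noteq> 0" "X a = c *\<^sub>R qpt p" "\<kappa> \<noteq> 0" "null_pair (fder f p) v1 v2"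
    "ell X N1 n a = \<kappa> * hess f p v1 v1" "ell X N2 n a = \<kappa> * hess f p v2 v2"
proof -
  let ?Df = "\<lambda>u. fder f u"
  have D: "open D" and X: "smooth_on D X" and sN: "smooth_on D N1" "smooth_on D N2"
    and op: "openin (top_of_set (cone Z)) {c *\<^sub>R X u | c u. c \<noteq> 0 \<and> u \<in> D}"
    using fr by (auto simp: moving_frame_def)
  have X': "X u \<in> cone Z" if "u \<in> D" for u
  proof -
    have "1 *\<^sub>R X u \<in> {c *\<^sub>R X u | c u. c \<noteq> 0 \<and> u \<in> D}"
      using that by (intro CollectI exI[of _ 1] exI[of _ u]) simp
    then show ?thesis using openin_imp_subset[OF op] by auto
  qed
  define x0 where "x0 u = fst (X u)" for u
  define g where "g u = dehom (X u)" for u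
  have X0: "x0 u \<noteq> 0" "X u = x0 u *\<^sub>R qpt (g u)" "g u \<in> Z" if uD: "u \<in> D" for u
  proof -
    obtain c z where c: "X u = c *\<^sub>R qpt z" "c \<noteq> 0" "z \<in> Z" using X'[OF uD] by (auto simp: cone_def)
    then have "x0 u = c" "g u = z" using dehom_qpt by (auto simp: x0_def g_def qpt_def emb_simps)
    then show "x0 u \<noteq> 0" "X u = x0 u *\<^sub>R qpt (g u)" "g u \<in> Z" using c by auto
  qed
  have sx0: "smooth_on D x0" unfolding x0_def by (intro smooth_on_fst D X)
  \<comment> \<open>The reciprocal of \<open>x0\<close> is written as \<open>x0\<close> times the
    power -1 of its square, because \<open>x0\<close> may be negative while \<open>powr\<close> is
    smooth on positive reals.\<close>
  have "smooth_on D (\<lambda>u. ((x0 u * x0 u) powr (- 1) * x0 u) *\<^sub>R mid (X u))"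
    using X0(1) by (intro smooth_on_scaleR smooth_on_mult smooth_on_powr smooth_on_mid D X sx0)
      (simp add: zero_less_mult_iff, metis linorder_neqE)
  then have sg: "smooth_on D g"
  proof (rule smooth_on_cong[OF D])
    fix u assume "u \<in> D"
    then show "((x0 u * x0 u) powr (- 1) * x0 u) *\<^sub>R mid (X u) = g u"
      using X0(1)[of u] by (simp add: g_def dehom_def x0_def powr_minus_divide)
  qed
  define x0' where "x0' u = fder x0 u" for u
  define g' where "g' u = fder g u" for u
  have dx0: "(x0 has_derivative x0' u) (at u)" and dg: "(g has_derivative g' u) (at u)" if "u \<in> D" for u
    unfolding x0'_def g'_def using that by (auto intro: smooth_on_deriv sx0 sg)
  have lg: "linear (g' u)" if "u \<in> D" for u using dg[OF that] has_derivative_linear by blast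
  define T where "T u h = emb 0 h (mink u h)" for u h
  define dX where "dX u = fder X u" for u
  have dX: "dX u h = x0 u *\<^sub>R T (g u) (g' u h) + x0' u h *\<^sub>R qpt (g u)" if "u \<in> D" for u h
  proof -
    have "((\<lambda>u. x0 u *\<^sub>R qpt (g u)) has_derivative (\<lambda>h. x0 u *\<^sub>R T (g u) (g' u h) + x0' u h *\<^sub>R qpt (g u))) (at u)"
      unfolding T_def by (intro has_derivative_scaleR dx0 qpt_has_derivative dg that)
    then have "(X has_derivative (\<lambda>h. x0 u *\<^sub>R T (g u) (g' u h) + x0' u h *\<^sub>R qpt (g u))) (at u)"
      by (rule has_derivative_transform_within_open[OF _ D that]) (simp add: X0)
    then show ?thesis unfolding dX_def by (rule fder_eq)
  qed
  have q0: "quad (qpt u) (qpt u) = 0" "quad (qpt u) (T u h) = 0" "quad (T u h) (T u h') = mink h h'" for u h h'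
    by (auto simp: qpt_def T_def quad_emb mink_sym)
  have quad_sym: "quad v w = quad w v" for v w
    by (cases rule: emb_cases[of v]; cases rule: emb_cases[of w]) (simp add: quad_emb mink_sym)
  have qdX: "quad (dX u h) (dX u h) = (x0 u)\<^sup>2 * mink (g' u h) (g' u h)" if "u \<in> D" for u h
    unfolding dX[OF that] by (simp add: quad_simps q0 quad_sym[of "T _ _" "qpt _"] power2_eq_square)
  define p where "p = g a"
  have fra: "\<And>c h. c *\<^sub>R X a + dX a h = 0 \<Longrightarrow> h = 0" "independent {N1 a, N2 a}" "N1 a \<noteq> N2 a"
    "{h. quad (dX a h) (dX a h) = 0} = span {N1 a} \<union> span {N2 a}" "quad (n a) (n a) = - 2"
    "quad (n a) (X a) = 0" "\<And>h. quad (n a) (dX a h) = 0"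
    using fr a by (auto simp: moving_frame_def Let_def dX_def)
  have nq: "quad (n a) (qpt p) = 0" using fra(6) X0(1)[OF a] X0(2)[OF a] by (simp add: quad_simps p_def)
  \<comment> \<open>The pairing of the normal with tangent vectors of the quadric. It vanishes on
    the tangent plane of the surface and is thus a multiple \<kappa> of the differential of
    \<open>f\<close>; this \<kappa> is the factor shared by both null directions.\<close>
  define m where "m h = quad (n a) (T p h)" for h
  have T_lin: "linear (T u)" for u
    by (rule linearI) (simp_all add: T_def emb_simps mink_simps)
  have lm: "linear m"
    unfolding m_def by (rule linearI) (simp_all add: linear_add[OF T_lin] linear_cmul[OF T_lin] quad_simps)
  have mg: "m (g' a h) = 0" for h
    using fra(7)[of h] nq X0(1)[OF a] unfolding dX[OF a] by (simp add: quad_simps m_def p_def)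
  have null_iff: "mink (g' a h) (g' a h) = 0 \<longleftrightarrow> h \<in> span {N1 a} \<union> span {N2 a}" for h
  proof -
    have "h \<in> span {N1 a} \<union> span {N2 a} \<longleftrightarrow> quad (dX a h) (dX a h) = 0"
      unfolding fra(4)[symmetric] by simp
    then show ?thesis unfolding qdX[OF a] using X0(1)[OF a] by simp
  qed
  define v1 v2 where v: "v1 = g' a (N1 a)" "v2 = g' a (N2 a)"
  have pZ: "p \<in> Z" using X0 a by (simp add: p_def)
  then have pS: "p \<in> S" using Z by simp
  have fg: "?Df (g u) (g' u h) = 0" if "u \<in> D" for u h
  proof -
    have uS: "g u \<in> S" using X0(3)[OF that] Z by simp
    show ?thesis
      by (rule derivative_locally_const[OF has_derivative_compose[OF dg[OF that] smooth_on_deriv[OF S(2) uS]] D that])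
        (use X0(3) Z in blast)
  qed
  have np: "null_pair (?Df p) v1 v2"
  proof -
    have 1: "mink v1 v1 = 0" "mink v2 v2 = 0"
      unfolding v null_iff by (auto intro: span_base)
    have "mink v1 v2 \<noteq> 0"
    proof
      \<comment> \<open>Then the sum of the two null fields would be null as well, although it lies
        on neither of the two null lines.\<close>
      assume "mink v1 v2 = 0"
      then have "mink (g' a (N1 a + N2 a)) (g' a (N1 a + N2 a)) = 0"
        using 1 by (simp add: linear_add[OF lg[OF a]] v[symmetric] mink_simps mink_sym[of v2 v1])
      then have "N1 a + N2 a \<in> span {N1 a} \<union> span {N2 a}" using null_iff by blast
      then have "N2 a \<in> span {N1 a} \<or> N1 a \<in> span {N2 a}"
        by (metis Un_iff add_diff_cancel_left' add_diff_cancel_right' insertI1 span_base span_diff)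
      moreover have "N2 a \<notin> span {N1 a}" "N1 a \<notin> span {N2 a}"
        using fra(2,3) by (auto simp: independent_insert insert_commute)
          (metis fra(2) fra(3) independent_insert insert_commute singletonD)+
      ultimately show False by blast
    qed
    then show ?thesis using 1 fg[OF a] by (auto simp: null_pair_def v p_def)
  qed
  have lf: "linear (?Df p)" by (rule smooth_on_linear[OF S(2) pS])
  obtain u0 where u0: "?Df p u0 \<noteq> 0" using nz[OF pZ] by blast
  obtain \<kappa> where \<kappa>: "\<And>w. m w = \<kappa> * ?Df p w"
    using null_pair_proportional[OF np lf u0 lm] mg v by metis
  have \<kappa>0: "\<kappa> \<noteq> 0"
  proof
    assume "\<kappa> = 0"
    then have m0: "m w = 0" for w by (simp add: \<kappa>)
    have "quad (n a) (n a) = 0"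
      by (rule quad_normal_null[of _ p]) (use nq m0 in \<open>auto simp: m_def T_def\<close>)
    then show False using fra(5) by simp
  qed
  have key: "ell X N n a = - (x0 a * \<kappa>) * hess f p (g' a (N a)) (g' a (N a))"
    if sN: "smooth_on D N" and nN: "mink (g' a (N a)) (g' a (N a)) = 0" for N
  proof -
    define A B where AB: "A u = x0' u (N u)" "B u = g' u (N u)" for u
    have "(N has_derivative fder N a) (at a)"
      by (rule smooth_on_deriv[OF sN a])
    note dA = has_derivative_frechet_apply[OF D a _ D sx0 has_derivative_ident this, folded x0'_def]
      and dB = has_derivative_frechet_apply[OF D a _ D sg has_derivative_ident this, folded g'_def]
    obtain A' where A': "(A has_derivative A') (at a)" using dA unfolding AB by blast
    obtain B' where B': "(B has_derivative B') (at a)" using dB unfolding AB by blast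
    have aX: "along N X u = x0 u *\<^sub>R T (g u) (B u) + A u *\<^sub>R qpt (g u)" if "u \<in> D" for u
      unfolding along_def AB using dX[OF that, unfolded dX_def] .
    have "((\<lambda>u. x0 u *\<^sub>R T (g u) (B u) + A u *\<^sub>R qpt (g u)) has_derivative
        (\<lambda>h. (x0 a *\<^sub>R emb 0 (B' h) (mink (g a) (B' h) + mink (g' a h) (B a)) + x0' a h *\<^sub>R T (g a) (B a))
          + (A a *\<^sub>R T (g a) (g' a h) + A' h *\<^sub>R qpt (g a)))) (at a)"
      unfolding T_def
      by (intro has_derivative_add has_derivative_scaleR dx0 a A' qpt_has_derivative dg)
         (unfold emb_def, intro has_derivative_Pair has_derivative_const has_derivative_fst has_derivative_snd B'
           mink_FDERIV[OF dg[OF a] B'])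
    then have "(along N X has_derivative
        (\<lambda>h. (x0 a *\<^sub>R emb 0 (B' h) (mink (g a) (B' h) + mink (g' a h) (B a)) + x0' a h *\<^sub>R T (g a) (B a))
          + (A a *\<^sub>R T (g a) (g' a h) + A' h *\<^sub>R qpt (g a)))) (at a)"
      by (rule has_derivative_transform_within_open[OF _ D a]) (simp add: aX)
    from fder_eq[OF this, of "N a"]
    have "along N (along N X) a = (x0 a *\<^sub>R emb 0 (B' (N a)) (mink p (B' (N a)) + mink (B a) (B a)) + A a *\<^sub>R T p (B a))
          + (A a *\<^sub>R T p (B a) + A' (N a) *\<^sub>R qpt p)"
      unfolding along_def[of N "along N X"] by (simp add: AB p_def)
    \<comment> \<open>Nullity of \<open>B a\<close> turns the first summand into a tangent vector of
      the quadric. Pairing with \<open>n a\<close> then kills \<open>qpt p\<close> and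
      \<open>T p (B a)\<close>, leaving only the acceleration \<open>B' (N a)\<close>.\<close>
    also have "\<dots> = x0 a *\<^sub>R T p (B' (N a)) + (2 * A a) *\<^sub>R T p (B a) + A' (N a) *\<^sub>R qpt p"
      using nN by (simp add: T_def AB emb_simps flip: scaleR_left_distrib)
    finally have "ell X N n a = x0 a * m (B' (N a))"
      using nq mg by (simp add: ell_def quad_simps quad_sym[of _ "n a"] m_def[symmetric] AB)
    \<comment> \<open>Derivative along \<open>N\<close> of the tangency relation
      \<open>?Df (g u) (B u) = 0\<close>; it trades the normal part of the acceleration for the
      Hessian.\<close>
    moreover have "hess f p (B a) (B a) + ?Df p (B' (N a)) = 0"
    proof -
      have "((\<lambda>u. ?Df (g u) (B u)) has_derivative (\<lambda>h. hess f (g a) (g' a h) (B a) + ?Df (g a) (B' h))) (at a)"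
        by (rule has_derivative_frechet_apply[OF D a _ S dg[OF a] B']) (use X0(3) Z in auto)
      from derivative_locally_const[OF this D a, of 0 "N a"] show ?thesis by (simp add: p_def AB fg)
    qed
    ultimately show ?thesis unfolding \<kappa> AB by (simp add: eq_neg_iff_add_eq_0[symmetric])
  qed
  show ?thesis
  proof (rule that[OF pZ X0(1)[OF a] X0(2)[OF a, folded p_def] _ np])
    show "- (x0 a * \<kappa>) \<noteq> 0" using X0(1)[OF a] \<kappa>0 by simp
    show "ell X N1 n a = - (x0 a * \<kappa>) * hess f p v1 v1" "ell X N2 n a = - (x0 a * \<kappa>) * hess f p v2 v2"
      using key[OF sN(1)] key[OF sN(2)] np by (auto simp: v null_pair_def)
  qed
qed


section \<open>Existence of moving frames\<close>

lemma discr_vderiv_nonzero: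
  assumes "discr F m < 0" shows "\<exists>u. vderiv F m u \<noteq> 0"
proof (rule ccontr)
  assume "\<not> ?thesis"
  then have "discr F m = 0" by (simp add: discr_def along_def)
  then show False using assms by simp
qed

lemma smooth_on_null12:
  assumes "open U" "smooth_on U F"
  shows "smooth_on (lambda_domain U F) (null1 F)" "smooth_on (lambda_domain U F) (null2 F)"
proof -
  have d: "smooth_on (lambda_domain U F) (d_t F)" "smooth_on (lambda_domain U F) (d_r F)"
    by (rule smooth_on_subset[OF smooth_on_d(3)[OF assms]] smooth_on_subset[OF smooth_on_d(1)[OF assms]],
        force simp: lambda_domain_def)+
  show "smooth_on (lambda_domain U F) (null1 F)"
    unfolding null1_def[abs_def] power2_eq_square
    by (intro smooth_on_Pair smooth_on_mult smooth_on_minus lambda_domain assms d)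
  show "smooth_on (lambda_domain U F) (null2 F)"
    unfolding null2_def[abs_def] power2_eq_square
    by (intro smooth_on_Pair smooth_on_mult smooth_on_minus lambda_domain assms d)
qed

lemma independent_pairI:
  fixes a b :: "'a::real_vector"
  assumes "\<And>c. a \<noteq> c *\<^sub>R b" "b \<noteq> 0"
  shows "independent {a, b}" "a \<noteq> b"
proof -
  have "a \<notin> span {b}" using assms by (auto simp: span_singleton)
  then show "independent {a, b}" using assms(2) by (auto simp: independent_insert)
  show "a \<noteq> b" using assms(1)[of 1] by simp
qed

text \<open>The frame lives on a graph chart of the fibre: \<open>null1\<close> and
  \<open>null2\<close>, projected by \<open>P\<close>, give smooth null fields, and the vector dual
  to the vertical differential of \<open>G\<close> gives the normal. The lemma is meant for the
  oriented defining function, for which \<open>lambda_plus\<close> is positive at the given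
  point.\<close>

lemma moving_frame_exists:
  assumes U: "open U" "smooth_on U G" and m: "(\<xi>, p) \<in> U" "G (\<xi>, p) = 0" "discr G (\<xi>, p) < 0" "lambda_plus G (\<xi>, p) > 0"
  shows "\<exists>D X N1 N2 n a. moving_frame (cone {u. (\<xi>, u) \<in> U \<and> G (\<xi>, u) = 0}) D X N1 N2 n \<and> a \<in> D \<and> X a = qpt p"
proof -
  let ?V = "lambda_domain U G" and ?f = "\<lambda>u. G (\<xi>, u)"
  let ?Df = "\<lambda>u. fder ?f u"
  define S where "S = {u. (\<xi>, u) \<in> ?V}"
  define Z where "Z = {u. (\<xi>, u) \<in> U \<and> G (\<xi>, u) = 0}"
  note V = lambda_domain[OF U]
  have GV: "smooth_on ?V G" by (rule smooth_on_subset[OF U(2)]) (auto simp: lambda_domain_def)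
  have S: "open S" "smooth_on S ?f" unfolding S_def
    by (rule fibre_open[OF V(1)], rule smooth_on_fibre[OF V(1) GV])
  have SV: "(\<xi>, u) \<in> ?V" "(\<xi>, u) \<in> U" "discr G (\<xi>, u) < 0" "lambda_plus G (\<xi>, u) > 0" if "u \<in> S" for u
    using that by (auto simp: S_def lambda_domain_def)
  have pS: "p \<in> S" using m by (simp add: S_def lambda_domain_def)
  have Df: "?Df u = vderiv G (\<xi>, u)" if "u \<in> S" for u
    by (rule fibre_frechet[OF U(2) SV(2)[OF that]])
  have lin: "linear (?Df u)" if "u \<in> S" for u
    by (rule smooth_on_linear[OF S(2) that])
  obtain w0 where w0: "?Df p w0 \<noteq> 0" using discr_vderiv_nonzero[OF m(3)] Df[OF pS] by auto
  obtain P E y0 e D N g where ch: "surface_chart ?f p S P E y0 e D N g"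
    using local_param[OF S pS m(2) w0] by blast
  then have P: "bounded_linear P" and oD: "open D" and N: "open N" "p \<in> N" "N \<subseteq> S" and sg: "smooth_on D g"
    and g: "\<And>a. a \<in> D \<Longrightarrow> g a \<in> N \<and> ?f (g a) = 0 \<and> P (g a) = a"
    and gP: "\<And>x. x \<in> N \<Longrightarrow> ?f x = 0 \<Longrightarrow> P x \<in> D \<and> g (P x) = x"
    unfolding surface_chart_def by (auto simp: open_Times)
  have gS: "g a \<in> S" if "a \<in> D" for a using g[OF that] N by blast
  define g' where "g' a = fder g a" for a
  have dg: "(g has_derivative g' a) (at a)" if "a \<in> D" for a
    unfolding g'_def by (rule smooth_on_deriv[OF sg that])
  have lg: "linear (g' a)" if "a \<in> D" for a using dg[OF that] has_derivative_linear by blast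
  note lP = bounded_linear.linear[OF P]
  note Pg' = surface_chart_derivative(1)[OF S ch, folded g'_def]
    and Dfg' = surface_chart_derivative(2)[OF S ch, folded g'_def]
    and g'P = surface_chart_derivative(3)[OF S ch, folded g'_def]
  define v1 v2 where v: "v1 a = null1 G (\<xi>, g a)" "v2 a = null2 G (\<xi>, g a)" for a
  define k where "k a = mink_dual (vderiv G (\<xi>, g a))" for a
  \<comment> \<open>By \<open>discr_mink_dual\<close> the square of \<open>k a\<close> is twice the
    discriminant, so this factor normalises the normal to square -2.\<close>
  define \<mu> where "\<mu> a = (- discr G (\<xi>, g a)) powr (- 1 / 2)" for a
  define X where "X a = qpt (g a)" for a
  define N1 N2 where N12: "N1 a = P (v1 a)" "N2 a = P (v2 a)" for a
  \<comment> \<open>The differential of \<open>qpt\<close> at \<open>g a\<close> applied to the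
    normal vector in the affine chart. This differential preserves inner products and its image is
    orthogonal to \<open>qpt (g a)\<close>.\<close>
  define n where "n a = emb 0 (\<mu> a *\<^sub>R k a) (\<mu> a * mink (k a) (g a))" for a
  have np: "null_pair (?Df (g a)) (v1 a) (v2 a)" if a: "a \<in> D" for a
    unfolding v Df[OF gS[OF a]]
    by (rule null_pair_null12) (use SV[OF gS[OF a]] smooth_on_differentiable[OF U(2)] in auto)
  have gN: "g' a (N1 a) = v1 a" "g' a (N2 a) = v2 a" if a: "a \<in> D" for a
    using np[OF a] g'P[OF a] by (auto simp: N12 null_pair_def)
  have gD: "g ` D \<subseteq> S" using gS by blast
  have comp: "smooth_on D (\<lambda>a. h (\<xi>, g a))" if "smooth_on ?V h" for h :: "jet2 \<Rightarrow> 'z::real_normed_vector"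
    using smooth_on_compose[OF oD S(1) gD sg, of "\<lambda>u. h (\<xi>, u)"] smooth_on_fibre[OF V(1) that] by (simp add: S_def)
  have smN: "smooth_on D N1" "smooth_on D N2"
    unfolding N12 v
    by (rule smooth_on_bounded_linear[OF P oD comp[OF smooth_on_null12(1)[OF U]]],
        rule smooth_on_bounded_linear[OF P oD comp[OF smooth_on_null12(2)[OF U]]])
  have smX: "smooth_on D X" unfolding X_def by (intro smooth_on_qpt oD sg)
  have smd: "smooth_on ?V (\<lambda>m. fder G m w)" for w
    by (rule smooth_on_frechet[OF V(1) GV])
  have smk: "smooth_on D k"
    unfolding k_def mink_dual_def divide_inverse
    by (intro smooth_on_Pair smooth_on_minus smooth_on_mult smooth_on_const oD comp[OF smd])
  have sm\<mu>: "smooth_on D \<mu>"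
  proof -
    have "smooth_on D (\<lambda>a. - discr G (\<xi>, g a))"
      by (rule smooth_on_minus[OF oD comp[OF smooth_on_discr[OF V(1) GV]]])
    then show ?thesis unfolding \<mu>_def
      by (rule smooth_on_powr[OF oD]) (use SV gS in auto)
  qed
  have smn: "smooth_on D n"
    unfolding n_def by (intro smooth_on_emb smooth_on_const smooth_on_scaleR smooth_on_mult smooth_on_mink oD smk sm\<mu> sg)
  have dX: "fder X a h = emb 0 (g' a h) (mink (g a) (g' a h))" if a: "a \<in> D" for a h
    unfolding X_def by (rule fder_eq[OF qpt_has_derivative[OF dg[OF a]]])
  have op: "openin (top_of_set (cone Z)) {c *\<^sub>R X u | c u. c \<noteq> 0 \<and> u \<in> D}"
  proof -
    have "{c *\<^sub>R X u | c u. c \<noteq> 0 \<and> u \<in> D} = cone Z \<inter> {w. fst w \<noteq> 0 \<and> dehom w \<in> N}"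
    proof (intro set_eqI iffI)
      fix w assume "w \<in> {c *\<^sub>R X u | c u. c \<noteq> 0 \<and> u \<in> D}"
      then obtain c u where cu: "w = c *\<^sub>R qpt (g u)" "c \<noteq> 0" "u \<in> D" by (auto simp: X_def)
      have "g u \<in> Z" using g[OF cu(3)] SV(2)[OF gS[OF cu(3)]] by (simp add: Z_def)
      moreover have "fst w = c" unfolding cu by (simp add: qpt_def emb_simps)
      ultimately show "w \<in> cone Z \<inter> {w. fst w \<noteq> 0 \<and> dehom w \<in> N}"
        using cu g[OF cu(3)] by (simp add: cone_qpt dehom_qpt)
    next
      fix w assume w: "w \<in> cone Z \<inter> {w. fst w \<noteq> 0 \<and> dehom w \<in> N}"
      then obtain c z where cz: "w = c *\<^sub>R qpt z" "c \<noteq> 0" "z \<in> Z" by (auto simp: cone_def)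
      then have "z \<in> N" using w dehom_qpt by auto
      then have "P z \<in> D" "g (P z) = z" using gP[of z] cz by (auto simp: Z_def)
      then show "w \<in> {c *\<^sub>R X u | c u. c \<noteq> 0 \<and> u \<in> D}" using cz by (metis (mono_tags, lifting) X_def mem_Collect_eq)
    qed
    then show ?thesis using openin_open_Int[OF open_dehom[OF N(1)]] by simp
  qed
  have inj: "u' = u" if "u \<in> D" "u' \<in> D" "X u' = c *\<^sub>R X u" for u u' c
    using that g by (metis X_def qpt_inj)
  have imm: "a' = 0 \<and> h = 0" if a: "a \<in> D" and eq: "a' *\<^sub>R X a + fder X a h = 0" for a a' h
  proof -
    have "a' = 0" "g' a h = 0" using eq unfolding dX[OF a] by (auto simp: X_def qpt_def emb_simps)
    then show ?thesis using Pg'[OF a, of h] by (simp add: linear_0[OF lP])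
  qed
  have ind: "independent {N1 a, N2 a}" "N1 a \<noteq> N2 a" if a: "a \<in> D" for a
  proof -
    have n1: "N1 a \<noteq> c *\<^sub>R N2 a" for c
    proof
      assume "N1 a = c *\<^sub>R N2 a"
      then have "v1 a = c *\<^sub>R v2 a" using gN[OF a] by (metis lg[OF a] linear_cmul)
      then show False using np[OF a] by (auto simp: null_pair_def mink_simps)
    qed
    have n2: "N2 a \<noteq> 0"
    proof
      assume "N2 a = 0"
      then have "v2 a = 0" using gN(2)[OF a] linear_0[OF lg[OF a]] by simp
      then show False using np[OF a] by (simp add: null_pair_def mink_simps)
    qed
    show "independent {N1 a, N2 a}" "N1 a \<noteq> N2 a" by (rule independent_pairI[OF n1 n2])+
  qed
  have nul: "{h. quad (fder X a h) (fder X a h) = 0} = span {N1 a} \<union> span {N2 a}"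
    if a: "a \<in> D" for a
  proof -
    obtain w1 where w1: "?Df (g a) w1 \<noteq> 0" using discr_vderiv_nonzero[OF SV(3)[OF gS[OF a]]] Df[OF gS[OF a]] by auto
    have "mink (g' a h) (g' a h) = 0 \<longleftrightarrow> h \<in> span {N1 a} \<union> span {N2 a}" for h
    proof
      assume "mink (g' a h) (g' a h) = 0"
      then obtain c where "g' a h = c *\<^sub>R v1 a \<or> g' a h = c *\<^sub>R v2 a"
        using null_pair_null[OF np[OF a] lin[OF gS[OF a]] w1 Dfg'[OF a]] by blast
      then have "h = c *\<^sub>R N1 a \<or> h = c *\<^sub>R N2 a"
      proof (elim disj_forward)
        assume "g' a h = c *\<^sub>R v1 a"
        then show "h = c *\<^sub>R N1 a" using Pg'[OF a, of h] by (simp only: N12 linear_cmul[OF lP])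
      next
        assume "g' a h = c *\<^sub>R v2 a"
        then show "h = c *\<^sub>R N2 a" using Pg'[OF a, of h] by (simp only: N12 linear_cmul[OF lP])
      qed
      then show "h \<in> span {N1 a} \<union> span {N2 a}" by (auto simp: span_singleton)
    next
      assume "h \<in> span {N1 a} \<union> span {N2 a}"
      then obtain c where "h = c *\<^sub>R N1 a \<or> h = c *\<^sub>R N2 a" by (auto simp: span_singleton)
      then have "g' a h = c *\<^sub>R v1 a \<or> g' a h = c *\<^sub>R v2 a"
        by (elim disj_forward) (simp_all only: linear_cmul[OF lg[OF a]] gN[OF a])
      then show "mink (g' a h) (g' a h) = 0" using np[OF a] by (auto simp: null_pair_def mink_simps)
    qed
    then show ?thesis unfolding dX[OF a] quad_emb by (simp add: Un_def)
  qed
  have nn: "quad (n a) (n a) = - 2" if a: "a \<in> D" for a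
  proof -
    define q where "q = - discr G (\<xi>, g a)"
    have q: "q > 0" using SV(3)[OF gS[OF a]] by (simp add: q_def)
    have "quad (n a) (n a) = \<mu> a * \<mu> a * mink (k a) (k a)"
      by (simp add: n_def quad_emb mink_simps)
    also have "mink (k a) (k a) = - 2 * q" unfolding k_def discr_mink_dual q_def by simp
    also have "\<mu> a * \<mu> a = q powr (- 1)"
      unfolding \<mu>_def q_def[symmetric] by (simp flip: powr_add)
    finally show ?thesis using q by (simp add: powr_minus_divide)
  qed
  have nX: "quad (n a) (X a) = 0" for a
    by (simp add: n_def X_def qpt_def quad_emb mink_simps)
  have nd: "quad (n a) (fder X a h) = 0" if a: "a \<in> D" for a h
    using Dfg'[OF a, of h] mink_dual[OF lin[OF gS[OF a]], of "g' a h"]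
    unfolding dX[OF a] n_def quad_emb k_def Df[OF gS[OF a]] by (simp add: mink_simps)
  have "moving_frame (cone Z) D X N1 N2 n"
    unfolding moving_frame_def Let_def
  proof (intro conjI ballI allI)
    fix u u' c assume "u \<in> D" "u' \<in> D"
    then show "X u' = c *\<^sub>R X u \<longrightarrow> u' = u" using inj by blast
  next
    fix u a v assume "u \<in> D"
    then show "a *\<^sub>R X u + fder X u v = 0 \<longrightarrow> a = 0 \<and> v = 0" using imm by blast
  qed (use oD smX smN smn op ind nul nn nX nd in \<open>simp_all only: simp_thms\<close>)
  moreover have "P p \<in> D" "X (P p) = qpt p" using gP[OF N(2) m(2)] by (auto simp: X_def)
  ultimately show ?thesis unfolding Z_def by blast
qed


subsection \<open>Indefinite spheres\<close>

text \<open>The equation of a hyperplane section in the affine chart. Its Hessian is a multiple of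
  \<open>mink\<close>, so spheres have vanishing second derivative in every null direction.\<close>

lemma qpt_functional:
  defines "e \<equiv> \<lambda>z u. quad (qpt u) z"
  shows "smooth_on UNIV (e z)" "fder (e z) u w = quad (emb 0 w (mink u w)) z"
    "hess (e z) u v w = quad (emb 0 0 (mink v w)) z"
proof -
  show "smooth_on UNIV (e z)"
    unfolding e_def
    by (intro smooth_on_bounded_linear[OF quad_left] smooth_on_qpt smooth_on_ident open_UNIV)
  have d: "(e z has_derivative (\<lambda>w. quad (emb 0 w (mink u w)) z)) (at u)" for u
    unfolding e_def
    by (rule bounded_linear.has_derivative[OF quad_left qpt_has_derivative[OF has_derivative_ident]])
  show fd: "fder (e z) u w = quad (emb 0 w (mink u w)) z" for u w
    by (rule fder_eq[OF d])
  have "((\<lambda>u. emb 0 w (mink u w)) has_derivative (\<lambda>v. emb 0 0 (mink v w))) (at u)"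
    unfolding emb_def
    by (simp, intro has_derivative_Pair has_derivative_const
        bounded_linear_imp_has_derivative[OF mink_left])
  then have "((\<lambda>u. fder (e z) u w) has_derivative (\<lambda>v. quad (emb 0 0 (mink v w)) z)) (at u)"
    unfolding fd
    by (rule bounded_linear.has_derivative[OF quad_left])
  then show "hess (e z) u v w = quad (emb 0 0 (mink v w)) z"
    unfolding hess_def by (rule fder_eq)
qed

lemma sphere_functional_regular:
  assumes "quad z z < 0" "quad (qpt p) z = 0"
  shows "\<exists>w. quad (emb 0 w (mink p w)) z \<noteq> 0"
proof (rule ccontr)
  have sym: "quad v w = quad w v" for v w
    by (cases v; cases w) (auto simp: algebra_simps)
  assume "\<not> ?thesis"
  then have "quad z z = 0" using assms(2) by (intro quad_normal_null[of z p]) (auto simp: sym[of z])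
  then show False using assms(1) by simp
qed

lemma qpt_nonzero: "qpt u \<noteq> 0"
  by (simp add: qpt_def emb_simps)

text \<open>The sphere is used as the reference surface: \<open>f\<close> vanishes on it near the point.\<close>

lemma sphere_null_hess:
  fixes f :: "real3 \<Rightarrow> real"
  assumes S: "open S" "smooth_on S f" and C: "C \<subseteq> {u \<in> S. f u = 0}" "p \<in> C"
    and nz: "fder f p u0 \<noteq> 0"
    and sph: "open_in_indefinite_sphere (cone C)"
    and v: "fder f p v = 0" "mink v v = 0"
  shows "hess f p v v = 0"
proof -
  obtain z where z: "quad z z < 0" "openin (top_of_set (sphere_cone z)) (cone C)"
    using sph unfolding open_in_indefinite_sphere_def by blast
  then obtain W where W: "open W" "cone C = sphere_cone z \<inter> W" unfolding openin_open by blast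
  let ?e = "\<lambda>u. quad (qpt u) z" and ?Df = "fder f p"
  let ?De = "fder ?e p"
  have "qpt p \<in> cone C" using cone_qpt[of 1 p C] C(2) by simp
  then have ep: "?e p = 0" "qpt p \<in> W" using W(2) by (auto simp: sphere_cone_def)
  have pS: "p \<in> S" using C by blast
  define T where "T = S \<inter> qpt -` W"
  have "continuous_on UNIV qpt"
    using smooth_on_continuous_on[OF smooth_on_qpt[OF open_UNIV smooth_on_ident]] by simp
  then have T: "open T" "p \<in> T" "T \<subseteq> S" using S(1) W(1) pS ep(2) by (auto simp: T_def open_vimage)
  have sT: "smooth_on T ?e" "smooth_on T f"
    using smooth_on_subset[OF qpt_functional(1)] smooth_on_subset[OF S(2) T(3)] by auto
  have ef: "f y = 0" if "y \<in> T" "?e y = 0" for y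
  proof -
    have "qpt y \<in> cone C" unfolding W(2)
      using that by (simp add: T_def sphere_cone_def qpt_nonzero quad_qpt)
    then show ?thesis using cone_qpt[of 1 y C] C(1) by auto
  qed
  obtain y0 where y0: "?De y0 \<noteq> 0"
    using sphere_functional_regular[OF z(1) ep(1)] by (auto simp: qpt_functional(2))
  have le: "linear ?De"
    by (rule smooth_on_linear[OF sT(1) T(2)])
  have lf: "linear ?Df"
    by (rule smooth_on_linear[OF S(2) pS])
  have ker: "?Df w = 0" if "?De w = 0" for w
    by (rule hess_on_hypersurface(1)[where f="?e" and h=f, OF T(1,2) sT(1) ep(1) sT(2) _ y0 that]) (rule ef)
  have fe: "?Df w = (?De w / ?De y0) * ?Df y0" for w
  proof -
    have "?De (w - (?De w / ?De y0) *\<^sub>R y0) = 0"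
      using y0 by (simp add: linear_diff[OF le] linear_cmul[OF le])
    from ker[OF this] show ?thesis by (simp add: linear_diff[OF lf] linear_cmul[OF lf])
  qed
  have "?Df y0 \<noteq> 0" using fe[of u0] nz by auto
  then have De: "?De v = 0" using fe[of v] v(1) y0 by simp
  have "hess f p v v * ?De y0 = ?Df y0 * hess ?e p v v"
    by (rule hess_on_hypersurface(2)[where f="?e" and h=f, OF T(1,2) sT(1) ep(1) sT(2) _ y0 De]) (rule ef)
  then have "hess f p v v * ?De y0 = ?Df y0 * quad (emb 0 0 0) z"
    by (simp add: qpt_functional(3) v(2))
  moreover have "quad (emb 0 0 0) z = 0" using quad_simps(7) by (simp add: emb_simps(7)[THEN iffD2])
  ultimately show ?thesis using y0 by simp
qed

text \<open>The unit normal satisfies \<open>\<nu>' = \<alpha> id\<close> on each tangent plane.  In a chart whose inverse is the linear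
  projection \<open>P\<close>, the two components of \<open>P \<circ> \<nu>\<close> depend on one coordinate each and have equal derivatives,
  so \<open>\<alpha>\<close> is constant without differentiating it.\<close>

lemma conformal_product_constant:
  fixes \<eta> :: "real \<times> real \<Rightarrow> real \<times> real"
  assumes D: "D = ball x0 e \<times> ball y0 e"
    and \<eta>: "\<And>a. a \<in> D \<Longrightarrow> (\<eta> has_derivative (\<lambda>h. \<alpha> a *\<^sub>R h)) (at a)"
    and ab: "a \<in> D" "b \<in> D"
  shows "\<alpha> a = \<alpha> b"
proof -
  have d1: "((\<lambda>x. \<eta> (x, y)) has_derivative (\<lambda>h. (\<alpha> (x, y) * h, 0))) (at x)"
    and d2: "((\<lambda>y. \<eta> (x, y)) has_derivative (\<lambda>h. (0, \<alpha> (x, y) * h))) (at y)" if "(x, y) \<in> D" for x y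
  proof -
    have "((\<lambda>x. (x, y)) has_derivative (\<lambda>h. (h, 0))) (at x)" "((\<lambda>y. (x, y)) has_derivative (\<lambda>h. (0, h))) (at y)"
      by (auto intro!: derivative_eq_intros)
    from has_derivative_compose[OF this(1) \<eta>[OF that]] has_derivative_compose[OF this(2) \<eta>[OF that]]
    show "((\<lambda>x. \<eta> (x, y)) has_derivative (\<lambda>h. (\<alpha> (x, y) * h, 0))) (at x)"
      "((\<lambda>y. \<eta> (x, y)) has_derivative (\<lambda>h. (0, \<alpha> (x, y) * h))) (at y)" by auto
  qed
  have c1: "fst (\<eta> (x, y)) = fst (\<eta> (x, y'))" if "x \<in> ball x0 e" "y \<in> ball y0 e" "y' \<in> ball y0 e" for x y y'
  proof (rule has_derivative_zero_unique[OF convex_ball _ that(2,3)])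
    fix t assume "t \<in> ball y0 e"
    then show "((\<lambda>y. fst (\<eta> (x, y))) has_derivative (\<lambda>h. 0)) (at t within ball y0 e)"
      using has_derivative_at_withinI[OF has_derivative_fst[OF d2[of x t]], of "ball y0 e"] that(1) by (simp add: D)
  qed
  have c2: "snd (\<eta> (x, y)) = snd (\<eta> (x', y))" if "x \<in> ball x0 e" "x' \<in> ball x0 e" "y \<in> ball y0 e" for x x' y
  proof (rule has_derivative_zero_unique[OF convex_ball _ that(1,2)])
    fix t assume "t \<in> ball x0 e"
    then show "((\<lambda>x. snd (\<eta> (x, y))) has_derivative (\<lambda>h. 0)) (at t within ball x0 e)"
      using has_derivative_at_withinI[OF has_derivative_snd[OF d1[of t y]], of "ball x0 e"] that(3) by (simp add: D)
  qed
  have h: "\<alpha> (x, y) = \<alpha> (x, y')" if xy: "x \<in> ball x0 e" "y \<in> ball y0 e" "y' \<in> ball y0 e" for x y y'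
  proof -
    have "((\<lambda>x. fst (\<eta> (x, y))) has_derivative (\<lambda>h. \<alpha> (x, y) * h)) (at x)"
      using has_derivative_fst[OF d1[of x y]] xy by (simp add: D)
    moreover have "((\<lambda>x. fst (\<eta> (x, y'))) has_derivative (\<lambda>h. \<alpha> (x, y') * h)) (at x)"
      using has_derivative_fst[OF d1[of x y']] xy by (simp add: D)
    ultimately have "\<alpha> (x, y) * 1 = \<alpha> (x, y') * 1"
      by (rule derivative_local_unique[OF _ _ open_ball xy(1)]) (rule c1[OF _ xy(2,3)])
    then show ?thesis by simp
  qed
  have k: "\<alpha> (x, y) = \<alpha> (x', y)" if xy: "x \<in> ball x0 e" "x' \<in> ball x0 e" "y \<in> ball y0 e" for x x' y
  proof -
    have "((\<lambda>y. snd (\<eta> (x, y))) has_derivative (\<lambda>h. \<alpha> (x, y) * h)) (at y)"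
      using has_derivative_snd[OF d2[of x y]] xy by (simp add: D)
    moreover have "((\<lambda>y. snd (\<eta> (x', y))) has_derivative (\<lambda>h. \<alpha> (x', y) * h)) (at y)"
      using has_derivative_snd[OF d2[of x' y]] xy by (simp add: D)
    ultimately have "\<alpha> (x, y) * 1 = \<alpha> (x', y) * 1"
      by (rule derivative_local_unique[OF _ _ open_ball xy(3)]) (rule c2[OF xy(1,2)])
    then show ?thesis by simp
  qed
  obtain x y x' y' where "a = (x, y)" "b = (x', y')" by (cases a; cases b)
  then show ?thesis using ab h[of x y y'] k[of x x' y'] by (auto simp: D)
qed

text \<open>One fibre of a Monge-Ampere equation. \<open>S\<close> is meant to contain only points
  of negative discriminant, so that the unit normal is defined and smooth on a full neighbourhood of
  the surface and can be differentiated in all directions.\<close>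

locale umbilic_surface =
  fixes S :: "(real3) set" and f :: "real3 \<Rightarrow> real" and Z
  assumes S: "open S" "smooth_on S f" and Z_def: "Z = {u \<in> S. f u = 0}"
    and spacelike: "\<And>u. u \<in> S \<Longrightarrow> mink (mink_dual (fder f u)) (mink_dual (fder f u)) < 0"
    and null_directions: "\<And>u. u \<in> Z \<Longrightarrow> \<exists>v1 v2. null_pair (fder f u) v1 v2 \<and> hess f u v1 v1 = 0 \<and> hess f u v2 v2 = 0"
begin

abbreviation "Df u \<equiv> fder f u"

definition "nscale u = (- mink (mink_dual (Df u)) (mink_dual (Df u)) / 2) powr (- 1 / 2)"

definition "unormal u = nscale u *\<^sub>R mink_dual (Df u)"

lemma Z_S: "u \<in> Z \<Longrightarrow> u \<in> S" "u \<in> Z \<Longrightarrow> f u = 0"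
  by (auto simp: Z_def)

lemma Df_linear: "u \<in> S \<Longrightarrow> linear (Df u)"
  by (rule smooth_on_linear[OF S(2)])

lemma Df_nonzero: "u \<in> S \<Longrightarrow> \<exists>w. Df u w \<noteq> 0"
proof (rule ccontr)
  assume "u \<in> S" "\<not> (\<exists>w. Df u w \<noteq> 0)"
  then have "mink_dual (Df u) = 0" by (simp add: mink_dual_def zero_prod_def)
  then show False using spacelike[OF \<open>u \<in> S\<close>] by (simp add: mink_simps)
qed

lemma nscale_pos: "u \<in> S \<Longrightarrow> nscale u > 0"
  using spacelike[of u] by (simp add: nscale_def)

lemma smooth_dual: "smooth_on S (\<lambda>u. mink_dual (Df u))"
  unfolding mink_dual_def divide_inverse
  by (intro smooth_on_Pair smooth_on_minus smooth_on_mult smooth_on_const smooth_on_frechet S)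

lemma smooth_nscale: "smooth_on S nscale"
proof -
  have "smooth_on S (\<lambda>u. - mink (mink_dual (Df u)) (mink_dual (Df u)) * inverse 2)"
    by (intro smooth_on_mult smooth_on_minus smooth_on_const smooth_on_mink smooth_dual S)
  then show ?thesis unfolding nscale_def[abs_def] divide_inverse
    by (rule smooth_on_powr[OF S(1)]) (use spacelike in simp)
qed

lemma smooth_normal: "smooth_on S unormal"
  unfolding unormal_def[abs_def] by (intro smooth_on_scaleR S smooth_nscale smooth_dual)

lemma normal_unit: "u \<in> S \<Longrightarrow> mink (unormal u) (unormal u) = - 2"
proof -
  assume u: "u \<in> S"
  define q where "q = - mink (mink_dual (Df u)) (mink_dual (Df u)) / 2"
  have q: "q > 0" using spacelike[OF u] by (simp add: q_def)
  have "mink (unormal u) (unormal u) = nscale u * nscale u * (- 2 * q)"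
    by (simp add: unormal_def mink_simps q_def)
  also have "nscale u * nscale u = q powr (- 1)"
    unfolding nscale_def q_def[symmetric] by (simp flip: powr_add)
  finally show ?thesis using q by (simp add: powr_minus_divide)
qed

lemma mink_normal: "u \<in> S \<Longrightarrow> mink (unormal u) w = nscale u * Df u w"
  by (simp add: unormal_def mink_simps mink_dual[OF Df_linear])

text \<open>The derivative of the unit normal has no normal component, and its tangential part is
  given by the Hessian. In a null basis of the tangent plane the Hessian and the metric both have
  only an off-diagonal entry, so they are proportional and the shape operator is a scalar.\<close>

lemma umbilic:
  assumes "u \<in> Z" shows "\<exists>\<alpha>. \<forall>w. Df u w = 0 \<longrightarrow> fder unormal u w = \<alpha> *\<^sub>R w"
proof -
  have u: "u \<in> S" using Z_S[OF assms] by blast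
  let ?n' = "fder unormal u"
  note dn = smooth_on_deriv[OF smooth_normal u]
  obtain v1 v2 where np: "null_pair (Df u) v1 v2" and h: "hess f u v1 v1 = 0" "hess f u v2 v2 = 0"
    using null_directions[OF assms] by blast
  obtain w0 where w0: "Df u w0 \<noteq> 0" using Df_nonzero[OF u] by blast
  define m where "m = mink v1 v2"
  have m: "m \<noteq> 0" "mink v1 v1 = 0" "mink v2 v2 = 0" "mink v2 v1 = m" "Df u v1 = 0" "Df u v2 = 0"
    using np by (auto simp: null_pair_def m_def mink_sym)
  have n1: "mink (?n' w) (unormal u) = 0" for w
  proof -
    have "mink (unormal u) (?n' w) + mink (?n' w) (unormal u) = 0"
      by (rule derivative_locally_const[OF mink_FDERIV[OF dn dn] S(1) u]) (rule normal_unit)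
    then show ?thesis by (simp add: mink_sym[of "unormal u"])
  qed
  have n2: "mink (?n' w) v = nscale u * hess f u w v" if "Df u v = 0" for w v
  proof -
    have "mink (?n' w) v = nscale u * hess f u w v + fder nscale u w * Df u v"
      by (rule derivative_local_unique[OF
            bounded_linear.has_derivative[OF mink_left dn]
            has_derivative_mult[OF smooth_on_deriv[OF smooth_nscale u] hess_deriv[OF S u]] S(1) u])
         (rule mink_normal)
    then show ?thesis using that by simp
  qed
  define \<alpha> where "\<alpha> = nscale u * hess f u v1 v2 / m"
  have "?n' w = \<alpha> *\<^sub>R w" if w: "Df u w = 0" for w
  proof -
    define x y where "x = mink w v2 / mink v1 v2" "y = mink w v1 / mink v1 v2"
    have wxy: "w = x *\<^sub>R v1 + y *\<^sub>R v2"
      using null_pair_kernel[OF np Df_linear[OF u] w0 w] by (simp add: x_y_def)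
    note l1 = hess_linear1[OF S u]
    have hw: "hess f u w v1 = y * hess f u v1 v2" "hess f u w v2 = x * hess f u v1 v2"
      unfolding wxy by (simp_all add: linear_add[OF l1] linear_cmul[OF l1] h hess_sym_real[OF S u, of v2 v1])
    have mw: "mink w v1 = y * m" "mink w v2 = x * m"
      unfolding wxy by (simp_all add: mink_simps m m_def[symmetric])
    have "?n' w - \<alpha> *\<^sub>R w = 0"
    proof (rule mink_zero[of v1 v2 "unormal u"])
      show "mink (?n' w - \<alpha> *\<^sub>R w) v1 = 0" "mink (?n' w - \<alpha> *\<^sub>R w) v2 = 0"
        using m by (simp_all add: mink_simps n2 hw mw \<alpha>_def)
      show "mink (?n' w - \<alpha> *\<^sub>R w) (unormal u) = 0"
        using mink_normal[OF u, of w] w by (simp add: mink_simps n1 mink_sym[of w])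
      show "mink v1 v2 \<noteq> 0" using m by (simp add: m_def)
      show "mink (unormal u) (unormal u) \<noteq> 0" by (simp add: normal_unit[OF u])
    qed (use m mink_normal[OF u] in auto)
    then show ?thesis by simp
  qed
  then show ?thesis by blast
qed

text \<open>Chosen point by point, with no regularity claimed; constancy on each chart comes from
  \<open>conformal_product_constant\<close>.\<close>

definition "\<alpha> u = (SOME \<alpha>. \<forall>w. Df u w = 0 \<longrightarrow> fder unormal u w = \<alpha> *\<^sub>R w)"

lemma normal_derivative: "u \<in> Z \<Longrightarrow> Df u w = 0 \<Longrightarrow> fder unormal u w = \<alpha> u *\<^sub>R w"
  using someI_ex[OF umbilic] unfolding \<alpha>_def by blast

text \<open>The lift \<open>emb 0 (unormal u) (mink (unormal u) u)\<close> of the unit normal minus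
  \<alpha> times \<open>qpt u\<close>: the pole of the sphere that touches the surface at
  \<open>u\<close> with the same curvature. Once \<alpha> is constant, its derivative along the
  surface vanishes.\<close>

definition "centre u = emb (- \<alpha> u) (unormal u - \<alpha> u *\<^sub>R u) (mink (unormal u) u - \<alpha> u * mink u u / 2)"

lemma centre_quad: "u \<in> S \<Longrightarrow> quad (centre u) (centre u) = - 2"
  by (simp add: centre_def quad_emb mink_simps normal_unit mink_sym[of u "unormal u"] algebra_simps)

lemma centre_qpt: "quad (qpt u) (centre u) = 0"
  by (simp add: centre_def qpt_def quad_emb mink_simps mink_sym[of u "unormal u"])

lemma centre_chart:
  assumes ch: "surface_chart f p S P E y0 e D N g" and ab: "a \<in> D" "b \<in> D"
  shows "centre (g a) = centre (g b)"
proof -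
  let ?g' = "\<lambda>a. fder g a"
  have P: "bounded_linear P" and D: "D = ball (fst (P p)) e \<times> ball (snd (P p)) e" and N: "N \<subseteq> S" and sg: "smooth_on D g"
    and g: "\<And>a. a \<in> D \<Longrightarrow> g a \<in> N \<and> f (g a) = 0 \<and> P (g a) = a"
    using ch unfolding surface_chart_def by auto
  have oD: "open D" "convex D" by (auto simp: D open_Times convex_Times)
  have gZ: "g a \<in> Z" if "a \<in> D" for a using g[OF that] N by (auto simp: Z_def)
  note dg = smooth_on_deriv[OF sg]
  have dn: "((\<lambda>a. unormal (g a)) has_derivative (\<lambda>h. \<alpha> (g a) *\<^sub>R ?g' a h)) (at a)" if a: "a \<in> D" for a
  proof -
    have "fder unormal (g a) (?g' a h) = \<alpha> (g a) *\<^sub>R ?g' a h" for h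
      by (rule normal_derivative[OF gZ[OF a] surface_chart_derivative(2)[OF S ch a]])
    then show ?thesis
      using has_derivative_compose[OF dg[OF a] smooth_on_deriv[OF smooth_normal Z_S(1)[OF gZ[OF a]]]] by simp
  qed
  have "((\<lambda>a. P (unormal (g a))) has_derivative (\<lambda>h. \<alpha> (g a) *\<^sub>R h)) (at a)" if a: "a \<in> D" for a
    using bounded_linear.has_derivative[OF P dn[OF a]]
    by (simp add: linear_cmul[OF bounded_linear.linear[OF P]] surface_chart_derivative(1)[OF S ch a])
  from conformal_product_constant[where \<alpha>="\<lambda>a. \<alpha> (g a)", OF D this]
  have \<alpha>: "\<alpha> (g a) = \<alpha> (g b)" if "a \<in> D" "b \<in> D" for a b using that by blast
  define c where "c = \<alpha> (g a)"
  let ?z = "\<lambda>x. emb (- c) (unormal (g x) - c *\<^sub>R g x) (mink (unormal (g x)) (g x) - c * (mink (g x) (g x) / 2))"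
  have z: "centre (g x) = ?z x" if "x \<in> D" for x
    using \<alpha>[OF that ab(1)] by (simp add: centre_def c_def)
  have "(?z has_derivative (\<lambda>h. 0)) (at x)" if x: "x \<in> D" for x
  proof -
    have c: "\<alpha> (g x) = c" using \<alpha>[OF x ab(1)] by (simp add: c_def)
    let ?h = "\<lambda>h. ?g' x h"
    have 1: "((\<lambda>x. unormal (g x) - c *\<^sub>R g x) has_derivative (\<lambda>h. 0)) (at x)"
      using has_derivative_diff[OF dn[OF x] has_derivative_scaleR_right[OF dg[OF x], of c]] by (simp add: c)
    have "((\<lambda>x. mink (unormal (g x)) (g x) - c * (mink (g x) (g x) / 2)) has_derivative
       (\<lambda>h. mink (unormal (g x)) (?h h) + mink (c *\<^sub>R ?h h) (g x) - c * ((mink (g x) (?h h) + mink (?h h) (g x)) / 2))) (at x)"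
      using dn[OF x] unfolding c
      by (intro has_derivative_diff has_derivative_mult_right bounded_linear.has_derivative[OF bounded_linear_divide]
           mink_FDERIV dg x)
    moreover have "mink (unormal (g x)) (?h h) = 0" for h
      by (simp add: mink_normal[OF Z_S(1)[OF gZ[OF x]]] surface_chart_derivative(2)[OF S ch x])
    ultimately have 2: "((\<lambda>x. mink (unormal (g x)) (g x) - c * (mink (g x) (g x) / 2)) has_derivative (\<lambda>h. 0)) (at x)"
      by (simp add: mink_simps mink_sym[of "g x"])
    have "(?z has_derivative (\<lambda>h. emb 0 0 0)) (at x)"
      unfolding emb_def
      by (intro has_derivative_Pair has_derivative_const has_derivative_fst has_derivative_snd 1 2)
    then show ?thesis by (simp add: emb_simps(7)[THEN iffD2])
  qed
  then have "?z a = ?z b"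
    by (intro has_derivative_zero_unique[OF oD(2) _ ab]) (rule has_derivative_at_withinI)
  then show ?thesis using z ab by simp
qed

lemma chart_exists: "p \<in> Z \<Longrightarrow> \<exists>P E y0 e D N \<rho>. surface_chart f p S P E y0 e D N \<rho>"
  using Df_nonzero local_param[OF S] Z_S by metis

lemma centre_constant:
  assumes C: "connected C" "C \<subseteq> Z" "a \<in> C" "b \<in> C"
  shows "centre a = centre b"
proof (rule connected_local_const[OF C(1,3,4)], rule ballI)
  fix p assume p: "p \<in> C"
  then obtain P E y0 e D N g where ch: "surface_chart f p S P E y0 e D N g" using chart_exists C(2) by blast
  then have N: "open N" "p \<in> N" and gP: "\<And>x. x \<in> N \<Longrightarrow> f x = 0 \<Longrightarrow> P x \<in> D \<and> g (P x) = x"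
    unfolding surface_chart_def by auto
  have "centre p = centre x" if "x \<in> C" "x \<in> N" for x
  proof -
    have "f p = 0" "f x = 0" using p that(1) C(2) Z_S(2) by blast+
    with centre_chart[OF ch, of "P p" "P x"] gP[OF N(2)] gP[OF that(2)] show ?thesis by simp
  qed
  then show "eventually (\<lambda>x. centre p = centre x) (at p within C)"
    unfolding eventually_at_topological using N by blast
qed

text \<open>A constant \<open>centre\<close> places the component inside one sphere. Relative
  openness is the remaining point: near \<open>p\<close> the sphere equation is strictly monotone
  along \<open>y0\<close>, so each line parallel to \<open>y0\<close> meets the sphere there at most
  once, and the chart already provides a point of the component on that line.\<close>

lemma component_in_sphere:
  assumes C: "C \<in> components Z"
  shows "open_in_indefinite_sphere (cone C)"
proof -
  have C': "connected C" "C \<subseteq> Z" "C \<noteq> {}"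
    using in_components_connected[OF C] in_components_subset[OF C] in_components_nonempty[OF C] by auto
  then obtain p0 where p0: "p0 \<in> C" by blast
  define z where "z = centre p0"
  have z: "centre p = z" if "p \<in> C" for p using centre_constant[OF C'(1,2) that p0] by (simp add: z_def)
  let ?e = "\<lambda>u. quad (qpt u) z"
  have eC: "?e p = 0" if "p \<in> C" for p using centre_qpt[of p] z[OF that] by simp
  have "\<exists>T. openin (top_of_set (sphere_cone z)) T \<and> w \<in> T \<and> T \<subseteq> cone C" if w: "w \<in> cone C" for w
  proof -
    obtain c p where cp: "w = c *\<^sub>R qpt p" "c \<noteq> 0" "p \<in> C" using w by (auto simp: cone_def)
    then have pZ: "p \<in> Z" using C' by blast
    then obtain P E y0 e D N \<rho> where ch: "surface_chart f p S P E y0 e D N \<rho>" using chart_exists by blast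
    then have P: "bounded_linear P" and D: "D = ball (fst (P p)) e \<times> ball (snd (P p)) e"
      and N: "open N" "p \<in> N" "N \<subseteq> S" and s\<rho>: "smooth_on D \<rho>" and split: "\<And>w. w = E (P w) + Df p w *\<^sub>R y0"
      and \<rho>: "\<And>a. a \<in> D \<Longrightarrow> \<rho> a \<in> N \<and> f (\<rho> a) = 0 \<and> P (\<rho> a) = a" and E: "bounded_linear E"
      and \<rho>P: "\<And>x. x \<in> N \<Longrightarrow> f x = 0 \<Longrightarrow> P x \<in> D \<and> \<rho> (P x) = x"
      and pos: "\<And>x. x \<in> N \<Longrightarrow> Df x y0 > 0"
      unfolding surface_chart_def by auto
    have oD: "open D" "connected D" by (auto simp: D open_Times convex_Times convex_connected)
    have pD: "P p \<in> D" "\<rho> (P p) = p" using \<rho>P[OF N(2)] Z_S[OF pZ] by auto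
    have "\<rho> ` D \<subseteq> C"
    proof (rule components_maximal[OF C])
      show "connected (\<rho> ` D)" by (rule connected_continuous_image[OF smooth_on_continuous_on[OF s\<rho>] oD(2)])
      show "\<rho> ` D \<subseteq> Z" using \<rho> N by (auto simp: Z_def)
      have "p \<in> C \<inter> \<rho> ` D" using pD cp(3) by force
      then show "C \<inter> \<rho> ` D \<noteq> {}" by blast
    qed
    then have \<rho>C: "\<rho> a \<in> C" if "a \<in> D" for a using that by blast
    \<comment> \<open>The derivative of \<open>?e\<close> at \<open>x\<close> along
      \<open>y0\<close>. At \<open>p\<close> it is a positive multiple of \<open>Df p y0\<close>, by
      the construction of \<open>centre\<close>.\<close>
    define g where "g x = quad (emb 0 y0 (mink x y0)) z" for x
    have "g p = mink (unormal p) y0"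
      unfolding g_def z[OF cp(3), symmetric] centre_def quad_emb
      by (simp add: mink_simps mink_sym[of y0 "unormal p"] mink_sym[of y0 p])
    then have gp: "g p > 0" using pos[OF N(2)] nscale_pos[OF Z_S(1)[OF pZ]] by (simp add: mink_normal[OF Z_S(1)[OF pZ]])
    have "continuous_on UNIV g"
      unfolding g_def
      using smooth_on_continuous_on[OF smooth_on_frechet[OF open_UNIV qpt_functional(1)[of z]], of y0]
      by (simp add: qpt_functional(2))
    then have "open (g -` {0<..})" by (intro open_vimage) auto
    then obtain d where d: "d > 0" "ball p d \<subseteq> g -` {0<..}" using gp open_contains_ball by (metis greaterThan_iff vimageI)
    \<comment> \<open>Both \<open>x\<close> and the surface point with the same projection lie in a
      convex ball on which \<open>g\<close> is positive.\<close>
    define N' where "N' = (ball p d \<inter> N) \<inter> {x. P x \<in> D \<and> \<rho> (P x) \<in> ball p d}"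
    have "open {x. P x \<in> D \<and> \<rho> (P x) \<in> ball p d}"
    proof -
      have "open (P -` {a \<in> D. \<rho> a \<in> ball p d})"
        by (intro open_vimage linear_continuous_on P smooth_on_open_vimage[OF oD(1) s\<rho>] open_ball)
      then show ?thesis by (simp add: vimage_def)
    qed
    then have N': "open N'" "p \<in> N'" using N pD d by (auto simp: N'_def)
    have in_C: "x \<in> C" if x: "x \<in> N'" "?e x = 0" for x
    proof -
      define y where "y = \<rho> (P x)"
      have y: "y \<in> C" "P y = P x" "y \<in> ball p d" using x \<rho>C \<rho> by (auto simp: y_def N'_def)
      define s where "s = Df p (x - y)"
      have xy: "x - y = s *\<^sub>R y0"
        using split[of "x - y"] y(2)
        by (simp add: s_def linear_diff[OF bounded_linear.linear[OF P]] linear_0[OF bounded_linear.linear[OF E]])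
      define mp where "mp = (1 / 2) *\<^sub>R x + (1 / 2) *\<^sub>R y"
      have "mp \<in> ball p d"
        unfolding mp_def using x y(3) by (intro convexD convex_ball) (auto simp: N'_def)
      then have gm: "g mp > 0" using d(2) by auto
      \<comment> \<open>\<open>qpt\<close> is quadratic, so its increment along a segment is exactly
        its derivative at the midpoint.\<close>
      have "qpt x - qpt y = s *\<^sub>R emb 0 y0 (mink mp y0)"
      proof -
        have "mink x x - mink y y = 2 * mink mp (x - y)"
          by (simp add: mp_def mink_simps mink_sym[of y x] algebra_simps)
        then have "mink x x - mink y y = 2 * (s * mink mp y0)" by (simp add: xy mink_simps)
        then show ?thesis using xy by (simp add: qpt_def emb_simps diff_divide_distrib[symmetric])
      qed
      then have "?e x - ?e y = s * g mp" by (simp add: g_def quad_simps flip: quad_simps(3))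
      then have "s = 0" using x(2) eC[OF y(1)] gm by simp
      then show ?thesis using xy y(1) by simp
    qed
    let ?T = "sphere_cone z \<inter> {w. fst w \<noteq> 0 \<and> dehom w \<in> N'}"
    have "openin (top_of_set (sphere_cone z)) ?T" by (rule openin_open_Int[OF open_dehom[OF N'(1)]])
    moreover have "w \<in> ?T"
      using cp N' eC[OF cp(3)] by (simp add: sphere_cone_def quad_simps quad_qpt qpt_nonzero dehom_qpt)
        (simp add: qpt_def emb_simps)
    moreover have "w' \<in> cone C" if w': "w' \<in> ?T" for w'
    proof -
      have f: "fst w' \<noteq> 0" "dehom w' \<in> N'" "quad w' w' = 0" "quad w' z = 0" using w' by (auto simp: sphere_cone_def)
      note eq = cone_null[OF f(1,3)]
      have "?e (dehom w') = 0" using f(1,4) by (subst (asm) eq) (simp add: quad_simps)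
      then have "dehom w' \<in> C" using in_C f(2) by blast
      then show ?thesis using f(1) cone_qpt[of "fst w'" "dehom w'" C] eq by simp
    qed
    ultimately show ?thesis by blast
  qed
  then have "openin (top_of_set (sphere_cone z)) (cone C)"
    using openin_subopen[of "top_of_set (sphere_cone z)" "cone C"] by blast
  moreover have "quad z z < 0" using centre_quad[OF Z_S(1)[OF subsetD[OF C'(2) p0]]] by (simp add: z_def)
  ultimately show ?thesis unfolding open_in_indefinite_sphere_def by blast
qed

end


subsection \<open>Contact transformations\<close>

text \<open>Combinations of two of the three forms defining the canonical system. The form
  \<open>dz - p dx - q dy\<close> is left out because its exterior derivative vanishes on the
  canonical system, see \<open>canonical_system_zbil\<close>.\<close>

fun pform :: "real \<times> real \<Rightarrow> jet2 \<Rightarrow> jet2 \<Rightarrow> real" where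
  "pform (c1, c2) ((x, y, z, p, q), (r, s, t)) ((dx, dy, dz, dp, dq), (dr, ds, dt)) =
     c1 * (dp - r * dx - s * dy) + c2 * (dq - s * dx - t * dy)"

text \<open>The exterior derivative of \<open>pform c\<close>.\<close>

fun dform :: "real \<times> real \<Rightarrow> jet2 \<Rightarrow> jet2 \<Rightarrow> real" where
  "dform (c1, c2) ((x, y, z, p, q), (r, s, t)) ((x', y', z', p', q'), (r', s', t')) =
     c1 * (x * r' - r * x' + (y * s' - s * y')) + c2 * (x * s' - s * x' + (y * t' - t * y'))"

text \<open>At every point these vectors are dual to the three defining forms. The coefficients of a
  combination of the forms are thus its values on them.\<close>

abbreviation "ez \<equiv> ((0, 0, 1, 0, 0), 0, 0, 0) :: jet2"
abbreviation "ep \<equiv> ((0, 0, 0, 1, 0), 0, 0, 0) :: jet2"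
abbreviation "eq \<equiv> ((0, 0, 0, 0, 1), 0, 0, 0) :: jet2"

text \<open>For \<open>v\<close> in the canonical system, \<open>v\<close> is a vertical null vector iff it lies in the kernel of the
  restriction of some \<open>dform c\<close>, \<open>c \<noteq> 0\<close>, to the canonical system: an intrinsic description of the
  null cones of the fibres.\<close>

lemma vertical_null_dform:
  assumes "mink v v = 0"
  shows "(0, v) \<in> canonical_system m" "\<exists>c. c \<noteq> 0 \<and> (\<forall>Y. dform c (0, v) Y = 0)"
proof -
  obtain r s t where v: "v = (r, s, t)" by (cases v)
  have rt: "r * t = s * s" using assms by (simp add: v)
  show "(0, v) \<in> canonical_system m"
    by (cases m rule: canonical_system.cases) (simp add: v zero_prod_def)
  have "\<exists>c1 c2. (c1 \<noteq> 0 \<or> c2 \<noteq> 0) \<and> c1 * r + c2 * s = 0 \<and> c1 * s + c2 * t = 0"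
  proof (cases "r = 0")
    case True
    then have "s = 0" using rt by simp
    then show ?thesis using True by (intro exI[of _ 1] exI[of _ 0]) simp
  next
    case False
    then show ?thesis using rt by (intro exI[of _ "- s"] exI[of _ r]) (simp add: algebra_simps)
  qed
  then obtain c1 c2 where c: "(c1, c2) \<noteq> 0" "c1 * r + c2 * s = 0" "c1 * s + c2 * t = 0"
    by (auto simp: zero_prod_def)
  have "dform (c1, c2) (0, v) Y = 0" for Y
  proof -
    obtain x y z p q r' s' t' where Y: "Y = ((x, y, z, p, q), (r', s', t'))" by (cases Y) auto
    have "dform (c1, c2) (0, v) Y = - (x * (c1 * r + c2 * s)) - y * (c1 * s + c2 * t)"
      by (simp add: Y v zero_prod_def algebra_simps)
    then show ?thesis using c by simp
  qed
  then show "\<exists>c. c \<noteq> 0 \<and> (\<forall>Y. dform c (0, v) Y = 0)" using c by blast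
qed

lemma dform_null_vertical:
  assumes c: "c \<noteq> 0" "\<And>Y. Y \<in> canonical_system m \<Longrightarrow> dform c V Y = 0" and V: "V \<in> canonical_system m"
  shows "fst V = 0 \<and> mink (snd V) (snd V) = 0"
proof -
  obtain c1 c2 where cc: "c = (c1, c2)" by (cases c)
  obtain x y z p q r s t where m: "m = ((x, y, z, p, q), (r, s, t))" by (cases m) auto
  obtain dx dy dz dp dq dr ds dt where V': "V = ((dx, dy, dz, dp, dq), (dr, ds, dt))" by (cases V) auto
  have can: "dz = p * dx + q * dy" "dp = r * dx + s * dy" "dq = s * dx + t * dy"
    using V by (simp_all add: m V' algebra_simps)
  \<comment> \<open>Vertical test vectors say that the symmetric product of \<open>c\<close> and
    \<open>(dx, dy)\<close> vanishes, hence that \<open>(dx, dy)\<close> does. The horizontal ones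
    below then put \<open>c\<close> in the kernel of the symmetric matrix with entries
    \<open>dr\<close>, \<open>ds\<close>, \<open>dt\<close>, whose determinant must be zero.\<close>
  have "dform c V (0, (1, 0, 0)) = 0" "dform c V (0, (0, 1, 0)) = 0" "dform c V (0, (0, 0, 1)) = 0"
    by (rule c(2); simp add: m zero_prod_def)+
  then have 1: "c1 * dx = 0" "c1 * dy + c2 * dx = 0" "c2 * dy = 0"
    by (auto simp: cc V' zero_prod_def)
  have "c1 \<noteq> 0 \<or> c2 \<noteq> 0" using c(1) by (auto simp: cc zero_prod_def)
  then have xy: "dx = 0" "dy = 0" using 1 by auto
  have "dform c V ((1, 0, p, r, s), (0, 0, 0)) = 0" "dform c V ((0, 1, q, s, t), (0, 0, 0)) = 0"
    by (rule c(2); simp add: m)+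
  then have 2: "c1 * dr + c2 * ds = 0" "c1 * ds + c2 * dt = 0"
    by (auto simp: cc V' xy)
  have "c1 * (dr * dt - ds * ds) = dt * (c1 * dr + c2 * ds) - ds * (c1 * ds + c2 * dt)"
    "c2 * (dr * dt - ds * ds) = dr * (c1 * ds + c2 * dt) - ds * (c1 * dr + c2 * ds)"
    by (simp_all add: algebra_simps)
  then have "dr * dt - ds * ds = 0" using 2 \<open>c1 \<noteq> 0 \<or> c2 \<noteq> 0\<close> by auto
  then show ?thesis using can xy by (simp add: V' zero_prod_def mult.commute)
qed

lemma dform_nondegenerate:
  assumes "\<And>V Y. V \<in> canonical_system m \<Longrightarrow> Y \<in> canonical_system m \<Longrightarrow> dform c V Y = 0"
  shows "c = 0"
proof (rule ccontr)
  assume c: "c \<noteq> 0"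
  obtain x y z p q r s t where m: "m = ((x, y, z, p, q), (r, s, t))" by (cases m) auto
  have "((1, 0, p, r, s), (0, 0, 0)) \<in> canonical_system m" by (simp add: m)
  from dform_null_vertical[OF c assms[OF this] this] show False by (simp add: zero_prod_def)
qed


text \<open>Splits \<open>pform c n Y\<close> into a part independent of the base point
  \<open>n\<close> and a part bilinear in \<open>n\<close> and \<open>Y\<close>, so that it can be
  differentiated by product rules. Antisymmetrising the bilinear part gives \<open>dform\<close>,
  see \<open>dform_pbil\<close>.\<close>

definition plin :: "real \<times> real \<Rightarrow> jet2 \<Rightarrow> real" where
  "plin c Y = fst c * fst (snd (snd (snd (fst Y)))) + snd c * snd (snd (snd (snd (fst Y))))"

definition pbil :: "real \<times> real \<Rightarrow> jet2 \<Rightarrow> jet2 \<Rightarrow> real" where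
  "pbil c n Y = fst c * (fst (snd n) * fst (fst Y) + fst (snd (snd n)) * fst (snd (fst Y)))
     + snd c * (fst (snd (snd n)) * fst (fst Y) + snd (snd (snd n)) * fst (snd (fst Y)))"

definition zbil :: "jet2 \<Rightarrow> jet2 \<Rightarrow> real" where
  "zbil n Y = fst (snd (snd (snd (fst n)))) * fst (fst Y) + snd (snd (snd (snd (fst n)))) * fst (snd (fst Y))"

lemma pform_eq: "pform c n Y = plin c Y - pbil c n Y"
  by (cases c; cases n; cases Y) (auto simp: plin_def pbil_def algebra_simps)

lemma plin_bounded_linear: "bounded_linear (plin c)"
  by (intro linear_conv_bounded_linear[THEN iffD1] linearI) (auto simp: plin_def algebra_simps)

lemma pbil_bounded_bilinear: "bounded_bilinear (pbil c)"
proof -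
  have "bilinear (pbil c)"
    unfolding bilinear_def by (auto intro!: linearI simp: pbil_def algebra_simps)
  then show ?thesis by (simp add: bilinear_conv_bounded_bilinear)
qed

lemma zbil_bounded_bilinear: "bounded_bilinear zbil"
proof -
  have "bilinear zbil"
    unfolding bilinear_def by (auto intro!: linearI simp: zbil_def algebra_simps)
  then show ?thesis by (simp add: bilinear_conv_bounded_bilinear)
qed

lemma dform_pbil: "dform c V Y = pbil c Y V - pbil c V Y"
  by (cases c; cases V; cases Y) (auto simp: pbil_def algebra_simps)

lemma canonical_system_iff:
  "X \<in> canonical_system m \<longleftrightarrow> fst (snd (snd (fst X))) - zbil m X = 0 \<and> pform (1, 0) m X = 0 \<and> pform (0, 1) m X = 0"
  by (cases m; cases X) (auto simp: zbil_def)

lemma canonical_system_zbil: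
  assumes "X \<in> canonical_system m" "Y \<in> canonical_system m" shows "zbil X Y = zbil Y X"
proof -
  obtain x y z p q r s t where m: "m = ((x, y, z, p, q), (r, s, t))" by (cases m) auto
  obtain x1 y1 z1 p1 q1 r1 s1 t1 where X: "X = ((x1, y1, z1, p1, q1), (r1, s1, t1))" by (cases X) auto
  obtain x2 y2 z2 p2 q2 r2 s2 t2 where Y: "Y = ((x2, y2, z2, p2, q2), (r2, s2, t2))" by (cases Y) auto
  have "p1 = r * x1 + s * y1" "q1 = s * x1 + t * y1" "p2 = r * x2 + s * y2" "q2 = s * x2 + t * y2"
    using assms by (simp_all add: m X Y)
  then show ?thesis by (simp add: X Y zbil_def algebra_simps)
qed

lemma pform_canonical: "X \<in> canonical_system m \<Longrightarrow> pform c m X = 0"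
  by (cases c; cases m; cases X) auto

section \<open>Contact transformations act conformally along the fibres\<close>

locale contact =
  fixes W W' :: "jet2 set" and \<Phi> :: "jet2 \<Rightarrow> jet2"
  assumes contact: "contact_transformation W W' \<Phi>"
begin

abbreviation "d\<Phi> m \<equiv> fder \<Phi> m"

lemma W: "open W" "open W'" "smooth_on W \<Phi>" "smooth_on W' (inv_into W \<Phi>)" "bij_betw \<Phi> W W'"
  and canonical: "m \<in> W \<Longrightarrow> d\<Phi> m ` canonical_system m = canonical_system (\<Phi> m)"
  using contact by (auto simp: contact_transformation_def)

lemma \<Phi>_in: "m \<in> W \<Longrightarrow> \<Phi> m \<in> W'"
  using W(5) by (auto simp: bij_betw_def)

lemma \<Phi>_inv: "m \<in> W \<Longrightarrow> inv_into W \<Phi> (\<Phi> m) = m"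
  using W(5) by (simp add: bij_betw_def)

lemma d\<Phi>_linear: "m \<in> W \<Longrightarrow> linear (d\<Phi> m)"
  by (rule smooth_on_linear[OF W(3)])

lemma d\<Phi>_has_derivative: "m \<in> W \<Longrightarrow> (\<Phi> has_derivative d\<Phi> m) (at m)"
  by (rule smooth_on_deriv[OF W(3)])

lemma d\<Phi>_inverse:
  assumes m: "m \<in> W" shows "fder (inv_into W \<Phi>) (\<Phi> m) (d\<Phi> m X) = X"
  by (rule derivative_local_unique[OF has_derivative_compose[OF d\<Phi>_has_derivative[OF m]
        smooth_on_deriv[OF W(4) \<Phi>_in[OF m]]] has_derivative_ident W(1) m]) (rule \<Phi>_inv)

lemma inverse: "contact W' W (inv_into W \<Phi>)"
proof
  have "smooth_on W (inv_into W' (inv_into W \<Phi>))"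
    by (rule smooth_on_cong[OF W(1,3)]) (simp add: inv_into_inv_into_eq[OF W(5)])
  moreover have "fder (inv_into W \<Phi>) n ` canonical_system n = canonical_system (inv_into W \<Phi> n)"
    if n: "n \<in> W'" for n
  proof -
    obtain m where m: "m \<in> W" "n = \<Phi> m" using n W(5) by (auto simp: bij_betw_def)
    show ?thesis
      unfolding m(2) \<Phi>_inv[OF m(1)] canonical[OF m(1), symmetric] image_image d\<Phi>_inverse[OF m(1)] by simp
  qed
  ultimately show "contact_transformation W' W (inv_into W \<Phi>)"
    using W bij_betw_inv_into[OF W(5)] by (simp add: contact_transformation_def)
qed

lemma pform_pullback_derivative:
  assumes m: "m \<in> W"
  shows "((\<lambda>m. pform c (\<Phi> m) (d\<Phi> m X)) has_derivative
    (\<lambda>Y. pform c (\<Phi> m) (hess \<Phi> m Y X) - pbil c (d\<Phi> m Y) (d\<Phi> m X))) (at m)"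
proof -
  note h = hess_deriv[OF W(1,3) m]
  have "((\<lambda>m. plin c (d\<Phi> m X) - pbil c (\<Phi> m) (d\<Phi> m X)) has_derivative
     (\<lambda>Y. plin c (hess \<Phi> m Y X) - (pbil c (\<Phi> m) (hess \<Phi> m Y X) + pbil c (d\<Phi> m Y) (d\<Phi> m X)))) (at m)"
    by (intro has_derivative_diff bounded_linear.has_derivative[OF plin_bounded_linear h]
        bounded_bilinear.FDERIV[OF pbil_bounded_bilinear d\<Phi>_has_derivative[OF m] h])
  then show ?thesis by (simp add: pform_eq diff_diff_eq)
qed

text \<open>\<open>\<Phi>\<^sup>* (pform c)\<close> is a combination of the three forms that define the canonical system; differentiating the
  coefficients contributes nothing on that system.\<close>

lemma dform_pullback:
  assumes m: "m \<in> W" and X: "X \<in> canonical_system m" and Y: "Y \<in> canonical_system m"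
  shows "dform c (d\<Phi> m X) (d\<Phi> m Y) = dform (pform c (\<Phi> m) (d\<Phi> m ep), pform c (\<Phi> m) (d\<Phi> m eq)) X Y"
proof -
  define \<theta> where "\<theta> V m = pform c (\<Phi> m) (d\<Phi> m V)" for V m
  have \<theta>_linear: "\<theta> (a *\<^sub>R V + b *\<^sub>R V') n = a * \<theta> V n + b * \<theta> V' n" if "n \<in> W" for a b V V' n
    unfolding \<theta>_def pform_eq
    by (simp add: linear_add[OF d\<Phi>_linear[OF that]] linear_cmul[OF d\<Phi>_linear[OF that]]
        bounded_linear.linear[OF plin_bounded_linear, THEN linear_add] bounded_linear.linear[OF plin_bounded_linear, THEN linear_cmul]
        bounded_bilinear.add_right[OF pbil_bounded_bilinear] bounded_bilinear.scaleR_right[OF pbil_bounded_bilinear] algebra_simps)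
  have dec: "\<theta> V n = (fst (snd (snd (fst V))) - zbil n V) * \<theta> ez n + pform (1, 0) n V * \<theta> ep n + pform (0, 1) n V * \<theta> eq n"
    if n: "n \<in> W" for V n
  proof -
    define a b d where "a = fst (snd (snd (fst V))) - zbil n V" "b = pform (1, 0) n V" "d = pform (0, 1) n V"
    \<comment> \<open>The projection of \<open>V\<close> to the canonical system along the three
      dual vectors; the pulled-back form vanishes on it.\<close>
    define V' where "V' = V - (a *\<^sub>R ez + b *\<^sub>R ep + d *\<^sub>R eq)"
    have "V' \<in> canonical_system n"
      unfolding canonical_system_iff
      by (cases n; cases V) (auto simp: V'_def a_b_d_def zbil_def algebra_simps)
    then have "d\<Phi> n V' \<in> canonical_system (\<Phi> n)" using canonical[OF n] by blast
    then have "\<theta> V' n = 0" unfolding \<theta>_def by (rule pform_canonical)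
    moreover have "V = 1 *\<^sub>R V' + 1 *\<^sub>R (a *\<^sub>R ez + 1 *\<^sub>R (b *\<^sub>R ep + d *\<^sub>R eq))" by (simp add: V'_def)
    ultimately show ?thesis
      unfolding a_b_d_def[symmetric]
      using \<theta>_linear[OF n, of 1 V' 1 "a *\<^sub>R ez + 1 *\<^sub>R (b *\<^sub>R ep + d *\<^sub>R eq)"]
        \<theta>_linear[OF n, of a ez 1 "b *\<^sub>R ep + d *\<^sub>R eq"] \<theta>_linear[OF n, of b ep d eq] by (simp only: mult_1 add_0 add.assoc)
  qed
  define a b d where abd: "a = \<theta> ez m" "b = \<theta> ep m" "d = \<theta> eq m"
  have key: "pform c (\<Phi> m) (hess \<Phi> m V' V) - pbil c (d\<Phi> m V') (d\<Phi> m V) = - a * zbil V' V - b * pbil (1, 0) V' V - d * pbil (0, 1) V' V"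
    if V: "V \<in> canonical_system m" for V V'
  proof -
    have d\<theta>: "(\<theta> E has_derivative fder (\<theta> E) m) (at m)" for E
    proof -
      have "\<theta> E differentiable (at m)"
        unfolding differentiable_def \<theta>_def using pform_pullback_derivative[OF m, of c E] by blast
      then show ?thesis using frechet_derivative_works by blast
    qed
    have lin: "((\<lambda>n. pform e n V) has_derivative (\<lambda>V'. - pbil e V' V)) (at m)" for e
      unfolding pform_eq
      using has_derivative_diff[OF has_derivative_const bounded_linear_imp_has_derivative[OF
          bounded_bilinear.bounded_linear_left[OF pbil_bounded_bilinear]]] by simp
    have linz: "((\<lambda>n. fst (snd (snd (fst V))) - zbil n V) has_derivative (\<lambda>V'. - zbil V' V)) (at m)"
      using has_derivative_diff[OF has_derivative_const bounded_linear_imp_has_derivative[OF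
          bounded_bilinear.bounded_linear_left[OF zbil_bounded_bilinear]]] by simp
    have V0: "fst (snd (snd (fst V))) - zbil m V = 0" "pform (1, 0) m V = 0" "pform (0, 1) m V = 0"
      using V unfolding canonical_system_iff by auto
    have "((\<lambda>n. (fst (snd (snd (fst V))) - zbil n V) * \<theta> ez n + pform (1, 0) n V * \<theta> ep n + pform (0, 1) n V * \<theta> eq n)
       has_derivative (\<lambda>V'. - zbil V' V * a + - pbil (1, 0) V' V * b + - pbil (0, 1) V' V * d)) (at m)"
      using has_derivative_add[OF has_derivative_add[OF has_derivative_mult[OF linz d\<theta>[of ez]]
            has_derivative_mult[OF lin[of "(1, 0)"] d\<theta>[of ep]]] has_derivative_mult[OF lin[of "(0, 1)"] d\<theta>[of eq]]]
      unfolding V0 abd mult_zero_left add_0_left .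
    moreover have "(\<theta> V has_derivative (\<lambda>V'. pform c (\<Phi> m) (hess \<Phi> m V' V) - pbil c (d\<Phi> m V') (d\<Phi> m V))) (at m)"
      using pform_pullback_derivative[OF m] unfolding \<theta>_def .
    ultimately have "- zbil V' V * a + - pbil (1, 0) V' V * b + - pbil (0, 1) V' V * d =
        pform c (\<Phi> m) (hess \<Phi> m V' V) - pbil c (d\<Phi> m V') (d\<Phi> m V)"
      by (rule derivative_local_unique[OF _ _ W(1) m]) (rule dec[symmetric])
    then show ?thesis by (simp add: mult.commute)
  qed
  \<comment> \<open>Antisymmetrising \<open>key\<close> in the two vectors cancels the second
    derivatives of \<Phi> by symmetry and the \<open>zbil\<close> terms by
    \<open>canonical_system_zbil\<close>.\<close>
  have "hess \<Phi> m X Y = hess \<Phi> m Y X" by (rule hess_sym[OF W(1,3) m])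
  then have "pbil c (d\<Phi> m Y) (d\<Phi> m X) - pbil c (d\<Phi> m X) (d\<Phi> m Y) =
     b * (pbil (1, 0) Y X - pbil (1, 0) X Y) + d * (pbil (0, 1) Y X - pbil (0, 1) X Y)"
    using key[OF X, of Y] key[OF Y, of X] canonical_system_zbil[OF X Y] by (simp add: algebra_simps)
  then have "dform c (d\<Phi> m X) (d\<Phi> m Y) = b * dform (1, 0) X Y + d * dform (0, 1) X Y"
    unfolding dform_pbil .
  also have "\<dots> = dform (b, d) X Y"
    by (cases X; cases Y) (auto simp: algebra_simps)
  finally show ?thesis by (simp add: abd \<theta>_def)
qed

text \<open>\<open>dform_pullback\<close> carries parameters from the target to the source, so the
  null cone is first reflected and only then, through the inverse map, preserved. The pulled-back
  parameter is nonzero: otherwise \<open>dform c\<close> would vanish on the entire canonical system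
  at the image point.\<close>

lemma null_vertical_reflected:
  assumes m: "m \<in> W" and V: "V \<in> canonical_system m" and n: "fst (d\<Phi> m V) = 0" "mink (snd (d\<Phi> m V)) (snd (d\<Phi> m V)) = 0"
  shows "fst V = 0 \<and> mink (snd V) (snd V) = 0"
proof -
  obtain c where c: "c \<noteq> 0" "\<And>Y. dform c (0, snd (d\<Phi> m V)) Y = 0"
    using vertical_null_dform(2)[OF n(2)] by blast
  have eq: "d\<Phi> m V = (0, snd (d\<Phi> m V))" using n(1) by (metis prod.collapse)
  define c' where "c' = (pform c (\<Phi> m) (d\<Phi> m ep), pform c (\<Phi> m) (d\<Phi> m eq))"
  have "c' \<noteq> 0"
  proof
    assume c': "c' = 0"
    have "dform 0 X Y = 0" for X Y by (cases X; cases Y) (auto simp: zero_prod_def)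
    then have "dform c (d\<Phi> m X) (d\<Phi> m Y) = 0" if "X \<in> canonical_system m" "Y \<in> canonical_system m" for X Y
      using dform_pullback[OF m that, of c] c' by (simp add: c'_def)
    then have "dform c X Y = 0" if "X \<in> canonical_system (\<Phi> m)" "Y \<in> canonical_system (\<Phi> m)" for X Y
      using that unfolding canonical[OF m, symmetric] by blast
    then show False using dform_nondegenerate c(1) by blast
  qed
  moreover have "dform c' V Y = 0" if "Y \<in> canonical_system m" for Y
    using dform_pullback[OF m V that, of c] c(2)[of "d\<Phi> m Y"] eq by (simp add: c'_def)
  ultimately show ?thesis using V by (rule dform_null_vertical)
qed

lemma null_vertical:
  assumes m: "m \<in> W" and v: "mink v v = 0"
  shows "fst (d\<Phi> m (0, v)) = 0" "mink (snd (d\<Phi> m (0, v))) (snd (d\<Phi> m (0, v))) = 0"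
proof -
  interpret inv: contact W' W "inv_into W \<Phi>" by (rule inverse)
  have "d\<Phi> m (0, v) \<in> canonical_system (\<Phi> m)"
    using canonical[OF m] vertical_null_dform(1)[OF v] by blast
  from inv.null_vertical_reflected[OF \<Phi>_in[OF m] this]
  show "fst (d\<Phi> m (0, v)) = 0" "mink (snd (d\<Phi> m (0, v))) (snd (d\<Phi> m (0, v))) = 0"
    by (simp_all add: d\<Phi>_inverse[OF m] v)
qed

definition "B m v = snd (d\<Phi> m (0, v))"

lemma B_linear: "m \<in> W \<Longrightarrow> linear (B m)"
proof -
  assume m: "m \<in> W"
  have eq: "(0, x + y) = ((0, x) :: jet2) + (0, y)" "(0, c *\<^sub>R x) = c *\<^sub>R ((0, x) :: jet2)" for x y c by auto
  show ?thesis
    unfolding B_def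
    by (rule linearI) (simp_all only: eq linear_add[OF d\<Phi>_linear[OF m]] linear_cmul[OF d\<Phi>_linear[OF m]] snd_add snd_scaleR)
qed

lemma vertical:
  assumes m: "m \<in> W" shows "d\<Phi> m (0, v) = (0, B m v)"
proof -
  obtain r s t where v: "v = (r, s, t)" by (cases v)
  \<comment> \<open>Three null vectors span the fibre direction, so verticality of the images of
    null vectors extends to all vertical vectors.\<close>
  have eq: "((0, v) :: jet2) = (r - s) *\<^sub>R (0, (1, 0, 0)) + s *\<^sub>R (0, (1, 1, 1)) + (t - s) *\<^sub>R (0, (0, 0, 1))"
    by (simp add: v)
  have "fst (d\<Phi> m (0, v)) = 0"
    unfolding eq linear_add[OF d\<Phi>_linear[OF m]] linear_cmul[OF d\<Phi>_linear[OF m]]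
    by (simp add: null_vertical(1)[OF m])
  then show ?thesis unfolding B_def by (metis prod.collapse)
qed

lemma B_null: "m \<in> W \<Longrightarrow> mink v v = 0 \<Longrightarrow> mink (B m v) (B m v) = 0"
  unfolding B_def by (rule null_vertical(2))

lemma B_surj:
  assumes m: "m \<in> W" shows "\<exists>v. B m v = w"
proof -
  interpret inv: contact W' W "inv_into W \<Phi>" by (rule inverse)
  have n: "\<Phi> m \<in> W'" by (rule \<Phi>_in[OF m])
  have "inv_into W' (inv_into W \<Phi>) (inv_into W \<Phi> (\<Phi> m)) = \<Phi> m"
    by (rule inv.\<Phi>_inv[OF n])
  have d: "fder (inv_into W' (inv_into W \<Phi>)) m = d\<Phi> m"
    by (rule frechet_derivative_transform_within_open[OF smooth_on_differentiable[OF inv.W(4) m] W(1) m])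
      (simp add: inv_into_inv_into_eq[OF W(5)])
  have "d\<Phi> m (0, inv.B (\<Phi> m) w) = (0, w)"
    using inv.d\<Phi>_inverse[OF n, of "(0, w)"] unfolding inv.vertical[OF n] \<Phi>_inv[OF m] d .
  then have "B m (inv.B (\<Phi> m) w) = w" by (simp add: B_def)
  then show ?thesis by blast
qed

end

text \<open>A quadratic form that vanishes on the null cone is a multiple of \<open>mink\<close>;
  this is applied to the pullback of \<open>mink\<close> under \<open>B\<close>.\<close>

lemma null_preserving_conformal:
  assumes B: "linear B" and null: "\<And>v. mink v v = 0 \<Longrightarrow> mink (B v) (B v) = 0"
  shows "\<exists>\<rho>. \<forall>v w. mink (B v) (B w) = \<rho> * mink v w"
proof -
  define e1 e2 e3 where e: "e1 = B (1, 0, 0)" "e2 = B (0, 1, 0)" "e3 = B (0, 0, 1)"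
  note Bv = linear_triple[OF B, folded e]
  define q12 q13 q22 q23 where q: "q12 = mink e1 e2" "q13 = mink e1 e3" "q22 = mink e2 e2" "q23 = mink e2 e3"
  have q0: "mink e1 e1 = 0" "mink e3 e3 = 0"
    using null[of "(1, 0, 0)"] null[of "(0, 0, 1)"] by (simp_all add: e)
  have Q: "mink (B (r, s, t)) (B (r', s', t')) = (r * s' + s * r') * q12 + (r * t' + t * r') * q13 + s * s' * q22 + (s * t' + t * s') * q23"
    for r s t r' s' t'
    unfolding Bv by (simp add: mink_simps q0 q mink_sym[of e2 e1] mink_sym[of e3 e1] mink_sym[of e3 e2] algebra_simps)
  have "mink (B (1, x, x * x)) (B (1, x, x * x)) = 0" for x by (rule null) simp
  from this[of 1] this[of "-1"] this[of 2]
  have "q12 = 0" "q23 = 0" "q22 = - 2 * q13" unfolding Q by simp_all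
  then have "mink (B v) (B w) = q13 * mink v w" for v w
    by (cases v; cases w) (simp add: Q algebra_simps)
  then show ?thesis by blast
qed

context contact
begin

lemma B_conformal:
  assumes m: "m \<in> W" shows "\<exists>\<rho>. \<rho> \<noteq> 0 \<and> (\<forall>v w. mink (B m v) (B m w) = \<rho> * mink v w)"
proof -
  obtain \<rho> where \<rho>: "\<And>v w. mink (B m v) (B m w) = \<rho> * mink v w"
    using null_preserving_conformal[OF B_linear[OF m] B_null[OF m]] by blast
  obtain v w where "B m v = (1, 0, 0)" "B m w = (0, 0, 1)" using B_surj[OF m] by metis
  then have "\<rho> \<noteq> 0" using \<rho>[of v w] by auto
  then show ?thesis using \<rho> by blast
qed

lemma hess_vertical:
  assumes m: "m \<in> W" shows "fst (hess \<Phi> m V (0, w)) = 0"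
  by (rule derivative_locally_const[OF has_derivative_fst[OF hess_deriv[OF W(1,3) m]] W(1) m])
    (simp add: vertical)

text \<open>Null lines of the fibres are mapped to null lines: differentiate the orthogonality relations
  \<open>B v \<bottom> B z\<close>, valid at every point for \<open>z \<bottom> v\<close>.\<close>

lemma hess_null:
  assumes m: "m \<in> W" and v: "mink v v = 0" "mink v2 v2 = 0" "mink v v2 \<noteq> 0"
  shows "\<exists>\<kappa>. hess \<Phi> m (0, v) (0, v) = (0, \<kappa> *\<^sub>R B m v)"
proof -
  define T where "T h z = snd (hess \<Phi> m (0, h) (0, z))" for h z
  have dB: "((\<lambda>m. B m z) has_derivative (\<lambda>V. snd (hess \<Phi> m V (0, z)))) (at m)" for z
    unfolding B_def by (rule has_derivative_snd[OF hess_deriv[OF W(1,3) m]])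
  have orth: "mink (B m v) (T h z) + mink (T h v) (B m z) = 0" if z: "mink v z = 0" for h z
  proof -
    have "mink (B n v) (B n z) = 0" if "n \<in> W" for n
      using B_conformal[OF that] z by (metis mult_zero_right)
    from derivative_locally_const[OF mink_FDERIV[OF dB dB] W(1) m this, of "(0, h)"]
    show ?thesis by (simp add: T_def)
  qed
  have Tsym: "T h z = T z h" for h z
    unfolding T_def by (rule arg_cong[OF hess_sym[OF W(1,3) m]])
  \<comment> \<open>Differentiate the orthogonality of \<open>B v\<close> and \<open>B z\<close>
    along \<open>v\<close>, and the nullity of \<open>B v\<close> along \<open>z\<close>; symmetry
    of \<open>T\<close> removes the cross term. So \<open>T v v\<close> is orthogonal to the image
    of every \<open>z\<close> orthogonal to \<open>v\<close>, hence parallel to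
    \<open>B m v\<close>.\<close>
  have Tz: "mink (T v v) (B m z) = 0" if z: "mink v z = 0" for z
    using orth[OF z, of v] orth[OF v(1), of z] mink_sym[of "B m v"] Tsym[of v z] by simp
  obtain k where k: "mink k v = 0" "mink k v2 = 0" "mink k k = - ((mink v v2)\<^sup>2 / 2)"
    using null_complement[OF v(1,2)] by blast
  obtain \<rho> where \<rho>: "\<rho> \<noteq> 0" "\<And>v w. mink (B m v) (B m w) = \<rho> * mink v w"
    using B_conformal[OF m] by blast
  have "T v v = (mink (T v v) (B m v2) / mink (B m v) (B m v2)) *\<^sub>R B m v
      + (mink (T v v) (B m v) / mink (B m v) (B m v2)) *\<^sub>R B m v2
      + (mink (T v v) (B m k) / mink (B m k) (B m k)) *\<^sub>R B m k"
    using v k \<rho>(1) by (intro mink_basis) (simp_all add: \<rho>(2))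
  then have "T v v = (mink (T v v) (B m v2) / mink (B m v) (B m v2)) *\<^sub>R B m v"
    using Tz[OF v(1)] Tz[of k] k(1) mink_sym[of k v] by simp
  then show ?thesis
    using hess_vertical[OF m, of "(0, v)" v] unfolding T_def by (metis prod.collapse)
qed

text \<open>The pullback of \<open>F'\<close> vanishes on the zero set of \<open>F\<close>, so
  \<open>hess_on_hypersurface\<close> relates the two Hessians by the ratio of the differentials,
  the same for both null vectors. The second derivative of \<Phi> contributes only through a
  multiple of the tangent vector \<open>B m v\<close>, by \<open>hess_null\<close>, and the
  differential of \<open>F'\<close> kills it.\<close>

lemma null_pair_image:
  assumes F: "open U" "smooth_on U F" and F': "open U'" "smooth_on U' F'"
    and FF': "\<And>x. x \<in> U \<Longrightarrow> x \<in> W \<Longrightarrow> F x = 0 \<Longrightarrow> \<Phi> x \<in> U' \<and> F' (\<Phi> x) = 0"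
    and m: "m \<in> U" "m \<in> W" "F m = 0" and nz: "vderiv F m u \<noteq> 0" "vderiv F' (\<Phi> m) u' \<noteq> 0"
    and np: "null_pair (vderiv F m) v1 v2"
  shows "null_pair (vderiv F' (\<Phi> m)) (B m v1) (B m v2)"
    "\<exists>\<mu>. \<mu> \<noteq> 0 \<and> vhess F' (\<Phi> m) (B m v1) = \<mu> * vhess F m v1 \<and> vhess F' (\<Phi> m) (B m v2) = \<mu> * vhess F m v2"
proof -
  define V where "V = U \<inter> {x \<in> W. \<Phi> x \<in> U'}"
  have V: "open V" unfolding V_def by (intro open_Int F(1) smooth_on_open_vimage[OF W(1,3) F'(1)])
  have VU: "V \<subseteq> U" "V \<subseteq> W" "\<Phi> ` V \<subseteq> U'" by (auto simp: V_def)
  have \<Phi>m: "\<Phi> m \<in> U'" "F' (\<Phi> m) = 0" using FF' m by auto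
  have mV: "m \<in> V" using m \<Phi>m by (simp add: V_def)
  have s\<Phi>: "smooth_on V \<Phi>" by (rule smooth_on_subset[OF W(3) VU(2)])
  have sF: "smooth_on V F" by (rule smooth_on_subset[OF F(2) VU(1)])
  define h where "h x = F' (\<Phi> x)" for x
  have sh: "smooth_on V h" unfolding h_def by (rule smooth_on_compose[OF V F'(1) VU(3) s\<Phi> F'(2)])
  have dh: "fder h x X = fder F' (\<Phi> x) (d\<Phi> x X)" if x: "x \<in> V" for x X
  proof -
    have "(h has_derivative (\<lambda>X. fder F' (\<Phi> x) (d\<Phi> x X))) (at x)"
      unfolding h_def
      by (rule has_derivative_compose[OF smooth_on_deriv[OF s\<Phi> x] smooth_on_deriv[OF F'(2)]])
        (use VU(3) x in blast)
    then show ?thesis by (rule fder_eq)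
  qed
  have hh: "hess h m X Y = hess F' (\<Phi> m) (d\<Phi> m X) (d\<Phi> m Y) + fder F' (\<Phi> m) (hess \<Phi> m X Y)" for X Y
  proof -
    have "((\<lambda>x. fder F' (\<Phi> x) (d\<Phi> x Y)) has_derivative
       (\<lambda>X. hess F' (\<Phi> m) (d\<Phi> m X) (d\<Phi> m Y) + fder F' (\<Phi> m) (hess \<Phi> m X Y))) (at m)"
      by (rule has_derivative_frechet_apply[OF V mV _ F' smooth_on_deriv[OF s\<Phi> mV] hess_deriv[OF V s\<Phi> mV]])
        (use VU(3) in blast)
    then have "((\<lambda>x. fder h x Y) has_derivative
       (\<lambda>X. hess F' (\<Phi> m) (d\<Phi> m X) (d\<Phi> m Y) + fder F' (\<Phi> m) (hess \<Phi> m X Y))) (at m)"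
      by (rule has_derivative_transform_within_open[OF _ V mV]) (simp only: dh)
    then show ?thesis unfolding hess_def[of h] by (rule fder_eq)
  qed
  have dhv: "fder h m (0, v) = vderiv F' (\<Phi> m) (B m v)" for v
    unfolding dh[OF mV] vertical[OF m(2)] ..
  have fh: "h y = 0" if "y \<in> V" "F y = 0" for y
    using FF'[of y] that VU by (auto simp: h_def)
  have A: "fder h m (0, v) = 0"
    "hess h m (0, v) (0, v) * vderiv F m u = fder h m (0, u) * hess F m (0, v) (0, v)"
    if "vderiv F m v = 0" for v
  proof -
    show "fder h m (0, v) = 0"
      by (rule hess_on_hypersurface(1)[OF V mV sF m(3) sh _ nz(1) that]) (rule fh)
    show "hess h m (0, v) (0, v) * vderiv F m u = fder h m (0, u) * hess F m (0, v) (0, v)"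
      by (rule hess_on_hypersurface(2)[OF V mV sF m(3) sh _ nz(1) that]) (rule fh)
  qed
  obtain \<rho> where \<rho>: "\<rho> \<noteq> 0" "\<And>v w. mink (B m v) (B m w) = \<rho> * mink v w"
    using B_conformal[OF m(2)] by blast
  show np': "null_pair (vderiv F' (\<Phi> m)) (B m v1) (B m v2)"
    using np A(1) \<rho>(1) unfolding null_pair_def dhv by (auto simp: \<rho>(2))
  have lF: "linear (vderiv F m)" and lF': "linear (vderiv F' (\<Phi> m))"
    using vderiv_linear smooth_on_differentiable F(2) F'(2) m(1) \<Phi>m(1) by blast+
  define \<mu> where "\<mu> = vderiv F' (\<Phi> m) (B m u) / vderiv F m u"
  \<comment> \<open>Otherwise the differential of \<open>F'\<close> would vanish on the image of
    \<open>B m\<close>, which is the whole vertical space.\<close>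
  have "\<mu> \<noteq> 0"
  proof
    assume "\<mu> = 0"
    then have 0: "vderiv F' (\<Phi> m) (B m u) = 0" using nz(1) by (simp add: \<mu>_def)
    obtain x where x: "B m x = u'" using B_surj[OF m(2)] by blast
    let ?x = "x - (vderiv F m x / vderiv F m u) *\<^sub>R u"
    have "vderiv F m ?x = 0" using nz(1) linear_diff[OF lF, of x] linear_cmul[OF lF, of _ u] by simp
    from A(1)[OF this] have "vderiv F' (\<Phi> m) (B m ?x) = 0" unfolding dhv .
    then have "vderiv F' (\<Phi> m) (B m x) = 0"
      unfolding linear_diff[OF B_linear[OF m(2)]] linear_cmul[OF B_linear[OF m(2)]] linear_diff[OF lF'] linear_cmul[OF lF'] 0 by simp
    then show False using x nz(2) by simp
  qed
  moreover have "vhess F' (\<Phi> m) (B m v) = \<mu> * vhess F m v" if v: "vderiv F m v = 0" "mink v v = 0" "mink w w = 0" "mink v w \<noteq> 0" for v w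
  proof -
    obtain \<kappa> where \<kappa>: "hess \<Phi> m (0, v) (0, v) = (0, \<kappa> *\<^sub>R B m v)" using hess_null[OF m(2) v(2-4)] by blast
    have "vderiv F' (\<Phi> m) (B m v) = 0" using A(1)[OF v(1)] unfolding dhv .
    then have "fder F' (\<Phi> m) (hess \<Phi> m (0, v) (0, v)) = 0"
      unfolding \<kappa> using linear_cmul[OF lF', of \<kappa>] by simp
    then have "hess h m (0, v) (0, v) = vhess F' (\<Phi> m) (B m v)"
      unfolding hh vertical[OF m(2)] vhess_def by simp
    then show ?thesis using A(2)[OF v(1)] nz(1) unfolding dhv \<mu>_def vhess_def by (simp add: field_simps)
  qed
  ultimately show "\<exists>\<mu>. \<mu> \<noteq> 0 \<and> vhess F' (\<Phi> m) (B m v1) = \<mu> * vhess F m v1 \<and> vhess F' (\<Phi> m) (B m v2) = \<mu> * vhess F m v2"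
    using np mink_sym[of v2 v1] unfolding null_pair_def by metis
qed

end


subsection \<open>The four classes\<close>

definition has_pattern :: "pde_class \<Rightarrow> (jet2 \<Rightarrow> real) \<Rightarrow> jet2 \<Rightarrow> bool" where
  "has_pattern k F m \<longleftrightarrow> (\<exists>v1 v2. null_pair (vderiv F m) v1 v2 \<and> null_pattern k (vhess F m v1) (vhess F m v2))"

lemma has_pattern_null_pair:
  assumes "open U" "smooth_on U F" "m \<in> U" "discr F m < 0" "null_pair (vderiv F m) v1 v2"
  shows "has_pattern k F m \<longleftrightarrow> null_pattern k (vhess F m v1) (vhess F m v2)"
proof -
  obtain u where "vderiv F m u \<noteq> 0" using discr_vderiv_nonzero[OF assms(4)] by blast
  then show ?thesis
    unfolding has_pattern_def using null_pattern_null_pair[OF assms(1-3) _ assms(5)] assms(5) by blast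
qed

lemma hyperbolic_pdeD:
  assumes "hyperbolic_pde U F \<Sigma>"
  shows "open U" "smooth_on U F" "m \<in> \<Sigma> \<longleftrightarrow> m \<in> U \<and> F m = 0" "m \<in> \<Sigma> \<Longrightarrow> discr F m < 0"
  using assms by (auto simp: hyperbolic_pde_def pde_def)

text \<open>A negative discriminant forces a nonzero vertical derivative. This gives regularity, and
  any base vector can be corrected by a vertical one to lie in the kernel of the
  differential.\<close>

lemma hyperbolic_pdeI:
  assumes U: "open U" "smooth_on U F" and \<Sigma>: "\<Sigma> = {m \<in> U. F m = 0}" and d: "\<And>m. m \<in> \<Sigma> \<Longrightarrow> discr F m < 0"
  shows "hyperbolic_pde U F \<Sigma>"
proof -
  have "(\<exists>v. fder F m v \<noteq> 0) \<and> fst ` {v. fder F m v = 0} = UNIV" if m: "m \<in> \<Sigma>" for m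
  proof -
    let ?D = "fder F m"
    obtain u where u: "?D (0, u) \<noteq> 0" using discr_vderiv_nonzero[OF d[OF m]] by blast
    have l: "linear ?D"
      using m \<Sigma> by (intro linear_frechet_derivative smooth_on_differentiable[OF U(2)]) simp
    have "x \<in> fst ` {v. ?D v = 0}" for x
    proof (rule image_eqI)
      show "x = fst ((x, 0) - (?D (x, 0) / ?D (0, u)) *\<^sub>R ((0, u) :: jet2))" by simp
      show "(x, 0) - (?D (x, 0) / ?D (0, u)) *\<^sub>R ((0, u) :: jet2) \<in> {v. ?D v = 0}"
        unfolding mem_Collect_eq linear_diff[OF l] linear_cmul[OF l] using u by simp
    qed
    then show ?thesis using u by blast
  qed
  then show ?thesis unfolding hyperbolic_pde_def pde_def using U \<Sigma> d by blast
qed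

text \<open>The disjunction about \<open>discr\<close> follows the two cases of
  \<open>oriented\<close>: an unchanged \<open>F\<close> gives equality of functions, a negated
  \<open>F\<close> gives it on \<open>U\<close>, where \<open>F\<close> is known to be
  differentiable.\<close>

lemma oriented_facts:
  assumes U: "open U" "smooth_on U F" "m \<in> U"
  defines "G \<equiv> oriented F m"
  shows "smooth_on U G" "discr G = discr F \<or> (\<forall>x\<in>U. discr G x = discr F x)"
    "\<And>x. x \<in> U \<Longrightarrow> G x = 0 \<longleftrightarrow> F x = 0" "d_s G m \<ge> 0"
    "\<And>x v. x \<in> U \<Longrightarrow> vderiv G x v = 0 \<longleftrightarrow> vderiv F x v = 0"
    "\<And>x v. x \<in> U \<Longrightarrow> vhess G x v = 0 \<longleftrightarrow> vhess F x v = 0"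
proof -
  have neg: "fder (\<lambda>x. - F x) x v = - fder F x v" if "x \<in> U" for x v
    by (rule fder_eq[OF has_derivative_minus[OF smooth_on_deriv[OF U(2) that]]])
  have hneg: "vhess (\<lambda>x. - F x) x v = - vhess F x v" if "x \<in> U" for x v
    unfolding vhess_def by (rule hess_bounded_linear[OF U(1,2) that bounded_linear_minus[OF bounded_linear_ident]])
  show "smooth_on U G" unfolding G_def oriented_def using U smooth_on_minus[OF U(1,2)] by simp
  show "discr G = discr F \<or> (\<forall>x\<in>U. discr G x = discr F x)"
    unfolding G_def oriented_def by (auto simp: discr_def along_def neg power2_eq_square)
  show "\<And>x. x \<in> U \<Longrightarrow> G x = 0 \<longleftrightarrow> F x = 0" by (simp add: G_def oriented_def)
  show "d_s G m \<ge> 0" unfolding G_def oriented_def using neg[OF U(3)] by (simp add: along_def)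
  show "\<And>x v. x \<in> U \<Longrightarrow> vderiv G x v = 0 \<longleftrightarrow> vderiv F x v = 0" by (simp add: G_def oriented_def neg)
  show "\<And>x v. x \<in> U \<Longrightarrow> vhess G x v = 0 \<longleftrightarrow> vhess F x v = 0" by (simp add: G_def oriented_def hneg)
qed

lemma null_pair_cong: "(\<And>v. l v = 0 \<longleftrightarrow> l' v = 0) \<Longrightarrow> null_pair l v1 v2 \<longleftrightarrow> null_pair l' v1 v2"
  by (simp add: null_pair_def)

context
  fixes U F \<Sigma> assumes hyp: "hyperbolic_pde U F \<Sigma>"
begin

private lemma U: "open U" "smooth_on U F" and \<Sigma>: "m \<in> \<Sigma> \<longleftrightarrow> m \<in> U \<and> F m = 0" and neg: "m \<in> \<Sigma> \<Longrightarrow> discr F m < 0"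
  using hyperbolic_pdeD[OF hyp] by auto

lemma oriented_domain:
  assumes m: "m \<in> \<Sigma>"
  shows "smooth_on U (oriented F m)" "m \<in> U" "oriented F m m = 0" "discr (oriented F m) m < 0" "lambda_plus (oriented F m) m > 0"
proof -
  have mU: "m \<in> U" using m \<Sigma> by blast
  note o = oriented_facts[OF U mU]
  show "smooth_on U (oriented F m)" "m \<in> U" by (fact o(1) mU)+
  show "oriented F m m = 0" using o(3)[OF mU] m \<Sigma> by blast
  show d: "discr (oriented F m) m < 0" using o(2) neg[OF m] mU by auto
  then show "lambda_plus (oriented F m) m > 0"
    using o(4) unfolding lambda_plus_def by (intro add_nonneg_pos) auto
qed

text \<open>Moves the invariants from the oriented function back to \<open>F\<close>: changing the
  sign alters neither the null pair nor the vanishing of second derivatives.\<close>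

lemma oriented_null_pair:
  assumes m: "m \<in> \<Sigma>"
  obtains v1 v2 where "null_pair (vderiv F m) v1 v2"
    "I1 (oriented F m) m = 0 \<longleftrightarrow> vhess F m v1 = 0" "I2 (oriented F m) m = 0 \<longleftrightarrow> vhess F m v2 = 0"
proof -
  let ?G = "oriented F m"
  note G = oriented_domain[OF m] and o = oriented_facts[OF U oriented_domain(2)[OF m]]
  have "null_pair (vderiv ?G m) (null1 ?G m) (null2 ?G m)"
    by (rule null_pair_null12[OF smooth_on_differentiable[OF G(1,2)] G(4,5)])
  then have "null_pair (vderiv F m) (null1 ?G m) (null2 ?G m)"
    using null_pair_cong[of "vderiv ?G m" "vderiv F m"] o(5)[OF G(2)] by blast
  then show ?thesis
    using I12_vhess[OF U(1) G(1,2,4,5)] o(6)[OF G(2)] by (intro that) auto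
qed

lemma pattern_I12:
  assumes m: "m \<in> \<Sigma>"
  shows "has_pattern MongeAmpere F m \<longleftrightarrow> I1 (oriented F m) m = 0 \<and> I2 (oriented F m) m = 0"
    "has_pattern Goursat F m \<longleftrightarrow> (I1 (oriented F m) m = 0) \<noteq> (I2 (oriented F m) m = 0)"
proof -
  obtain v1 v2 where v: "null_pair (vderiv F m) v1 v2"
    "I1 (oriented F m) m = 0 \<longleftrightarrow> vhess F m v1 = 0" "I2 (oriented F m) m = 0 \<longleftrightarrow> vhess F m v2 = 0"
    by (rule oriented_null_pair[OF m])
  have "m \<in> U" using m \<Sigma> by blast
  note p = has_pattern_null_pair[OF U this neg[OF m] v(1)]
  show "has_pattern MongeAmpere F m \<longleftrightarrow> I1 (oriented F m) m = 0 \<and> I2 (oriented F m) m = 0"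
    "has_pattern Goursat F m \<longleftrightarrow> (I1 (oriented F m) m = 0) \<noteq> (I2 (oriented F m) m = 0)"
    using p[of MongeAmpere] p[of Goursat] v(2,3) by simp_all
qed

text \<open>Whichever moving frame produced \<open>l1\<close> and \<open>l2\<close>, their pattern
  is that of \<open>F\<close> at the point. The existential choice of a frame in the surface classes
  is therefore harmless.\<close>

lemma ell_values_fibre:
  assumes ell: "ell_values (cone {u. (\<xi>, u) \<in> \<Sigma>}) (c *\<^sub>R qpt p) l1 l2" and c: "c \<noteq> 0"
  shows "(\<xi>, p) \<in> \<Sigma> \<and> (has_pattern k F (\<xi>, p) \<longleftrightarrow> null_pattern k l1 l2)"
proof -
  let ?f = "\<lambda>u. F (\<xi>, u)"
  define S where "S = {u. (\<xi>, u) \<in> U}"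
  have S: "open S" "smooth_on S ?f" unfolding S_def by (rule fibre_open[OF U(1)] smooth_on_fibre[OF U])+
  have Z: "{u. (\<xi>, u) \<in> \<Sigma>} = {u \<in> S. ?f u = 0}" by (auto simp: S_def \<Sigma>)
  obtain D X N1 N2 n a c' where fr: "moving_frame (cone {u. (\<xi>, u) \<in> \<Sigma>}) D X N1 N2 n" and a: "a \<in> D"
    and w: "c *\<^sub>R qpt p = c' *\<^sub>R X a" and l: "l1 = ell X N1 n a" "l2 = ell X N2 n a"
    using ell unfolding ell_values_def by blast
  have nz: "\<exists>w. fder ?f u w \<noteq> 0" if "u \<in> {u. (\<xi>, u) \<in> \<Sigma>}" for u
    using discr_vderiv_nonzero[OF neg[of "(\<xi>, u)"]] that fibre_frechet[OF U(2), of \<xi> u] \<Sigma> by auto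
  obtain p' \<kappa> c0 v1 v2 where p': "p' \<in> {u. (\<xi>, u) \<in> \<Sigma>}" "c0 \<noteq> 0" "X a = c0 *\<^sub>R qpt p'" "\<kappa> \<noteq> 0"
    "null_pair (fder ?f p') v1 v2"
    "ell X N1 n a = \<kappa> * hess ?f p' v1 v1" "ell X N2 n a = \<kappa> * hess ?f p' v2 v2"
    by (rule moving_frame_ell[OF S Z nz fr a])
  have "c' \<noteq> 0" using w c qpt_nonzero[of p] by auto
  then have "dehom (c *\<^sub>R qpt p) = p'" using w p'(2,3) dehom_qpt[of "c' * c0" p'] by simp
  then have pp: "p' = p" using dehom_qpt[OF c] by simp
  then have m: "(\<xi>, p) \<in> \<Sigma>" using p'(1) by simp
  have mU: "(\<xi>, p) \<in> U" using m \<Sigma> by blast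
  have np: "null_pair (vderiv F (\<xi>, p)) v1 v2" using p'(5) unfolding pp fibre_frechet[OF U(2) mU] .
  have "l1 = \<kappa> * vhess F (\<xi>, p) v1" "l2 = \<kappa> * vhess F (\<xi>, p) v2"
    unfolding l p'(6,7) pp fibre_hess[OF U mU] vhess_def by simp_all
  moreover have "\<kappa> * \<kappa> > 0" using p'(4) by (auto simp: zero_less_mult_iff linorder_neq_iff)
  ultimately have "null_pattern k l1 l2 \<longleftrightarrow> has_pattern k F (\<xi>, p)"
    using null_pattern_scale has_pattern_null_pair[OF U mU neg[OF m] np] by metis
  then show ?thesis using m by blast
qed

lemma ell_values_exist:
  assumes m: "(\<xi>, p) \<in> \<Sigma>" and c: "c \<noteq> 0"
  shows "\<exists>l1 l2. ell_values (cone {u. (\<xi>, u) \<in> \<Sigma>}) (c *\<^sub>R qpt p) l1 l2"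
proof -
  let ?G = "oriented F (\<xi>, p)"
  note G = oriented_domain[OF m]
  have "{u. (\<xi>, u) \<in> U \<and> ?G (\<xi>, u) = 0} = {u. (\<xi>, u) \<in> \<Sigma>}"
    using oriented_facts(3)[OF U G(2)] \<Sigma> by blast
  then obtain D X N1 N2 n a where "moving_frame (cone {u. (\<xi>, u) \<in> \<Sigma>}) D X N1 N2 n" "a \<in> D" "X a = qpt p"
    using moving_frame_exists[OF U(1) G] by auto
  then show ?thesis unfolding ell_values_def by metis
qed

lemma fibre_pattern_iff:
  "(\<forall>m\<in>\<Sigma>. has_pattern k F m) \<longleftrightarrow>
   (\<forall>\<xi>. \<forall>w \<in> quadric_cone (fibre \<Sigma> \<xi>). \<exists>l1 l2. ell_values (quadric_cone (fibre \<Sigma> \<xi>)) w l1 l2 \<and> null_pattern k l1 l2)"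
  (is "?L \<longleftrightarrow> ?R")
proof
  assume L: ?L
  show ?R
  proof (intro allI ballI)
    fix \<xi> w assume "w \<in> quadric_cone (fibre \<Sigma> \<xi>)"
    then obtain c p where cp: "w = c *\<^sub>R qpt p" "c \<noteq> 0" "(\<xi>, p) \<in> \<Sigma>"
      unfolding quadric_cone_fibre by (auto simp: cone_def)
    obtain l1 l2 where "ell_values (cone {u. (\<xi>, u) \<in> \<Sigma>}) w l1 l2"
      using ell_values_exist[OF cp(3,2)] cp(1) by blast
    moreover have "null_pattern k l1 l2"
      using ell_values_fibre[OF calculation[unfolded cp(1)] cp(2)] L cp(3) by blast
    ultimately show "\<exists>l1 l2. ell_values (quadric_cone (fibre \<Sigma> \<xi>)) w l1 l2 \<and> null_pattern k l1 l2"
      unfolding quadric_cone_fibre by blast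
  qed
next
  assume R: ?R
  show ?L
  proof
    fix m assume m: "m \<in> \<Sigma>"
    obtain \<xi> p where mp: "m = (\<xi>, p)" by (cases m)
    have "1 *\<^sub>R qpt p \<in> quadric_cone (fibre \<Sigma> \<xi>)"
      unfolding quadric_cone_fibre using m mp cone_qpt[of 1] by simp
    then obtain l1 l2 where "ell_values (cone {u. (\<xi>, u) \<in> \<Sigma>}) (1 *\<^sub>R qpt p) l1 l2" "null_pattern k l1 l2"
      using R unfolding quadric_cone_fibre by blast
    then show "has_pattern k F m" using ell_values_fibre[of \<xi> 1 p l1 l2 k] mp by simp
  qed
qed

lemma in_class_pattern: "in_class k F \<Sigma> \<longleftrightarrow> (\<forall>m\<in>\<Sigma>. has_pattern k F m)"
proof (cases k)
  case TwoElliptic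
  then show ?thesis
    using fibre_pattern_iff[of TwoElliptic] by (simp add: two_elliptic_pde_def two_elliptic_def sgn_1_pos)
next
  case TwoHyperbolic
  then show ?thesis
    using fibre_pattern_iff[of TwoHyperbolic] by (simp add: two_hyperbolic_pde_def two_hyperbolic_def sgn_1_neg)
qed (simp_all add: monge_ampere_def goursat_def pattern_I12)

lemma goursat_iff: "goursat F \<Sigma> \<longleftrightarrow> (\<forall>\<xi>. singly_ruled (quadric_cone (fibre \<Sigma> \<xi>)))"
  using fibre_pattern_iff[of Goursat] in_class_pattern[of Goursat] by (simp add: singly_ruled_def)

section \<open>Monge-Ampere equations and indefinite spheres\<close>

lemma monge_ampere_spheres:
  assumes "monge_ampere F \<Sigma>" "M \<in> fibre_components \<Sigma> \<xi>"
  shows "open_in_indefinite_sphere (quadric_cone M)"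
proof -
  let ?f = "\<lambda>u. F (\<xi>, u)"
  define S where "S = {u. (\<xi>, u) \<in> {m \<in> U. discr F m < 0}}"
  define Z where "Z = {u. (\<xi>, u) \<in> \<Sigma>}"
  obtain C where C: "C \<in> components Z" "M = lagr \<xi> ` C"
    using assms(2) by (auto simp: fibre_components_def Z_def)
  have V: "open {m \<in> U. discr F m < 0}"
    using smooth_on_open_vimage[OF U(1) smooth_on_discr[OF U] open_lessThan[of 0]] by simp
  have "umbilic_surface S ?f Z"
  proof
    show "open S" unfolding S_def by (rule fibre_open[OF V])
    show "smooth_on S ?f" unfolding S_def by (rule smooth_on_fibre[OF V smooth_on_subset[OF U(2)]]) blast
    show "Z = {u \<in> S. ?f u = 0}" using neg \<Sigma> unfolding Z_def S_def by blast
    show "mink (mink_dual (fder ?f u)) (mink_dual (fder ?f u)) < 0" if "u \<in> S" for u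
      using that fibre_frechet[OF U(2), of \<xi> u] discr_mink_dual[of F "(\<xi>, u)"] by (simp add: S_def)
    show "\<exists>v1 v2. null_pair (fder ?f u) v1 v2 \<and> hess ?f u v1 v1 = 0 \<and> hess ?f u v2 v2 = 0" if "u \<in> Z" for u
    proof -
      have m: "(\<xi>, u) \<in> \<Sigma>" "(\<xi>, u) \<in> U" using that \<Sigma> by (auto simp: Z_def)
      obtain v1 v2 where v: "null_pair (vderiv F (\<xi>, u)) v1 v2"
        "I1 (oriented F (\<xi>, u)) (\<xi>, u) = 0 \<longleftrightarrow> vhess F (\<xi>, u) v1 = 0" "I2 (oriented F (\<xi>, u)) (\<xi>, u) = 0 \<longleftrightarrow> vhess F (\<xi>, u) v2 = 0"
        by (rule oriented_null_pair[OF m(1)])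
      then have "vhess F (\<xi>, u) v1 = 0" "vhess F (\<xi>, u) v2 = 0"
        using assms(1) m(1) by (auto simp: monge_ampere_def)
      then show ?thesis
        unfolding fibre_hess[OF U m(2)] fibre_frechet[OF U(2) m(2)] vhess_def using v(1) by blast
    qed
  qed
  from umbilic_surface.component_in_sphere[OF this C(1)] show ?thesis
    unfolding C(2) quadric_cone_image .
qed

lemma spheres_monge_ampere:
  assumes "\<And>\<xi> M. M \<in> fibre_components \<Sigma> \<xi> \<Longrightarrow> open_in_indefinite_sphere (quadric_cone M)"
  shows "monge_ampere F \<Sigma>"
  unfolding monge_ampere_def
proof
  fix m assume m: "m \<in> \<Sigma>"
  obtain \<xi> p where mp: "m = (\<xi>, p)" by (cases m)
  let ?f = "\<lambda>u. F (\<xi>, u)"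
  define S where "S = {u. (\<xi>, u) \<in> U}"
  define Z where "Z = {u. (\<xi>, u) \<in> \<Sigma>}"
  have S: "open S" "smooth_on S ?f" unfolding S_def by (rule fibre_open[OF U(1)] smooth_on_fibre[OF U])+
  have Z: "Z = {u \<in> S. ?f u = 0}" by (auto simp: S_def Z_def \<Sigma>)
  have mU: "(\<xi>, p) \<in> U" using m mp \<Sigma> by blast
  have "p \<in> \<Union> (components Z)" unfolding Union_components[symmetric] using m mp by (simp add: Z_def)
  then obtain C where C: "C \<in> components Z" "p \<in> C" by blast
  have "lagr \<xi> ` C \<in> fibre_components \<Sigma> \<xi>" using C(1) by (auto simp: fibre_components_def Z_def)
  then have sph: "open_in_indefinite_sphere (cone C)" using assms quadric_cone_image by metis
  have CZ: "C \<subseteq> {u \<in> S. ?f u = 0}" using in_components_subset[OF C(1)] Z by simp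
  obtain u where u: "fder ?f p u \<noteq> 0"
    using discr_vderiv_nonzero[OF neg[OF m]] unfolding mp fibre_frechet[OF U(2) mU] by blast
  obtain v1 v2 where v: "null_pair (vderiv F m) v1 v2"
    "I1 (oriented F m) m = 0 \<longleftrightarrow> vhess F m v1 = 0" "I2 (oriented F m) m = 0 \<longleftrightarrow> vhess F m v2 = 0"
    by (rule oriented_null_pair[OF m])
  have "vhess F m v = 0" if "vderiv F m v = 0" "mink v v = 0" for v
    using sphere_null_hess[OF S CZ C(2) u sph, of v] that
    unfolding mp fibre_frechet[OF U(2) mU] fibre_hess[OF U mU] vhess_def by blast
  then show "I1 (oriented F m) m = 0 \<and> I2 (oriented F m) m = 0"
    using v by (auto simp: null_pair_def)
qed

lemma hyperbolic_restrict:
  assumes "open W" shows "hyperbolic_pde (U \<inter> W) F (\<Sigma> \<inter> W)"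
  using assms U neg by (intro hyperbolic_pdeI) (auto simp: \<Sigma> intro: smooth_on_subset)

text \<open>The defining function is \<open>F\<close> composed with the inverse of \<Phi>.
  Hyperbolicity is not checked by transforming \<open>discr\<close>: a null pair is pushed forward
  by the conformal map \<open>B\<close>, and \<open>null_pair_timelike\<close> turns it into a
  negative discriminant.\<close>

lemma hyperbolic_image:
  assumes "contact_transformation W W' \<Phi>"
  shows "\<exists>U' F'. hyperbolic_pde U' F' (\<Phi> ` (\<Sigma> \<inter> W))"
proof -
  interpret contact W W' \<Phi> by (rule contact.intro[OF assms])
  define \<Psi> where "\<Psi> = inv_into W \<Phi>"
  define U' where "U' = {n \<in> W'. \<Psi> n \<in> U}"
  define F' where "F' n = F (\<Psi> n)" for n
  have U': "open U'" unfolding U'_def \<Psi>_def by (rule smooth_on_open_vimage[OF W(2,4) U(1)])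
  have s\<Psi>: "smooth_on U' \<Psi>" unfolding U'_def \<Psi>_def by (rule smooth_on_subset[OF W(4)]) blast
  have sF': "smooth_on U' F'" unfolding F'_def
    by (rule smooth_on_compose[OF U' U(1) _ s\<Psi> U(2)]) (auto simp: U'_def)
  have inW: "\<Psi> n \<in> W" "\<Phi> (\<Psi> n) = n" if "n \<in> W'" for n
    using that W(5) unfolding \<Psi>_def bij_betw_def by (metis inv_into_into f_inv_into_f)+
  have img: "\<Phi> ` (\<Sigma> \<inter> W) = {n \<in> U'. F' n = 0}"
  proof (intro set_eqI iffI)
    fix n assume "n \<in> \<Phi> ` (\<Sigma> \<inter> W)"
    then obtain m where m: "m \<in> \<Sigma>" "m \<in> W" "n = \<Phi> m" by blast
    then show "n \<in> {n \<in> U'. F' n = 0}" using \<Phi>_in \<Phi>_inv \<Sigma> by (simp add: U'_def F'_def \<Psi>_def)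
  next
    fix n assume n: "n \<in> {n \<in> U'. F' n = 0}"
    then have "\<Psi> n \<in> \<Sigma> \<inter> W" "n = \<Phi> (\<Psi> n)" using inW by (auto simp: U'_def F'_def \<Sigma>)
    then show "n \<in> \<Phi> ` (\<Sigma> \<inter> W)" by blast
  qed
  have "discr F' n < 0" if ni: "n \<in> \<Phi> ` (\<Sigma> \<inter> W)" for n
  proof -
    obtain m where m: "m \<in> \<Sigma>" "m \<in> W" "n = \<Phi> m" using ni by blast
    have n: "n \<in> U'" using ni img by blast
    have dF': "vderiv F' n (B m v) = vderiv F m v" for v
    proof -
      have "(F' has_derivative (\<lambda>X. fder F (\<Psi> n) (fder \<Psi> n X))) (at n)"
        unfolding F'_def
        by (rule has_derivative_compose[OF smooth_on_deriv[OF s\<Psi> n] smooth_on_deriv[OF U(2)]])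
          (use n in \<open>simp add: U'_def\<close>)
      from fder_eq[OF this, of "(0, B m v)"]
      have "vderiv F' n (B m v) = fder F (\<Psi> n) (fder \<Psi> n (d\<Phi> m (0, v)))"
        unfolding vertical[OF m(2)] .
      then show ?thesis using d\<Phi>_inverse[OF m(2)] \<Phi>_inv[OF m(2)] by (simp add: m(3) \<Psi>_def)
    qed
    obtain v1 v2 where np: "null_pair (vderiv F m) v1 v2" using oriented_null_pair[OF m(1)] by metis
    obtain \<rho> where \<rho>: "\<rho> \<noteq> 0" "\<And>v w. mink (B m v) (B m w) = \<rho> * mink v w" using B_conformal[OF m(2)] by blast
    have np': "null_pair (vderiv F' n) (B m v1) (B m v2)" using np \<rho> by (simp add: null_pair_def dF')
    obtain u where "vderiv F m u \<noteq> 0" using discr_vderiv_nonzero[OF neg[OF m(1)]] by blast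
    then have "vderiv F' n (B m u) \<noteq> 0" by (simp add: dF')
    from null_pair_timelike[OF np' vderiv_linear[OF smooth_on_differentiable[OF sF' n]] this]
    show ?thesis unfolding discr_mink_dual by simp
  qed
  from hyperbolic_pdeI[OF U' sF' img this] show ?thesis by blast
qed

end

section \<open>Contact invariance and inequivalence of the classes\<close>

lemma in_class_contact:
  assumes hyp: "hyperbolic_pde U F \<Sigma>" and con: "contact_transformation W W' \<Phi>"
    and hyp': "hyperbolic_pde U' F' (\<Phi> ` (\<Sigma> \<inter> W))"
  shows "in_class k F (\<Sigma> \<inter> W) \<longleftrightarrow> in_class k F' (\<Phi> ` (\<Sigma> \<inter> W))"
proof -
  interpret contact W W' \<Phi> by (rule contact.intro[OF con])
  note U = hyperbolic_pdeD[OF hyp] and U' = hyperbolic_pdeD[OF hyp']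
  have "has_pattern k F m \<longleftrightarrow> has_pattern k F' (\<Phi> m)" if m: "m \<in> \<Sigma>" "m \<in> W" for m
  proof -
    have mU: "m \<in> U" "F m = 0" using m U(3) by auto
    have \<Phi>m: "\<Phi> m \<in> \<Phi> ` (\<Sigma> \<inter> W)" using m by blast
    then have \<Phi>mU: "\<Phi> m \<in> U'" using U'(3) by blast
    obtain v1 v2 where np: "null_pair (vderiv F m) v1 v2" using oriented_null_pair[OF hyp m(1)] by metis
    obtain u where u: "vderiv F m u \<noteq> 0" using discr_vderiv_nonzero[OF U(4)[OF m(1)]] by blast
    obtain u' where u': "vderiv F' (\<Phi> m) u' \<noteq> 0" using discr_vderiv_nonzero[OF U'(4)[OF \<Phi>m]] by blast
    have FF': "\<Phi> x \<in> U' \<and> F' (\<Phi> x) = 0" if "x \<in> U" "x \<in> W" "F x = 0" for x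
    proof -
      have "\<Phi> x \<in> \<Phi> ` (\<Sigma> \<inter> W)" using that U(3) by blast
      then show ?thesis using U'(3) by blast
    qed
    have im: "null_pair (vderiv F' (\<Phi> m)) (B m v1) (B m v2)"
      by (rule null_pair_image(1)[OF U(1,2) U'(1,2) _ mU(1) m(2) mU(2) u u' np]) (rule FF')
    have "\<exists>\<mu>. \<mu> \<noteq> 0 \<and> vhess F' (\<Phi> m) (B m v1) = \<mu> * vhess F m v1 \<and> vhess F' (\<Phi> m) (B m v2) = \<mu> * vhess F m v2"
      by (rule null_pair_image(2)[OF U(1,2) U'(1,2) _ mU(1) m(2) mU(2) u u' np]) (rule FF')
    then obtain \<mu> where \<mu>: "\<mu> \<noteq> 0" "vhess F' (\<Phi> m) (B m v1) = \<mu> * vhess F m v1" "vhess F' (\<Phi> m) (B m v2) = \<mu> * vhess F m v2"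
      by blast
    have "\<mu> * \<mu> > 0" using \<mu>(1) by (auto simp: zero_less_mult_iff linorder_neq_iff)
    then show ?thesis
      unfolding has_pattern_null_pair[OF U(1,2) mU(1) U(4)[OF m(1)] np]
        has_pattern_null_pair[OF U'(1,2) \<Phi>mU U'(4)[OF \<Phi>m] im] \<mu>(2,3)
      by (simp add: null_pattern_scale)
  qed
  then show ?thesis
    unfolding in_class_pattern[OF hyp'] in_class_pattern[OF hyperbolic_restrict[OF hyp W(1)]] by blast
qed

text \<open>Each class imposes its pattern at every point, so comparing the two patterns at a single
  common point decides. Such a point exists because the matched pieces are nonempty.\<close>

lemma class_unique:
  assumes hyp: "hyperbolic_pde U F \<Sigma>" and hyp': "hyperbolic_pde U' F' \<Sigma>'" and con: "contact_transformation W W' \<Phi>"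
    and eq: "\<Phi> ` (\<Sigma> \<inter> W) = \<Sigma>' \<inter> W'" and ne: "\<Sigma> \<inter> W \<noteq> {}" and k: "in_class k F \<Sigma>" "in_class k' F' \<Sigma>'"
  shows "k = k'"
proof -
  interpret contact W W' \<Phi> by (rule contact.intro[OF con])
  note hr = hyperbolic_restrict[OF hyp W(1)] and hr' = hyperbolic_restrict[OF hyp' W(2)]
  have "in_class k F (\<Sigma> \<inter> W)" using k(1) in_class_pattern[OF hyp] in_class_pattern[OF hr] by blast
  then have "in_class k F' (\<Sigma>' \<inter> W')" using in_class_contact[OF hyp con] hr' unfolding eq by blast
  moreover obtain n where n: "n \<in> \<Sigma>' \<inter> W'" using ne eq by blast
  ultimately have "has_pattern k F' n" "has_pattern k' F' n"
    using in_class_pattern[OF hr'] in_class_pattern[OF hyp'] k(2) by blast+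
  moreover obtain v1 v2 where np: "null_pair (vderiv F' n) v1 v2" using oriented_null_pair[OF hyp', of n] n by blast
  have "n \<in> U'" "discr F' n < 0" using n hyperbolic_pdeD[OF hyp'] by blast+
  note hp = has_pattern_null_pair[OF hyperbolic_pdeD(1,2)[OF hyp'] this np]
  ultimately show ?thesis using hp null_pattern_disjoint by blast
qed

theorem theorem4p9:
  fixes U :: "jet2 set" and F :: "jet2 \<Rightarrow> real" and \<Sigma> :: "jet2 set"
  assumes "hyperbolic_pde U F \<Sigma>"
  shows
    "(monge_ampere F \<Sigma> \<longleftrightarrow>
        (\<forall>\<xi>. \<forall>M \<in> fibre_components \<Sigma> \<xi>. open_in_indefinite_sphere (quadric_cone M))) \<and>
     (goursat F \<Sigma> \<longleftrightarrow> (\<forall>\<xi>. singly_ruled (quadric_cone (fibre \<Sigma> \<xi>)))) \<and>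
     (two_elliptic_pde \<Sigma> \<longleftrightarrow> (\<forall>\<xi>. two_elliptic (quadric_cone (fibre \<Sigma> \<xi>)))) \<and>
     (two_hyperbolic_pde \<Sigma> \<longleftrightarrow> (\<forall>\<xi>. two_hyperbolic (quadric_cone (fibre \<Sigma> \<xi>)))) \<and>
     (\<forall>W W' \<Phi>. contact_transformation W W' \<Phi> \<longrightarrow>
        (\<exists>U' F'. hyperbolic_pde U' F' (\<Phi> ` (\<Sigma> \<inter> W))) \<and>
        (\<forall>U' F' k. hyperbolic_pde U' F' (\<Phi> ` (\<Sigma> \<inter> W)) \<longrightarrow>
           (in_class k F (\<Sigma> \<inter> W) \<longleftrightarrow> in_class k F' (\<Phi> ` (\<Sigma> \<inter> W))))) \<and>
     (\<forall>U' F' \<Sigma>' W W' \<Phi> k k'.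
        hyperbolic_pde U' F' \<Sigma>' \<and> contact_transformation W W' \<Phi> \<and>
        \<Phi> ` (\<Sigma> \<inter> W) = \<Sigma>' \<inter> W' \<and> \<Sigma> \<inter> W \<noteq> {} \<and> in_class k F \<Sigma> \<and> in_class k' F' \<Sigma>' \<longrightarrow> k = k')"
proof (intro conjI)
  show "monge_ampere F \<Sigma> \<longleftrightarrow> (\<forall>\<xi>. \<forall>M \<in> fibre_components \<Sigma> \<xi>. open_in_indefinite_sphere (quadric_cone M))"
    using monge_ampere_spheres[OF assms] spheres_monge_ampere[OF assms] by blast
  show "goursat F \<Sigma> \<longleftrightarrow> (\<forall>\<xi>. singly_ruled (quadric_cone (fibre \<Sigma> \<xi>)))"
    by (rule goursat_iff[OF assms])
  show "two_elliptic_pde \<Sigma> \<longleftrightarrow> (\<forall>\<xi>. two_elliptic (quadric_cone (fibre \<Sigma> \<xi>)))"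
    by (rule two_elliptic_pde_def)
  show "two_hyperbolic_pde \<Sigma> \<longleftrightarrow> (\<forall>\<xi>. two_hyperbolic (quadric_cone (fibre \<Sigma> \<xi>)))"
    by (rule two_hyperbolic_pde_def)
  show "\<forall>W W' \<Phi>. contact_transformation W W' \<Phi> \<longrightarrow>
      (\<exists>U' F'. hyperbolic_pde U' F' (\<Phi> ` (\<Sigma> \<inter> W))) \<and>
      (\<forall>U' F' k. hyperbolic_pde U' F' (\<Phi> ` (\<Sigma> \<inter> W)) \<longrightarrow>
         (in_class k F (\<Sigma> \<inter> W) \<longleftrightarrow> in_class k F' (\<Phi> ` (\<Sigma> \<inter> W))))"
    using hyperbolic_image[OF assms] in_class_contact[OF assms] by blast
  show "\<forall>U' F' \<Sigma>' W W' \<Phi> k k'.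
      hyperbolic_pde U' F' \<Sigma>' \<and> contact_transformation W W' \<Phi> \<and>
      \<Phi> ` (\<Sigma> \<inter> W) = \<Sigma>' \<inter> W' \<and> \<Sigma> \<inter> W \<noteq> {} \<and> in_class k F \<Sigma> \<and> in_class k' F' \<Sigma>' \<longrightarrow> k = k'"
    using class_unique[OF assms] by blast
qed

end
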